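(* Let $\varepsilon=(\varepsilon_i)_{i=1}^n \in \{1,-1\}^n$. Then the following hold. (i) Let $V$ be a finite-dimensional irreducible $U_q(\mathfrak{g})^{\ge 0}$-module of type $\varepsilon$. Then the action of $U_q(\mathfrak{g})^{\ge 0}$ on $V$ extends uniquely to an action of $U_q(\mathfrak{g})$ on $V$. The resulting $U_q(\mathfrak{g})$-module structure on $V$ is irreducible and of type $\varepsilon$. (ii) Let $V$ be a finite-dimensional irreducible $U_q(\mathfrak{g})$-module of type $\varepsilon$. When the $U_q(\mathfrak{g})$-action is restricted to $U_q(\mathfrak{g})^{\ge 0}$, the resulting $U_q(\mathfrak{g})^{\ge 0}$-module structure on $V$ is irreducible and of type $\varepsilon$.
   Context: $\mathbb{F}$ is an algebraically closed field of characteristic $0$, $\mathbb{F}^\times=\mathbb{F}\setminus\{0\}$, and $q\in\mathbb{F}^\times$ is not a root of unity. $A=(A_{ij})$ is a symmetrizable generalized Cartan matrix of order $n$ and affine type (in the sense of Kac: indecomposable, of corank 1, with $Au=0$ for some column vector $u$ with positive entries). $s_1,\dots,s_n$ are relatively prime positive integers with $s_iA_{ij}=s_jA_{ji}$ for all $i,j$; put $q_i=q^{s_i}$, $[m]_i=\frac{q_i^m-q_i^{-m}}{q_i-q_i^{-1}}$, $[m]_i^!=[m]_i[m-1]_i\cdots[1]_i$ with $[0]_i^!=1$, and $\begin{bmatrix} m\\ r\end{bmatrix}_i=\frac{[m]_i^!}{[r]_i^![m-r]_i^!}$ for integers $m\ge r\ge 0$. $\mathfrak{g}=\mathfrak{g}'(A)$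 is the Kac-Moody algebra over $\mathbb{C}$ of $A$. $U_q(\mathfrak{g})$ is the unital associative $\mathbb{F}$-algebra with generators $E_i,F_i,K_i^{\pm1}$ ($1\le i\le n$) and relations: $K_iK_i^{-1}=K_i^{-1}K_i=1$; $K_iK_j=K_jK_i$; $K_iE_jK_i^{-1}=q_i^{A_{ij}}E_j$; $K_iF_jK_i^{-1}=q_i^{-A_{ij}}F_j$; $E_iF_j-F_jE_i=\delta_{ij}\frac{K_i-K_i^{-1}}{q_i-q_i^{-1}}$; and, for $i\ne j$, $\sum_{r=0}^{1-A_{ij}}(-1)^r\begin{bmatrix}1-A_{ij}\\ r\end{bmatrix}_iE_i^{1-A_{ij}-r}E_jE_i^r=0$ and the same relation with every $E$ replaced by $F$. The Borel subalgebra $U_q(\mathfrak{g})^{\ge0}$ is the subalgebra of $U_q(\mathfrak{g})$ generated by $E_i,K_i^{\pm1}$ ($1\le i\le n$). Type of a $U_q(\mathfrak{g})$-module: for a finite-dimensional irreducible $U_q(\mathfrak{g})$-module $V$, each $K_i$ acts semisimply and there are $\varepsilon_i\in\{1,-1\}$ such that every eigenvalue of $K_i$ on $V$ is of the form $\varepsilon_iq_i^m$ ($m\in\mathbb{Z}$); $(\varepsilon_i)_{i=1}^n$ is the type of $V$. Type of a $U_q(\mathfrak{g})^{\ge0}$-module: for a finite-dimensional irreducible $U_q(\mathfrak{g})^{\ge0}$-module $V$, each $K_i$ acts semisimply and there are scalars $\alpha_i\in\mathbb{F}^\times$ such that the set of distinct eigenvalues of $K_i$ on $V$ is $\alpha_i\Delta_i$,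 where $\Delta_i\subseteq\{q_i^m\mid m\in\mathbb{Z}\}$ and $\Delta_i=\{\theta^{-1}\mid\theta\in\Delta_i\}$; $(\alpha_i)_{i=1}^n$ is the type of $V$. *)

theory Defs
  imports
    "HOL-Analysis.Cartesian_Space"
    "HOL-Computational_Algebra.Polynomial"
    "HOL-Library.Poly_Mapping"
    "HOL-Algebra.Module"
    "HOL-Algebra.QuotRing"
    "HOL-Algebra.Generated_Rings"
begin

section \<open>Affine generalized Cartan matrices\<close>

definition gen_cartan_matrix :: "int ^ 'n ^ 'n \<Rightarrow> bool" where
  "gen_cartan_matrix A \<longleftrightarrow>
     (\<forall>i. A $ i $ i = 2) \<and>
     (\<forall>i j. i \<noteq> j \<longrightarrow> A $ i $ j \<le> 0) \<and>
     (\<forall>i j. A $ i $ j = 0 \<longrightarrow> A $ j $ i = 0)"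

definition indecomposable_matrix :: "int ^ 'n ^ 'n \<Rightarrow> bool" where
  "indecomposable_matrix A \<longleftrightarrow>
     \<not> (\<exists>J. J \<noteq> {} \<and> J \<noteq> UNIV \<and>
          (\<forall>i \<in> J. \<forall>j \<in> - J. A $ i $ j = 0 \<and> A $ j $ i = 0))"

definition real_matrix :: "int ^ 'n ^ 'm \<Rightarrow> real ^ 'n ^ 'm" where
  "real_matrix A = (\<chi> i j. of_int (A $ i $ j))"

definition affine_cartan_matrix :: "int ^ 'n::finite ^ 'n \<Rightarrow> bool" where
  "affine_cartan_matrix A \<longleftrightarrow>
     gen_cartan_matrix A \<and>
     indecomposable_matrix A \<and>
     CARD('n) = rank (real_matrix A) + 1 \<and>
     (\<exists>u. (\<forall>i. u $ i > 0) \<and> real_matrix A *v u = 0)"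

text \<open>The numbers \<open>s i\<close> witness that \<open>A\<close> is symmetrizable.\<close>

definition symmetrizer :: "int ^ 'n ^ 'n \<Rightarrow> ('n \<Rightarrow> nat) \<Rightarrow> bool" where
  "symmetrizer A s \<longleftrightarrow>
     (\<forall>i. s i > 0) \<and> Gcd (range s) = 1 \<and>
     (\<forall>i j. int (s i) * A $ i $ j = int (s j) * A $ j $ i)"


section \<open>Quantum integers\<close>

definition qint :: "'a::field \<Rightarrow> nat \<Rightarrow> 'a" where
  "qint p m = (p ^ m - inverse p ^ m) / (p - inverse p)"

definition qfact :: "'a::field \<Rightarrow> nat \<Rightarrow> 'a" where
  "qfact p m = (\<Prod>k = 1..m. qint p k)"

definition qbinomial :: "'a::field \<Rightarrow> nat \<Rightarrow> nat \<Rightarrow> 'a" where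
  "qbinomial p m r = qfact p m / (qfact p r * qfact p (m - r))"


section \<open>Free associative algebras\<close>

datatype 'g free_word = Word (letters: "'g list")

instantiation free_word :: (type) monoid_add
begin

definition "0 = Word []"
definition "u + v = Word (letters u @ letters v)"

instance
  by standard (simp_all add: zero_free_word_def plus_free_word_def)

end

text \<open>
  The free algebra is the monoid algebra of the free monoid: finitely supported
  functions on words, with the convolution product of \<open>Poly_Mapping\<close>.
\<close>

type_synonym ('g, 'a) free_algebra = "'g free_word \<Rightarrow>\<^sub>0 'a"

definition fvar :: "'g \<Rightarrow> ('g, 'a::field) free_algebra" where
  "fvar g = Poly_Mapping.single (Word [g]) 1"

definition fconst :: "'a::field \<Rightarrow> ('g, 'a) free_algebra" where
  "fconst c = Poly_Mapping.single 0 c"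

definition free_ring :: "('g, 'a::field) free_algebra ring" where
  "free_ring = \<lparr>carrier = UNIV, mult = (*), one = 1, zero = 0, add = (+)\<rparr>"

definition presented_algebra ::
    "('g, 'a::field) free_algebra set \<Rightarrow> ('a, ('g, 'a) free_algebra set) module" where
  "presented_algebra rels =
     (let I = Idl\<^bsub>free_ring\<^esub> rels; Q = free_ring Quot I in
      \<lparr>carrier = carrier Q, mult = mult Q, one = one Q, zero = zero Q, add = add Q,
       smult = (\<lambda>c X. (I +>\<^bsub>free_ring\<^esub> fconst c) \<otimes>\<^bsub>Q\<^esub> X)\<rparr>)"

definition presented_gen ::
    "('g, 'a::field) free_algebra set \<Rightarrow> 'g \<Rightarrow> ('g, 'a) free_algebra set" where
  "presented_gen rels g = (Idl\<^bsub>free_ring\<^esub> rels) +>\<^bsub>free_ring\<^esub> fvar g"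

text \<open>The unital subalgebra generated by \<open>S\<close> is the subring generated by \<open>S\<close> and the scalars.\<close>

definition generated_subalgebra :: "('a, 'u) module \<Rightarrow> 'u set \<Rightarrow> 'u set" where
  "generated_subalgebra U S =
     generate_ring U (range (\<lambda>c. c \<odot>\<^bsub>U\<^esub> \<one>\<^bsub>U\<^esub>) \<union> S)"


section \<open>The quantized enveloping algebra and its Borel subalgebra\<close>

datatype 'n uq_gen = GenE 'n | GenF 'n | GenK 'n | GenKinv 'n

abbreviation fE :: "'n \<Rightarrow> ('n uq_gen, 'a::field) free_algebra" where "fE i \<equiv> fvar (GenE i)"
abbreviation fF :: "'n \<Rightarrow> ('n uq_gen, 'a::field) free_algebra" where "fF i \<equiv> fvar (GenF i)"
abbreviation fK :: "'n \<Rightarrow> ('n uq_gen, 'a::field) free_algebra" where "fK i \<equiv> fvar (GenK i)"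
abbreviation fKinv :: "'n \<Rightarrow> ('n uq_gen, 'a::field) free_algebra" where
  "fKinv i \<equiv> fvar (GenKinv i)"

text \<open>With \<open>N = 1 - A\<^sub>i\<^sub>j\<close>; this is only used for \<open>i \<noteq> j\<close>, where \<open>N\<close> is positive.\<close>

definition serre_poly ::
    "int ^ 'n ^ 'n \<Rightarrow> ('n \<Rightarrow> nat) \<Rightarrow> 'a::field \<Rightarrow> ('n \<Rightarrow> ('n uq_gen, 'a) free_algebra) \<Rightarrow>
     'n \<Rightarrow> 'n \<Rightarrow> ('n uq_gen, 'a) free_algebra" where
  "serre_poly A s q X i j =
     (let N = nat (1 - A $ i $ j) in
      \<Sum>r = 0..N. fconst ((-1) ^ r * qbinomial (q ^ s i) N r) * X i ^ (N - r) * X j * X i ^ r)"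

text \<open>A relation \<open>a = b\<close> is encoded by the element \<open>a - b\<close>.\<close>

definition uq_relations ::
    "int ^ 'n ^ 'n \<Rightarrow> ('n \<Rightarrow> nat) \<Rightarrow> 'a::field \<Rightarrow> ('n uq_gen, 'a) free_algebra set" where
  "uq_relations A s q =
     {fK i * fKinv i - 1 | i. True} \<union>
     {fKinv i * fK i - 1 | i. True} \<union>
     {fK i * fK j - fK j * fK i | i j. True} \<union>
     {fK i * fE j * fKinv i - fconst ((q ^ s i) powi (A $ i $ j)) * fE j | i j. True} \<union>
     {fK i * fF j * fKinv i - fconst ((q ^ s i) powi (- (A $ i $ j))) * fF j | i j. True} \<union>
     {fE i * fF j - fF j * fE i
        - (if i = j then fconst (inverse (q ^ s i - inverse (q ^ s i))) * (fK i - fKinv i)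
           else 0) | i j. True} \<union>
     {serre_poly A s q fE i j | i j. i \<noteq> j} \<union>
     {serre_poly A s q fF i j | i j. i \<noteq> j}"

definition uq ::
    "int ^ 'n ^ 'n \<Rightarrow> ('n \<Rightarrow> nat) \<Rightarrow> 'a::field \<Rightarrow> ('a, ('n uq_gen, 'a) free_algebra set) module"
  where "uq A s q = presented_algebra (uq_relations A s q)"

definition uq_gen ::
    "int ^ 'n ^ 'n \<Rightarrow> ('n \<Rightarrow> nat) \<Rightarrow> 'a::field \<Rightarrow> 'n uq_gen \<Rightarrow> ('n uq_gen, 'a) free_algebra set"
  where "uq_gen A s q g = presented_gen (uq_relations A s q) g"

definition uq_borel ::
    "int ^ 'n ^ 'n \<Rightarrow> ('n \<Rightarrow> nat) \<Rightarrow> 'a::field \<Rightarrow> ('a, ('n uq_gen, 'a) free_algebra set) module"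
  where
  "uq_borel A s q = (uq A s q)
     \<lparr>carrier := generated_subalgebra (uq A s q)
        (uq_gen A s q ` (range GenE \<union> range GenK \<union> range GenKinv))\<rparr>"


section \<open>Modules over an associative algebra\<close>

text \<open>
  A left module over an associative unital algebra \<open>U\<close>, with underlying vector space
  the whole type \<open>'v\<close>.  The values of \<open>act\<close> outside \<open>carrier U\<close> are irrelevant.
\<close>

locale alg_module = vector_space scale
  for scale :: "'a::field \<Rightarrow> 'v::ab_group_add \<Rightarrow> 'v" +
  fixes U :: "('a, 'u) module" and act :: "'u \<Rightarrow> 'v \<Rightarrow> 'v"
  assumes act_linear: "x \<in> carrier U \<Longrightarrow> Vector_Spaces.linear scale scale (act x)"
    and act_add: "x \<in> carrier U \<Longrightarrow> y \<in> carrier U \<Longrightarrow> act (x \<oplus>\<^bsub>U\<^esub> y) v = act x v + act y v"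
    and act_smult: "x \<in> carrier U \<Longrightarrow> act (c \<odot>\<^bsub>U\<^esub> x) v = scale c (act x v)"
    and act_mult: "x \<in> carrier U \<Longrightarrow> y \<in> carrier U \<Longrightarrow> act (x \<otimes>\<^bsub>U\<^esub> y) v = act x (act y v)"
    and act_one: "act \<one>\<^bsub>U\<^esub> v = v"

definition (in vector_space) finite_dim :: bool where
  "finite_dim \<longleftrightarrow> (\<exists>B. finite B \<and> span B = UNIV)"

definition (in alg_module) irreducible_module :: bool where
  "irreducible_module \<longleftrightarrow>
     (\<exists>v::'v. v \<noteq> 0) \<and>
     (\<forall>W. subspace W \<and> (\<forall>x \<in> carrier U. act x ` W \<subseteq> W) \<longrightarrow> W = {0} \<or> W = UNIV)"

definition fd_irreducible ::
    "('a::field \<Rightarrow> 'v::ab_group_add \<Rightarrow> 'v) \<Rightarrow> ('a, 'u) module \<Rightarrow> ('u \<Rightarrow> 'v \<Rightarrow> 'v) \<Rightarrow> bool" where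
  "fd_irreducible smul U act \<longleftrightarrow>
     alg_module smul U act \<and>
     vector_space.finite_dim smul \<and>
     alg_module.irreducible_module smul U act"

context vector_space
begin

definition eigenvalues :: "('b \<Rightarrow> 'b) \<Rightarrow> 'a set" where
  "eigenvalues T = {\<theta>. \<exists>v. v \<noteq> 0 \<and> T v = scale \<theta> v}"

text \<open>Over an algebraically closed field, semisimple means diagonalizable.\<close>

definition acts_semisimply :: "('b \<Rightarrow> 'b) \<Rightarrow> bool" where
  "acts_semisimply T \<longleftrightarrow> span {v. \<exists>\<theta>. T v = scale \<theta> v} = UNIV"

end


section \<open>Types\<close>

definition uq_type ::
    "('a::field \<Rightarrow> 'v::ab_group_add \<Rightarrow> 'v) \<Rightarrow> int ^ 'n ^ 'n \<Rightarrow> ('n \<Rightarrow> nat) \<Rightarrow> 'a \<Rightarrow>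
     (('n uq_gen, 'a) free_algebra set \<Rightarrow> 'v \<Rightarrow> 'v) \<Rightarrow> ('n \<Rightarrow> 'a) \<Rightarrow> bool" where
  "uq_type smul A s q act \<epsilon> \<longleftrightarrow>
     (\<forall>i. let T = act (uq_gen A s q (GenK i)) in
        vector_space.acts_semisimply smul T \<and>
        \<epsilon> i \<in> {1, -1} \<and>
        (\<forall>\<theta> \<in> vector_space.eigenvalues smul T. \<exists>m::int. \<theta> = \<epsilon> i * (q ^ s i) powi m))"

definition borel_type ::
    "('a::field \<Rightarrow> 'v::ab_group_add \<Rightarrow> 'v) \<Rightarrow> int ^ 'n ^ 'n \<Rightarrow> ('n \<Rightarrow> nat) \<Rightarrow> 'a \<Rightarrow>
     (('n uq_gen, 'a) free_algebra set \<Rightarrow> 'v \<Rightarrow> 'v) \<Rightarrow> ('n \<Rightarrow> 'a) \<Rightarrow> bool" where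
  "borel_type smul A s q act \<alpha> \<longleftrightarrow>
     (\<forall>i. let T = act (uq_gen A s q (GenK i)) in
        vector_space.acts_semisimply smul T \<and>
        \<alpha> i \<noteq> 0 \<and>
        (\<exists>\<Delta>. vector_space.eigenvalues smul T = (\<lambda>\<theta>. \<alpha> i * \<theta>) ` \<Delta> \<and>
             \<Delta> \<subseteq> {(q ^ s i) powi m | m::int. True} \<and>
             \<Delta> = inverse ` \<Delta>))"

definition extends_to_uq ::
    "('a::field \<Rightarrow> 'v::ab_group_add \<Rightarrow> 'v) \<Rightarrow> int ^ 'n ^ 'n \<Rightarrow> ('n \<Rightarrow> nat) \<Rightarrow> 'a \<Rightarrow>
     (('n uq_gen, 'a) free_algebra set \<Rightarrow> 'v \<Rightarrow> 'v) \<Rightarrow>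
     (('n uq_gen, 'a) free_algebra set \<Rightarrow> 'v \<Rightarrow> 'v) \<Rightarrow> bool" where
  "extends_to_uq smul A s q act act' \<longleftrightarrow>
     alg_module smul (uq A s q) act' \<and>
     (\<forall>x \<in> carrier (uq_borel A s q). act' x = act x)"

end

theory Submission
  imports Defs "HOL-Library.Function_Algebras"
begin

text \<open>
  Fix \<open>i\<close>. On a module of the Borel subalgebra, \<open>E\<^sub>i\<close> and \<open>K\<^sub>i\<close> decompose \<open>V\<close> into strings. Let
  \<open>V\<^sub>c\<close> be spanned by the strings whose weights are centred at \<open>c\<close> or below. The quantum Serre
  relation says that \<open>E\<^sub>j\<close> generates a string centred at 0 under the adjoint action of \<open>E\<^sub>i\<close>, so
  \<open>V\<^sub>c\<close> is a submodule. By irreducibility all strings have the same centre, which is 0 because of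
  the type. Hence exactly one \<open>F\<^sub>i\<close> completes \<open>E\<^sub>i\<close> and \<open>K\<^sub>i\<close> to an action of quantum sl(2), and the
  remaining relations follow from the representation theory of quantum sl(2), applied to its
  adjoint action on \<open>End V\<close>.

  Conversely, let \<open>W\<close> be a Borel submodule of an irreducible module \<open>V\<close>. The map \<open>E\<^sub>i\<^sup>m\<close> embeds the
  weight spaces of \<open>W\<close> of \<open>i\<close>-weight \<open>-m\<close> into those of \<open>i\<close>-weight \<open>m\<close>, so the trace over \<open>W\<close> of
  the \<open>i\<close>-weight is nonnegative. In affine type a positive combination of these traces vanishes,
  since a central element acts trivially. So all these embeddings are bijective, which makes \<open>W\<close>
  stable under \<open>F\<^sub>i\<close>.
\<close>

section \<open>Quantum integers\<close>

text \<open>Two facts about nilpotent operators \<open>e\<close>, \<open>f\<close> with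
  \<open>e f - f e = [k]\<close> on weight \<open>k\<close> do most of the work: on weight
  \<open>-m\<close> the map \<open>e^m\<close> is injective, and a vector of weight
  \<open>-m\<close> is killed by \<open>f\<close> if and only if it is killed by
  \<open>e^(m+1)\<close>. They are proved for an abstract family of weight spaces because they serve
  both \<open>V\<close> and \<open>End V\<close>. In \<open>End V\<close> the operator
  \<open>E_j\<close> has weight \<open>A_ij\<close>, applying the adjoint \<open>E_i\<close> exactly
  \<open>1 - A_ij\<close> times gives the Serre expression, and the adjoint \<open>F_i\<close> is
  the commutator with \<open>F_i\<close> up to an invertible factor. So Serre relations and
  vanishing commutators are the same condition: the relation for the \<open>E\<close> gives
  \<open>[E_j, F_i] = 0\<close>, and this, with the roles of \<open>E\<close> and \<open>F\<close>
  exchanged, gives the relation for the \<open>F\<close>. The obstacle is that none of this can be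
  used before \<open>F_i\<close> exists. Stability of the filtration under \<open>E_j\<close> has to
  come from the Serre relation alone, read as a polynomial in one variable with explicit distinct
  roots.\<close>

definition qnum :: "'a::field \<Rightarrow> int \<Rightarrow> 'a" where
  "qnum p k = (p powi k - p powi (- k)) / (p - inverse p)"

locale generic_parameter =
  fixes p :: "'a::field"
  assumes p_nonzero: "p \<noteq> 0"
    and not_root_of_unity: "\<And>k::nat. k > 0 \<Longrightarrow> p ^ k \<noteq> 1"
begin

lemma powi_eq_1_iff: "p powi k = 1 \<longleftrightarrow> k = 0"
proof (cases "k \<ge> 0")
  case True
  then show ?thesis
    using not_root_of_unity[of "nat k"] by (cases "k = 0") (auto simp: power_int_def)
next
  case False
  then show ?thesis
    using not_root_of_unity[of "nat (- k)"] p_nonzero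
    by (auto simp: power_int_def power_inverse)
qed

lemma powi_inject: "p powi j = p powi k \<longleftrightarrow> j = k"
proof
  assume "p powi j = p powi k"
  then have "p powi (j - k) = 1"
    using p_nonzero by (simp add: power_int_diff)
  then show "j = k"
    by (simp add: powi_eq_1_iff)
qed simp

lemma powi_add: "p powi (j + k) = p powi j * p powi k"
  using p_nonzero by (simp add: power_int_add)

lemma denominator_nonzero: "p - inverse p \<noteq> 0"
proof
  assume "p - inverse p = 0"
  then have "p powi 1 = p powi (- 1)" by simp
  then show False unfolding powi_inject by simp
qed

lemma qnum_eq_0_iff: "qnum p k = 0 \<longleftrightarrow> k = 0"
  using denominator_nonzero powi_inject[of k "- k"] by (simp add: qnum_def)

lemma qnum_0 [simp]: "qnum p 0 = 0"
  by (simp add: qnum_def)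

lemma qnum_1 [simp]: "qnum p 1 = 1"
  using denominator_nonzero by (simp add: qnum_def)

lemma qnum_minus: "qnum p (- k) = - qnum p k"
  by (simp add: qnum_def minus_divide_left)

text \<open>The coefficient identity behind moving a power of \<open>e\<close> past
  \<open>f\<close>, and behind the commutator of \<open>E\<close> and \<open>F\<close> on a string.
  Cleared of denominators it is an identity of Laurent polynomials in \<open>p\<close>,
  \<open>p^j\<close> and \<open>p^k\<close>.\<close>

lemma qnum_recurrence:
  "qnum p (k + 2 * j) + qnum p j * qnum p (k + j - 1) = qnum p (j + 1) * qnum p (k + j)"
proof -
  define x where "x = p powi j"
  define y where "y = p powi k"
  define X where "X = inverse x"
  define Y where "Y = inverse y"
  define P where "P = inverse p"
  have "k + 2 * j = k + j + j" "k + j - 1 = k + j + (- 1)" by simp_all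
  then have e: "p powi (k + 2 * j) = y * x * x" "p powi (k + j - 1) = y * x * P"
    "p powi (j + 1) = x * p" "p powi (k + j) = y * x" "p powi j = x"
    by (simp_all only: powi_add x_def y_def P_def power_int_minus power_int_1_right)
  have i: "inverse (y * x * x) = Y * X * X" "inverse (y * x * P) = Y * X * p"
    "inverse (x * p) = X * P" "inverse (y * x) = Y * X" "inverse x = X"
    by (simp_all add: X_def Y_def P_def)
  have "(y * x * x - Y * X * X) * (p - P) + (x - X) * (y * x * P - Y * X * p)
      = (x * p - X * P) * (y * x - Y * X)"
    by (simp add: algebra_simps)
  moreover have "a / d + (b / d) * (c / d) = (f / d) * (g / d)"
    if "a * d + b * c = f * g" "d \<noteq> 0" for a b c d f g :: 'a
  proof -
    have "f * g / (d * d) = a * d / (d * d) + b * c / (d * d)"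
      by (simp add: that(1)[symmetric] add_divide_distrib)
    then show ?thesis using that(2) by simp
  qed
  ultimately show ?thesis
    using denominator_nonzero unfolding qnum_def power_int_minus e i P_def[symmetric] by metis
qed

lemma qint_eq_qnum: "qint p m = qnum p (int m)"
  by (simp add: qint_def qnum_def power_int_minus power_inverse)

lemma qfact_Suc: "qfact p (Suc m) = qfact p m * qint p (Suc m)"
  by (simp add: qfact_def)

lemma qfact_nonzero: "qfact p m \<noteq> 0"
  by (auto simp: qfact_def qint_eq_qnum qnum_eq_0_iff)

lemma qbinomial_0 [simp]: "qbinomial p m 0 = 1"
  using qfact_nonzero[of m] by (simp add: qbinomial_def) (simp add: qfact_def)

lemma qbinomial_self [simp]: "qbinomial p m m = 1"
  using qfact_nonzero[of m] by (simp add: qbinomial_def) (simp add: qfact_def)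

lemma qnum_add: "qnum p (j + k) = p powi j * qnum p k + p powi (- k) * qnum p j"
proof -
  have "p powi (j + k) - p powi (- (j + k))
      = p powi j * (p powi k - p powi (- k)) + p powi (- k) * (p powi j - p powi (- j))"
    using powi_add[of "- k" "- j"] powi_add[of j k] by (simp add: algebra_simps)
  then show ?thesis
    by (simp add: qnum_def add_divide_distrib)
qed

lemma qbinomial_pascal:
  assumes "1 \<le> r" "r \<le> m"
  shows "qbinomial p (Suc m) r
    = p powi int r * qbinomial p m r + p powi (int r - int (Suc m)) * qbinomial p m (r - 1)"
proof -
  obtain t where r: "r = Suc t" using assms(1) by (cases r) auto
  obtain u where m: "m = r + u" using assms(2) le_Suc_ex by blast
  have "qint p (Suc m) = p powi int r * qint p (Suc u) + p powi (- int (Suc u)) * qint p r"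
    using qnum_add[of "int r" "int (Suc u)"]
    unfolding qint_eq_qnum m by (simp only: of_nat_add add_Suc_right[symmetric] power_int_of_nat)
  moreover have "int r - int (Suc m) = - int (Suc u)" by (simp add: m)
  moreover have "qfact p r = qfact p t * qint p r" "qfact p (Suc u) = qfact p u * qint p (Suc u)"
    "qfact p (Suc m) = qfact p m * qint p (Suc m)"
    by (simp_all only: r qfact_Suc)
  moreover have "Suc m - r = Suc u" "m - r = u" "m - (r - 1) = Suc u" "r - 1 = t"
    by (simp_all add: m r)
  moreover have "z * (a * y + b * x) / (v * x * (w * y)) = a * (z / (v * x * w)) + b * (z / (v * (w * y)))"
    if "x \<noteq> 0" "y \<noteq> 0" for a b v w x y z :: 'a
    using that by (simp add: add_divide_distrib distrib_left ac_simps)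
  moreover have "qint p r \<noteq> 0" "qint p (Suc u) \<noteq> 0"
    by (simp_all add: qint_eq_qnum qnum_eq_0_iff r del: of_nat_Suc)
  ultimately show ?thesis
    unfolding qbinomial_def by metis
qed

end

lemma generic_parameter_inverse:
  assumes "generic_parameter p" shows "generic_parameter (inverse p)"
proof -
  interpret generic_parameter p by fact
  show ?thesis
    by unfold_locales (use p_nonzero not_root_of_unity in \<open>auto simp: power_inverse\<close>)
qed

lemma qnum_inverse: "qnum (inverse p) k = qnum p k"
proof -
  have "inverse p - p = - (p - inverse p)" by simp
  then show ?thesis
    unfolding qnum_def power_int_inverse power_int_minus inverse_inverse_eq
    by (metis minus_diff_eq minus_divide_divide)
qed

lemma qint_inverse: "qint (inverse p) k = qint p k"
  using qnum_inverse[of p "int k"]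
  by (simp add: qint_def qnum_def power_int_minus power_inverse)

lemma qbinomial_inverse: "qbinomial (inverse p) m r = qbinomial p m r"
  by (simp add: qbinomial_def qfact_def qint_inverse)

text \<open>The first Pascal rule read at \<open>inverse p\<close>, under which quantum binomials
  are invariant. This version drives the expansion of powers of \<open>ad_E\<close>, the other one
  the factorisation of Gauss sums.\<close>

lemma (in generic_parameter) qbinomial_pascal':
  assumes "1 \<le> r" "r \<le> m"
  shows "qbinomial p (Suc m) r
    = p powi (- int r) * qbinomial p m r + p powi (int (Suc m) - int r) * qbinomial p m (r - 1)"
proof -
  interpret i: generic_parameter "inverse p"
    by (rule generic_parameter_inverse) unfold_locales
  have "inverse p powi k = p powi (- k)" for k
    by (simp add: power_int_inverse power_int_minus)
  with i.qbinomial_pascal[OF assms] show ?thesis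
    unfolding qbinomial_inverse by (simp only: minus_diff_eq)
qed

section \<open>Joint eigenvectors\<close>

abbreviation lin :: "('a::field \<Rightarrow> 'b::ab_group_add \<Rightarrow> 'b) \<Rightarrow> ('b \<Rightarrow> 'b) \<Rightarrow> bool" where
  "lin s \<equiv> Vector_Spaces.linear s s"

text \<open>The Serre expression of order \<open>N\<close> on vectors, with arbitrary operators
  instead of generators: it serves the \<open>E\<close>, the \<open>F\<close>, and the powers of the
  adjoint operator.\<close>

definition serre_op ::
    "('a::field \<Rightarrow> 'b::ab_group_add \<Rightarrow> 'b) \<Rightarrow> 'a \<Rightarrow> ('b \<Rightarrow> 'b) \<Rightarrow> ('b \<Rightarrow> 'b) \<Rightarrow> nat \<Rightarrow> 'b \<Rightarrow> 'b" where
  "serre_op s p E X N v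
    = (\<Sum>r\<le>N. s ((-1) ^ r * qbinomial p N r) ((E ^^ (N - r)) (X ((E ^^ r) v))))"

text \<open>With index type \<open>unit\<close> this is an eigenspace of a single operator, so that
  one set of lemmas covers both cases.\<close>

definition joint_eigenspace ::
    "('a \<Rightarrow> 'b \<Rightarrow> 'b) \<Rightarrow> ('i \<Rightarrow> 'b \<Rightarrow> 'b) \<Rightarrow> ('i \<Rightarrow> 'a) \<Rightarrow> 'b set" where
  "joint_eigenspace s T \<kappa> = {v. \<forall>i. T i v = s (\<kappa> i) v}"

context vector_space
begin

lemma linI:
  assumes "\<And>x y. f (x + y) = f x + f y" "\<And>c x. f (scale c x) = scale c (f x)"
  shows "lin scale f"
  using assms by unfold_locales auto

lemma lin_add: "lin scale f \<Longrightarrow> f (x + y) = f x + f y"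
  and lin_scale: "lin scale f \<Longrightarrow> f (scale c x) = scale c (f x)"
  by (simp_all add: Vector_Spaces.linear_iff_module_hom module_hom.add module_hom.scale)

lemma lin_0: "lin scale f \<Longrightarrow> f 0 = 0"
  using lin_scale[of f 0 0] by simp

lemma lin_neg: "lin scale f \<Longrightarrow> f (- x) = - f x"
  using lin_scale[of f "-1" x] by simp

lemma lin_diff: "lin scale f \<Longrightarrow> f (x - y) = f x - f y"
  using lin_add[of f x "- y"] by (simp add: lin_neg)

lemma lin_sum: "lin scale f \<Longrightarrow> f (sum g A) = (\<Sum>a\<in>A. f (g a))"
  by (induction A rule: infinite_finite_induct) (simp_all add: lin_0 lin_add)

lemma lin_compose: "lin scale f \<Longrightarrow> lin scale g \<Longrightarrow> lin scale (\<lambda>x. f (g x))"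
  by (rule linI) (simp_all add: lin_add lin_scale)

lemma lin_minus: "lin scale f \<Longrightarrow> lin scale g \<Longrightarrow> lin scale (\<lambda>x. f x - g x)"
  by (rule linI) (simp_all add: lin_add lin_scale scale_right_diff_distrib)

lemma lin_plus: "lin scale f \<Longrightarrow> lin scale g \<Longrightarrow> lin scale (\<lambda>x. f x + g x)"
  by (rule linI) (simp_all add: lin_add lin_scale scale_right_distrib)

lemma lin_scaled: "lin scale f \<Longrightarrow> lin scale (\<lambda>x. scale c (f x))"
  by (rule linI) (simp_all add: lin_add lin_scale scale_right_distrib scale_left_commute)

lemma lin_ident: "lin scale (\<lambda>x. x)"
  by (rule linI) simp_all

lemma lin_const_0: "lin scale (\<lambda>x. 0)"
  by (rule linI) simp_all

lemma lin_sum_fun: "(\<And>i. i \<in> I \<Longrightarrow> lin scale (f i)) \<Longrightarrow> lin scale (\<lambda>x. \<Sum>i\<in>I. f i x)"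
  by (induction I rule: infinite_finite_induct) (simp_all add: lin_const_0 lin_plus)

lemma lin_funpow: "lin scale f \<Longrightarrow> lin scale (f ^^ n)"
  by (induction n) (simp_all add: lin_ident lin_compose id_def comp_def)

lemma lin_subspace_image: "lin scale f \<Longrightarrow> subspace S \<Longrightarrow> subspace (f ` S)"
  by (simp add: Vector_Spaces.linear_iff_module_hom module_hom.subspace_image)

lemma lin_span_image_subset:
  assumes "lin scale f" "\<And>g. g \<in> G \<Longrightarrow> f g \<in> W" "subspace W" "x \<in> span G"
  shows "f x \<in> W"
  using assms(4)
proof (induction rule: span_induct_alt)
  case base
  then show ?case using assms(3) by (simp add: lin_0[OF assms(1)] subspace_0)
next
  case (step c x y)
  then show ?case
    using assms by (simp add: lin_add[OF assms(1)] lin_scale[OF assms(1)] subspace_add subspace_scale)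
qed

lemma lin_eq_on_span:
  assumes "lin scale f" "lin scale g" "\<And>x. x \<in> G \<Longrightarrow> f x = g x" "span G = UNIV"
  shows "f = g"
proof
  fix x
  have "f x - g x \<in> {0}"
    by (rule lin_span_image_subset[of "\<lambda>x. f x - g x" G])
      (use assms in \<open>auto intro: lin_minus simp: subspace_def\<close>)
  then show "f x = g x" by simp
qed

lemma subspace_joint_eigenspace:
  "(\<And>i. lin scale (T i)) \<Longrightarrow> subspace (joint_eigenspace scale T \<kappa>)"
  by (auto simp: joint_eigenspace_def subspace_def lin_0 lin_add lin_scale scale_right_distrib
      scale_left_commute)

lemma span_Int_joint_eigenspace:
  assumes "\<And>i. lin scale (T i)" "x \<in> span (G \<inter> joint_eigenspace scale T \<kappa>)"
  shows "x \<in> joint_eigenspace scale T \<kappa>"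
proof -
  have "subspace (joint_eigenspace scale T \<kappa>)"
    using assms(1) by (rule subspace_joint_eigenspace)
  then show ?thesis
    using assms(2) span_minimal[of "G \<inter> joint_eigenspace scale T \<kappa>" "joint_eigenspace scale T \<kappa>"]
    by blast
qed

lemma joint_eigenspace_Int:
  assumes "v \<in> joint_eigenspace scale T \<kappa>" "v \<in> joint_eigenspace scale T \<psi>" "v \<noteq> 0"
  shows "\<kappa> = \<psi>"
  using assms by (auto simp: joint_eigenspace_def)

text \<open>The operator \<open>T i - \<psi> i\<close> kills the component at \<open>\<psi>\<close>
  and rescales the others; an \<open>i\<close> at which two eigenvalue systems differ makes the
  factor nonzero. For \<open>W = {0}\<close> this is the independence of joint eigenspaces.\<close>

lemma joint_eigenspace_components_in_subspace:
  assumes "finite P" and "\<And>i. lin scale (T i)" and "subspace W" and "\<And>i w. w \<in> W \<Longrightarrow> T i w \<in> W"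
    and "\<And>\<kappa>. \<kappa> \<in> P \<Longrightarrow> v \<kappa> \<in> joint_eigenspace scale T \<kappa>" and "sum v P \<in> W" and "\<kappa> \<in> P"
  shows "v \<kappa> \<in> W"
  using assms(1,5,6,7)
proof (induction P arbitrary: v \<kappa> rule: finite_induct)
  case empty
  then show ?case by simp
next
  case (insert \<psi> P)
  have in_W: "v \<xi> \<in> W" if "\<xi> \<in> P" for \<xi>
  proof -
    have "\<xi> \<noteq> \<psi>" using insert that by auto
    then obtain i where i: "\<xi> i \<noteq> \<psi> i" by auto
    define u where "u \<zeta> = scale (\<zeta> i - \<psi> i) (v \<zeta>)" for \<zeta>
    have "T i (sum v (insert \<psi> P)) - scale (\<psi> i) (sum v (insert \<psi> P))
        = (\<Sum>\<zeta>\<in>insert \<psi> P. u \<zeta>)"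
      unfolding lin_sum[OF assms(2)] scale_sum_right sum_subtractf[symmetric] u_def
      using insert.prems(1)
      by (intro sum.cong) (auto simp: joint_eigenspace_def scale_left_diff_distrib)
    also have "\<dots> = sum u P"
      using insert.hyps by (simp add: u_def)
    finally have "sum u P \<in> W"
      using insert.prems(2) assms(3,4) by (metis subspace_diff subspace_scale)
    moreover have "u \<zeta> \<in> joint_eigenspace scale T \<zeta>" if "\<zeta> \<in> P" for \<zeta>
      using insert.prems(1) that by (simp add: u_def joint_eigenspace_def lin_scale[OF assms(2)]
          scale_left_commute)
    ultimately have "u \<xi> \<in> W" using insert.IH that by blast
    then have "scale (inverse (\<xi> i - \<psi> i)) (u \<xi>) \<in> W" using assms(3) subspace_scale by blast
    then show ?thesis using i by (simp add: u_def)
  qed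
  have "sum v P \<in> W" using in_W assms(3) subspace_sum by blast
  then have "v \<psi> \<in> W"
    using insert.prems(2) insert.hyps assms(3) subspace_diff[of W "sum v (insert \<psi> P)" "sum v P"]
    by simp
  then show ?case using in_W insert.prems(3) by auto
qed

lemma span_joint_eigenvectors_decompose:
  assumes "G \<subseteq> (\<Union>\<kappa>. joint_eigenspace scale T \<kappa>)" "x \<in> span G"
  shows "\<exists>P v. finite P \<and> (\<forall>\<kappa>. v \<kappa> \<in> span (G \<inter> joint_eigenspace scale T \<kappa>))
    \<and> (\<forall>\<kappa>. \<kappa> \<notin> P \<longrightarrow> v \<kappa> = 0) \<and> x = sum v P"
  using assms(2)
proof (induction rule: span_induct_alt)
  case base
  then show ?case by (intro exI[of _ "{}"] exI[of _ "\<lambda>_. 0"]) (simp add: span_zero)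
next
  case (step c g y)
  then obtain P v where P: "finite P" "\<And>\<kappa>. v \<kappa> \<in> span (G \<inter> joint_eigenspace scale T \<kappa>)"
    "\<And>\<kappa>. \<kappa> \<notin> P \<Longrightarrow> v \<kappa> = 0" "y = sum v P" by blast
  obtain \<psi> where \<psi>: "g \<in> joint_eigenspace scale T \<psi>" using step assms(1) by auto
  have "scale c g + sum v P = sum (v(\<psi> := scale c g + v \<psi>)) (insert \<psi> P)"
  proof (cases "\<psi> \<in> P")
    case True
    then show ?thesis
      using P(1) by (simp add: insert_absorb sum.remove[of P \<psi>] add.assoc)
  next
    case False
    then show ?thesis
      using P(1,3) by (simp, intro sum.cong) auto
  qed
  moreover have "scale c g + v \<psi> \<in> span (G \<inter> joint_eigenspace scale T \<psi>)"
    using step.hyps \<psi> P(2)[of \<psi>] by (intro span_add span_scale) (auto intro: span_base)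
  ultimately show ?case
    using P by (intro exI[of _ "insert \<psi> P"] exI[of _ "v(\<psi> := scale c g + v \<psi>)"]) auto
qed

text \<open>Subtracting \<open>x\<close> from its own component gives a relation between joint
  eigenvectors of distinct systems, so each term vanishes, in particular
  \<open>v \<kappa> - x\<close>.\<close>

lemma span_joint_eigenvectors_Int:
  assumes T: "\<And>i. lin scale (T i)" and G: "G \<subseteq> (\<Union>\<kappa>. joint_eigenspace scale T \<kappa>)"
    and x: "x \<in> span G" "x \<in> joint_eigenspace scale T \<kappa>"
  shows "x \<in> span (G \<inter> joint_eigenspace scale T \<kappa>)"
proof -
  obtain P v where P: "finite P" "\<And>\<kappa>. v \<kappa> \<in> span (G \<inter> joint_eigenspace scale T \<kappa>)"
    "\<And>\<kappa>. \<kappa> \<notin> P \<Longrightarrow> v \<kappa> = 0" "x = sum v P"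
    using span_joint_eigenvectors_decompose[OF G x(1)] by blast
  have v: "v \<psi> \<in> joint_eigenspace scale T \<psi>" for \<psi>
    using T P(2)[of \<psi>] by (rule span_Int_joint_eigenspace)
  have "sum (v(\<kappa> := v \<kappa> - x)) (insert \<kappa> P) = 0"
  proof (cases "\<kappa> \<in> P")
    case True
    then show ?thesis
      using P(1,4) by (simp add: insert_absorb sum.remove[of P \<kappa>])
  next
    case False
    then have "(\<Sum>\<psi>\<in>P. (v(\<kappa> := v \<kappa> - x)) \<psi>) = sum v P" by (intro sum.cong) auto
    then show ?thesis
      using False P by simp
  qed
  moreover have "(v(\<kappa> := v \<kappa> - x)) \<psi> \<in> joint_eigenspace scale T \<psi>" for \<psi>
    using v x(2) subspace_joint_eigenspace[of T, OF T] by (auto intro: subspace_diff)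
  ultimately have "(v(\<kappa> := v \<kappa> - x)) \<kappa> \<in> {0}"
    using P(1) joint_eigenspace_components_in_subspace
      [of "insert \<kappa> P" T "{0}" "v(\<kappa> := v \<kappa> - x)" \<kappa>, OF _ T]
    by (simp add: lin_0[OF T] subspace_def)
  then show ?thesis using P(2)[of \<kappa>] by simp
qed

lemma invariant_subspace_span_joint_eigenvectors:
  assumes T: "\<And>i. lin scale (T i)" and all: "span (\<Union>\<kappa>. joint_eigenspace scale T \<kappa>) = UNIV"
    and W: "subspace W" "\<And>i w. w \<in> W \<Longrightarrow> T i w \<in> W"
  shows "W \<subseteq> span (W \<inter> (\<Union>\<kappa>. joint_eigenspace scale T \<kappa>))"
proof
  fix w assume w: "w \<in> W"
  obtain P v where P: "finite P"
    "\<And>\<kappa>. v \<kappa> \<in> span ((\<Union>\<kappa>. joint_eigenspace scale T \<kappa>) \<inter> joint_eigenspace scale T \<kappa>)" "w = sum v P"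
    using span_joint_eigenvectors_decompose[of _ T w, OF order_refl] all by auto
  have v: "v \<psi> \<in> joint_eigenspace scale T \<psi>" for \<psi>
    using T P(2)[of \<psi>] by (rule span_Int_joint_eigenspace)
  have "v \<kappa> \<in> W" if "\<kappa> \<in> P" for \<kappa>
    by (rule joint_eigenspace_components_in_subspace[OF P(1) T W v]) (use P w that in auto)
  then show "w \<in> span (W \<inter> (\<Union>\<kappa>. joint_eigenspace scale T \<kappa>))"
    unfolding P(3) using v by (intro span_sum span_base) auto
qed

text \<open>Each element of a finite spanning set involves finitely many eigenvalue systems. An
  eigenvector for a system outside this finite list would lie in the span of the other eigenspaces,
  and so be 0.\<close>

lemma finite_joint_eigenvalues:
  assumes T: "\<And>i. lin scale (T i)" and all: "span (\<Union>\<kappa>. joint_eigenspace scale T \<kappa>) = UNIV"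
    and B: "finite B" "span B = UNIV"
  shows "finite {\<kappa>. \<exists>v \<in> joint_eigenspace scale T \<kappa>. v \<noteq> 0}"
proof -
  have "\<forall>b. \<exists>P. finite P \<and> b \<in> span (\<Union>\<kappa>\<in>P. joint_eigenspace scale T \<kappa>)"
  proof
    fix b
    obtain P v where P: "finite P"
      "\<And>\<kappa>. v \<kappa> \<in> span ((\<Union>\<kappa>. joint_eigenspace scale T \<kappa>) \<inter> joint_eigenspace scale T \<kappa>)" "b = sum v P"
      using span_joint_eigenvectors_decompose[of _ T b, OF order_refl] all by auto
    have "v \<kappa> \<in> span (\<Union>\<kappa>\<in>P. joint_eigenspace scale T \<kappa>)" if "\<kappa> \<in> P" for \<kappa>
      using P(2)[of \<kappa>] that span_mono[of "(\<Union>\<kappa>. joint_eigenspace scale T \<kappa>) \<inter> joint_eigenspace scale T \<kappa>"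
          "\<Union>\<kappa>\<in>P. joint_eigenspace scale T \<kappa>"] by blast
    then show "\<exists>P. finite P \<and> b \<in> span (\<Union>\<kappa>\<in>P. joint_eigenspace scale T \<kappa>)"
      using P by (auto intro: span_sum)
  qed
  then obtain P where P: "\<And>b. finite (P b)" "\<And>b. b \<in> span (\<Union>\<kappa>\<in>P b. joint_eigenspace scale T \<kappa>)"
    by metis
  define Q where "Q = (\<Union>b\<in>B. P b)"
  define G where "G = (\<Union>\<kappa>\<in>Q. joint_eigenspace scale T \<kappa>)"
  have "b \<in> span G" if "b \<in> B" for b
    using P(2)[of b] span_mono[of "\<Union>\<kappa>\<in>P b. joint_eigenspace scale T \<kappa>" G] that
    by (auto simp: G_def Q_def)
  then have G: "span G = UNIV"
    using B(2) span_minimal[of B "span G"] by auto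
  have "\<kappa> \<in> Q" if v: "v \<in> joint_eigenspace scale T \<kappa>" "v \<noteq> 0" for \<kappa> v
  proof (rule ccontr)
    assume "\<kappa> \<notin> Q"
    then have "G \<inter> joint_eigenspace scale T \<kappa> \<subseteq> {0}"
      unfolding G_def by (auto dest: joint_eigenspace_Int)
    then have "span (G \<inter> joint_eigenspace scale T \<kappa>) \<subseteq> {0}"
      by (intro span_minimal) (auto simp: subspace_def)
    moreover have "v \<in> span (G \<inter> joint_eigenspace scale T \<kappa>)"
      by (rule span_joint_eigenvectors_Int[OF T _ _ v(1)]) (auto simp: G, auto simp: G_def)
    ultimately show False using v by auto
  qed
  then have "{\<kappa>. \<exists>v \<in> joint_eigenspace scale T \<kappa>. v \<noteq> 0} \<subseteq> Q" by blast
  moreover have "finite Q" using B(1) P(1) by (auto simp: Q_def)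
  ultimately show ?thesis by (rule finite_subset)
qed

text \<open>Induction on the set of operators: the joint eigenspace \<open>W\<close> of those
  already treated is stable under the next \<open>T j\<close> by commutation, and therefore splits
  into eigenvectors of \<open>T j\<close>.\<close>

lemma commuting_semisimple_span_joint_eigenvectors:
  fixes T :: "'i::finite \<Rightarrow> 'b \<Rightarrow> 'b"
  assumes T: "\<And>i. lin scale (T i)" and comm: "\<And>i j v. T i (T j v) = T j (T i v)"
    and ss: "\<And>i. span {v. \<exists>\<theta>. T i v = scale \<theta> v} = UNIV"
  shows "span (\<Union>\<kappa>. joint_eigenspace scale T \<kappa>) = UNIV"
proof -
  have "span {v. \<forall>i\<in>I. \<exists>\<theta>. T i v = scale \<theta> v} = UNIV" if "finite I" for I
    using that
  proof (induction I rule: finite_induct)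
    case empty
    then show ?case by simp
  next
    case (insert j I)
    let ?G = "{v. \<forall>i\<in>insert j I. \<exists>\<theta>. T i v = scale \<theta> v}"
    have "v \<in> span ?G" if v: "\<forall>i\<in>I. \<exists>\<theta>. T i v = scale \<theta> v" for v
    proof -
      obtain \<theta> where \<theta>: "\<And>i. i \<in> I \<Longrightarrow> T i v = scale (\<theta> i) v" using v by metis
      define W where "W = {u. \<forall>i\<in>I. T i u = scale (\<theta> i) u}"
      have W: "subspace W"
        by (auto simp: W_def subspace_def T lin_0 lin_add lin_scale scale_right_distrib
            scale_left_commute)
      have inv: "T j w \<in> W" if "w \<in> W" for w
        using that by (auto simp: W_def comm[of _ j] T lin_scale)
      let ?E = "\<Union>\<kappa>. joint_eigenspace scale (\<lambda>_::unit. T j) \<kappa>"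
      have E: "?E = {v. \<exists>\<theta>. T j v = scale \<theta> v}"
        by (auto simp: joint_eigenspace_def)
      have "W \<subseteq> span (W \<inter> ?E)"
        by (rule invariant_subspace_span_joint_eigenvectors)
          (use T W inv ss[of j] E in auto)
      moreover have "W \<inter> ?E \<subseteq> ?G"
        unfolding E by (auto simp: W_def)
      ultimately show ?thesis
        using \<theta> span_mono[of "W \<inter> ?E" ?G] W_def by blast
    qed
    then show ?case
      using span_minimal[of "{v. \<forall>i\<in>I. \<exists>\<theta>. T i v = scale \<theta> v}" "span ?G"] insert.IH by auto
  qed
  from this[of UNIV] have "span {v. \<forall>i. \<exists>\<theta>. T i v = scale \<theta> v} = UNIV" by simp
  moreover have "{v. \<forall>i. \<exists>\<theta>. T i v = scale \<theta> v} = (\<Union>\<kappa>. joint_eigenspace scale T \<kappa>)"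
    by (auto simp: joint_eigenspace_def choice_iff)
  ultimately show ?thesis by simp
qed

end

section \<open>Weighted modules over quantum sl(2)\<close>

text \<open>The laws are stated on each \<open>M k\<close>. In the second application the ambient
  space consists of all maps on \<open>V\<close>, and the commutation rule is established for linear
  maps of a given weight.\<close>

locale weighted_sl2 = vector_space scale + generic_parameter p
  for scale :: "'a::field \<Rightarrow> 'b::ab_group_add \<Rightarrow> 'b" and p :: 'a +
  fixes M :: "int \<Rightarrow> 'b set" and e f :: "'b \<Rightarrow> 'b"
  assumes subspace_M: "subspace (M k)"
    and e_M: "x \<in> M k \<Longrightarrow> e x \<in> M (k + 2)"
    and f_M: "x \<in> M k \<Longrightarrow> f x \<in> M (k - 2)"
    and e_add: "x \<in> M k \<Longrightarrow> y \<in> M k \<Longrightarrow> e (x + y) = e x + e y"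
    and e_scale: "x \<in> M k \<Longrightarrow> e (scale c x) = scale c (e x)"
    and f_scale: "x \<in> M k \<Longrightarrow> f (scale c x) = scale c (f x)"
    and e_f: "x \<in> M k \<Longrightarrow> e (f x) = f (e x) + scale (qnum p k) x"
begin

lemma e_0: "e 0 = 0"
  using e_scale[of 0 0 0] subspace_0[OF subspace_M] by simp

lemma f_0: "f 0 = 0"
  using f_scale[of 0 0 0] subspace_0[OF subspace_M] by simp

lemma e_pow_0: "(e ^^ j) 0 = 0"
  by (induction j) (simp_all add: e_0)

lemma e_pow_M: "x \<in> M k \<Longrightarrow> (e ^^ j) x \<in> M (k + 2 * int j)"
proof (induction j)
  case (Suc j)
  then show ?case using e_M[of "(e ^^ j) x" "k + 2 * int j"] by (simp add: algebra_simps)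
qed simp

lemma f_pow_M: "x \<in> M k \<Longrightarrow> (f ^^ j) x \<in> M (k - 2 * int j)"
proof (induction j)
  case (Suc j)
  then show ?case using f_M[of "(f ^^ j) x" "k - 2 * int j"] by (simp add: algebra_simps)
qed simp

text \<open>The source of the vanishing arguments below. Since \<open>j + 1\<close> is nonzero, the
  coefficient is zero only for \<open>k = -j\<close>, so a lowest vector of weight \<open>k\<close>
  can lose a nonzero \<open>e^j x\<close> under \<open>e\<close> only there.\<close>

lemma e_pow_f:
  assumes "x \<in> M k"
  shows "(e ^^ Suc j) (f x)
    = f ((e ^^ Suc j) x) + scale (qnum p (int j + 1) * qnum p (k + int j)) ((e ^^ j) x)"
proof (induction j)
  case 0
  then show ?case using assms by (simp add: e_f)
next
  case (Suc j)
  let ?y = "(e ^^ Suc j) x"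
  let ?c = "qnum p (int j + 1) * qnum p (k + int j)"
  have y: "?y \<in> M (k + 2 * int (Suc j))" using e_pow_M[OF assms] .
  have fy: "f ?y \<in> M (k + 2 * int j)" using f_M[OF y] by (simp add: algebra_simps)
  have z: "(e ^^ j) x \<in> M (k + 2 * int j)" using e_pow_M[OF assms] .
  have "(e ^^ Suc (Suc j)) (f x) = e (f ?y + scale ?c ((e ^^ j) x))"
    using Suc by simp
  also have "\<dots> = e (f ?y) + scale ?c ?y"
    using e_add[OF fy subspace_scale[OF subspace_M z]] e_scale[OF z] by simp
  also have "\<dots> = f (e ?y) + scale (qnum p (k + 2 * int (Suc j)) + ?c) ?y"
    using e_f[OF y] by (simp add: scale_left_distrib add.assoc)
  also have "qnum p (k + 2 * int (Suc j)) + ?c = qnum p (int (Suc j) + 1) * qnum p (k + int (Suc j))"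
    using qnum_recurrence[of k "int (Suc j)"] by (simp add: algebra_simps)
  finally show ?case by simp
qed

lemma e_pow_lowest_cancel:
  assumes "y \<in> M k" "f y = 0" "(e ^^ Suc j) y = 0" "k + int j \<noteq> 0"
  shows "(e ^^ j) y = 0"
  using e_pow_f[OF assms(1), of j] assms
  by (simp add: e_pow_0 e_0 f_0 qnum_eq_0_iff)

text \<open>Induction on the order of nilpotency of \<open>f\<close> at \<open>y\<close>. The vector
  \<open>f y\<close> satisfies the hypotheses at weight \<open>-(m+2)\<close>, hence is 0. Then
  \<open>y\<close> is lowest, and \<open>e^m y = 0\<close> cancels down to \<open>y = 0\<close>
  because \<open>-m + j\<close> is nonzero for \<open>j < m\<close>.\<close>

lemma e_pow_injective:
  assumes "y \<in> M (- int m)" "(e ^^ m) y = 0" "(f ^^ r) y = 0"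
  shows "y = 0"
  using assms
proof (induction r arbitrary: y m)
  case 0
  then show ?case by simp
next
  case (Suc r)
  have "(e ^^ Suc (Suc m)) (f y) = 0"
    using e_pow_f[OF Suc.prems(1), of "Suc m"] Suc.prems(2) by (simp add: e_0 f_0)
  moreover have "f y \<in> M (- int (Suc (Suc m)))"
    using f_M[OF Suc.prems(1)] by (simp add: algebra_simps)
  moreover have "(f ^^ r) (f y) = 0"
    using Suc.prems(3) by (simp add: funpow_swap1)
  ultimately have fy: "f y = 0" using Suc.IH by blast
  have "j \<le> m \<Longrightarrow> (e ^^ j) y = 0 \<Longrightarrow> y = 0" for j
  proof (induction j)
    case (Suc j)
    then show ?case
      using e_pow_lowest_cancel[OF \<open>y \<in> M (- int m)\<close> fy, of j] by simp
  qed simp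
  then show ?case using Suc.prems(2) by blast
qed

text \<open>By the commutation formula \<open>e^(m+2)\<close> kills \<open>f x\<close>, whose weight
  is \<open>-(m+2)\<close>, so injectivity applies to \<open>f x\<close>.\<close>

lemma f_eq_0_if_e_pow_eq_0:
  assumes "x \<in> M (- int m)" "(e ^^ Suc m) x = 0" "(f ^^ r) x = 0"
  shows "f x = 0"
proof (rule e_pow_injective)
  show "f x \<in> M (- int (Suc (Suc m)))"
    using f_M[OF assms(1)] by (simp add: algebra_simps)
  show "(e ^^ Suc (Suc m)) (f x) = 0"
    using e_pow_f[OF assms(1), of "Suc m"] assms(2) by (simp add: e_0 f_0)
  show "(f ^^ r) (f x) = 0"
    using assms(3) by (simp add: funpow_swap1[symmetric] f_0)
qed

text \<open>The vector \<open>e^(n+1) x\<close> is again killed by \<open>f\<close>, because the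
  coefficient contains \<open>[-n + n] = 0\<close>. Its weight \<open>n + 2\<close> is positive, so
  cancellation never meets a zero coefficient and nilpotency of \<open>e\<close> makes it
  vanish.\<close>

lemma e_pow_eq_0_if_lowest:
  assumes "x \<in> M (- int n)" "f x = 0" "(e ^^ r) x = 0"
  shows "(e ^^ Suc n) x = 0"
proof -
  let ?y = "(e ^^ Suc n) x"
  have y: "?y \<in> M (int n + 2)"
    using e_pow_M[OF assms(1), of "Suc n"] by (simp add: algebra_simps)
  have fy: "f ?y = 0"
    using e_pow_f[OF assms(1), of n] assms(2) by (simp add: e_0 e_pow_0)
  have "(e ^^ j) ?y = 0 \<Longrightarrow> ?y = 0" for j
  proof (induction j)
    case (Suc j)
    then show ?case using e_pow_lowest_cancel[OF y fy, of j] by simp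
  qed simp
  moreover have "(e ^^ r) ?y = (e ^^ Suc n) ((e ^^ r) x)"
    by (simp only: funpow_add[unfolded comp_def, THEN fun_cong, symmetric] add.commute)
  ultimately show ?thesis
    using assms(3) by (simp only: e_pow_0)
qed

end

definition weight_space :: "('a::field \<Rightarrow> 'b \<Rightarrow> 'b) \<Rightarrow> ('b \<Rightarrow> 'b) \<Rightarrow> 'a \<Rightarrow> 'a \<Rightarrow> int \<Rightarrow> 'b set" where
  "weight_space s K \<epsilon> p k = {v. K v = s (\<epsilon> * p powi k) v}"

text \<open>\<open>L\<close> is the inverse of \<open>K\<close>. Bounded weights stand in for finite
  dimension: they make \<open>E\<close> and \<open>F\<close> nilpotent on weight vectors, and they
  pass on to \<open>End V\<close>.\<close>

locale uq_sl2_module = vector_space scale + generic_parameter p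
  for scale :: "'a::field \<Rightarrow> 'b::ab_group_add \<Rightarrow> 'b" and p :: 'a +
  fixes \<epsilon> :: 'a and E F K L :: "'b \<Rightarrow> 'b"
  assumes sign: "\<epsilon> \<in> {1, -1}"
    and lin_E: "lin scale E" and lin_F: "lin scale F"
    and lin_K: "lin scale K" and lin_L: "lin scale L"
    and K_L: "K (L v) = v" and L_K: "L (K v) = v"
    and K_E: "K (E v) = scale (p powi 2) (E (K v))"
    and K_F: "K (F v) = scale (p powi (- 2)) (F (K v))"
    and E_F: "E (F v) - F (E v) = scale (inverse (p - inverse p)) (K v - L v)"
    and span_weight_spaces: "span (\<Union>k. weight_space scale K \<epsilon> p k) = UNIV"
    and weights_bounded: "\<exists>b. \<forall>k. \<forall>v \<in> weight_space scale K \<epsilon> p k. v \<noteq> 0 \<longrightarrow> \<bar>k\<bar> \<le> b"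
begin

lemmas E_simps = lin_add[OF lin_E] lin_scale[OF lin_E] lin_diff[OF lin_E] lin_0[OF lin_E]
lemmas F_simps = lin_add[OF lin_F] lin_scale[OF lin_F] lin_diff[OF lin_F] lin_0[OF lin_F]
lemmas K_simps = lin_add[OF lin_K] lin_scale[OF lin_K] lin_diff[OF lin_K] lin_0[OF lin_K]
lemmas L_simps = lin_add[OF lin_L] lin_scale[OF lin_L] lin_diff[OF lin_L] lin_0[OF lin_L]

lemma sign_squared [simp]: "\<epsilon> * \<epsilon> = 1"
  using sign by auto

lemma L_eigen: "K v = scale c v \<Longrightarrow> c \<noteq> 0 \<Longrightarrow> L v = scale (inverse c) v"
  using L_K[of v] by (metis L_simps(2) scale_scale left_inverse scale_one)

lemma L_weight:
  assumes "v \<in> weight_space scale K \<epsilon> p k" shows "L v = scale (\<epsilon> * p powi (- k)) v"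
proof -
  have "inverse \<epsilon> = \<epsilon>" using sign by auto
  then show ?thesis
    using L_eigen[of v "\<epsilon> * p powi k"] assms p_nonzero sign
    by (auto simp: weight_space_def power_int_minus)
qed

lemma subspace_weight_space: "subspace (weight_space scale K \<epsilon> p k)"
  by (auto simp: weight_space_def subspace_def K_simps scale_right_distrib scale_left_commute)

text \<open>The Chevalley involution. As \<open>\<epsilon>\<close> is its own inverse, passing from
  \<open>K\<close> to \<open>L\<close> negates weights and leaves the sign unchanged.\<close>

lemma swapped: "uq_sl2_module scale p \<epsilon> F E L K"
proof unfold_locales
  have L_eq: "weight_space scale L \<epsilon> p k = weight_space scale K \<epsilon> p (- k)" for k
  proof (intro equalityI subsetI)
    fix v assume "v \<in> weight_space scale L \<epsilon> p k"
    then have "v = scale (\<epsilon> * p powi k) (K v)"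
      using K_L[of v] by (simp add: weight_space_def K_simps)
    then have "scale (\<epsilon> * p powi (- k)) v = scale ((\<epsilon> * \<epsilon>) * (p powi (- k) * p powi k)) (K v)"
      by (metis (no_types, lifting) scale_scale mult.assoc mult.left_commute)
    then show "v \<in> weight_space scale K \<epsilon> p (- k)"
      by (simp add: weight_space_def powi_add[symmetric])
  next
    fix v assume "v \<in> weight_space scale K \<epsilon> p (- k)"
    then show "v \<in> weight_space scale L \<epsilon> p k"
      using L_weight[of v "- k"] by (simp add: weight_space_def)
  qed
  have "(\<Union>k. weight_space scale L \<epsilon> p k) = (\<Union>k. weight_space scale K \<epsilon> p k)"
    unfolding L_eq by (auto, metis minus_minus)
  then show "span (\<Union>k. weight_space scale L \<epsilon> p k) = UNIV"
    using span_weight_spaces by simp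
  show "\<exists>b. \<forall>k. \<forall>v\<in>weight_space scale L \<epsilon> p k. v \<noteq> 0 \<longrightarrow> \<bar>k\<bar> \<le> b"
    using weights_bounded unfolding L_eq by (metis abs_minus_cancel)
  show "L (F v) = scale (p powi 2) (F (L v))" for v
  proof -
    have "F v = F (K (L v))" by (simp add: K_L)
    also have "\<dots> = scale (p powi 2) (K (F (L v)))"
      using p_nonzero by (simp add: K_F power_int_minus)
    finally show ?thesis by (simp add: L_simps L_K)
  qed
  show "L (E v) = scale (p powi (- 2)) (E (L v))" for v
  proof -
    have "E v = E (K (L v))" by (simp add: K_L)
    also have "\<dots> = scale (p powi (- 2)) (K (E (L v)))"
      using p_nonzero by (simp add: K_E power_int_minus)
    finally show ?thesis by (simp add: L_simps L_K)
  qed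
  show "F (E v) - E (F v) = scale (inverse (p - inverse p)) (L v - K v)" for v
    using E_F[of v] by (metis minus_diff_eq scale_minus_right)
qed (use sign in \<open>simp_all add: E_simps F_simps K_simps L_simps K_L L_K\<close>)

lemma E_weight: "v \<in> weight_space scale K \<epsilon> p k \<Longrightarrow> E v \<in> weight_space scale K \<epsilon> p (k + 2)"
  by (simp add: weight_space_def K_E E_simps powi_add algebra_simps)

lemma F_weight: "v \<in> weight_space scale K \<epsilon> p k \<Longrightarrow> F v \<in> weight_space scale K \<epsilon> p (k - 2)"
  using powi_add[of k "- 2"] by (simp add: weight_space_def K_F F_simps algebra_simps)

lemma E_F_weight:
  assumes "v \<in> weight_space scale K \<epsilon> p k"
  shows "E (F v) = F (E v) + scale (\<epsilon> * qnum p k) v"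
proof -
  have "K v = scale (\<epsilon> * p powi k) v" "L v = scale (\<epsilon> * p powi (- k)) v"
    using assms L_weight by (auto simp: weight_space_def)
  then have "E (F v) - F (E v) = scale (inverse (p - inverse p))
      (scale (\<epsilon> * p powi k) v - scale (\<epsilon> * p powi (- k)) v)"
    by (simp add: E_F)
  also have "\<dots> = scale (inverse (p - inverse p) * (\<epsilon> * p powi k - \<epsilon> * p powi (- k))) v"
    by (simp only: scale_left_diff_distrib[symmetric] scale_scale)
  also have "inverse (p - inverse p) * (\<epsilon> * p powi k - \<epsilon> * p powi (- k)) = \<epsilon> * qnum p k"
    by (simp add: qnum_def divide_inverse right_diff_distrib left_diff_distrib mult_ac)
  finally show ?thesis by (simp add: algebra_simps)
qed

text \<open>The commutator of \<open>E\<close> and \<open>F\<close> on weight \<open>k\<close> is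
  \<open>\<epsilon> [k]\<close>; the factor \<open>\<epsilon>\<close> in front of \<open>F\<close>
  absorbs the sign.\<close>

sublocale wt: weighted_sl2 scale p "weight_space scale K \<epsilon> p" E "\<lambda>v. scale \<epsilon> (F v)"
proof unfold_locales
  fix v k
  assume v: "v \<in> weight_space scale K \<epsilon> p k"
  show "scale \<epsilon> (F v) \<in> weight_space scale K \<epsilon> p (k - 2)"
    using F_weight[OF v] subspace_weight_space subspace_scale by blast
  show "E (scale \<epsilon> (F v)) = scale \<epsilon> (F (E v)) + scale (qnum p k) v"
    using E_F_weight[OF v] by (simp add: E_simps scale_right_distrib mult.assoc[symmetric])
qed (simp_all add: subspace_weight_space E_weight E_simps F_simps scale_left_commute)

lemma F_pow_scale: "((\<lambda>v. scale \<epsilon> (F v)) ^^ j) v = scale (\<epsilon> ^ j) ((F ^^ j) v)"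
  by (induction j) (simp_all add: F_simps mult.commute)

lemma F_pow_weight_eq_0:
  "\<exists>r. \<forall>v \<in> weight_space scale K \<epsilon> p k. ((\<lambda>v. scale \<epsilon> (F v)) ^^ r) v = 0"
proof -
  obtain b where b: "\<And>k v. v \<in> weight_space scale K \<epsilon> p k \<Longrightarrow> v \<noteq> 0 \<Longrightarrow> \<bar>k\<bar> \<le> b"
    using weights_bounded by blast
  \<comment> \<open>This many applications of \<open>F\<close> carry the weight out of the interval
    of weights that occur.\<close>
  have "\<not> \<bar>k - 2 * int (nat (b + \<bar>k\<bar> + 1))\<bar> \<le> b" by linarith
  then show ?thesis
    using wt.f_pow_M[of _ k "nat (b + \<bar>k\<bar> + 1)"] b by metis
qed

lemma E_pow_injective:
  assumes "v \<in> weight_space scale K \<epsilon> p (- int m)" "(E ^^ m) v = 0"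
  shows "v = 0"
  using F_pow_weight_eq_0[of "- int m"] wt.e_pow_injective assms by blast

lemma F_eq_0_if_E_pow_eq_0:
  assumes "v \<in> weight_space scale K \<epsilon> p (- int m)" "(E ^^ Suc m) v = 0"
  shows "F v = 0"
proof -
  have "scale \<epsilon> (F v) = 0"
    using F_pow_weight_eq_0[of "- int m"] wt.f_eq_0_if_e_pow_eq_0 assms by blast
  then show ?thesis using sign by auto
qed

lemma F_E_pow:
  assumes "v \<in> weight_space scale K \<epsilon> p k"
  shows "F ((E ^^ Suc j) v) = (E ^^ Suc j) (F v)
    - scale (\<epsilon> * (qnum p (int j + 1) * qnum p (k + int j))) ((E ^^ j) v)"
proof -
  have "scale \<epsilon> ((E ^^ Suc j) (scale \<epsilon> (F v))) = (E ^^ Suc j) (F v)"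
    by (simp only: lin_scale[OF lin_funpow[OF lin_E]]) simp
  moreover have "scale \<epsilon> ((E ^^ Suc j) (scale \<epsilon> (F v)))
    = F ((E ^^ Suc j) v) + scale (\<epsilon> * (qnum p (int j + 1) * qnum p (k + int j))) ((E ^^ j) v)"
    unfolding wt.e_pow_f[OF assms] by (simp add: scale_right_distrib mult.assoc[symmetric])
  ultimately show ?thesis by (simp add: algebra_simps)
qed

section \<open>The adjoint action of quantum sl(2) on endomorphisms\<close>

definition End_weight :: "int \<Rightarrow> ('b \<Rightarrow> 'b) set" where
  "End_weight k = {X. lin scale X \<and> (\<forall>v. K (X v) = scale (p powi k) (X (K v)))}"

text \<open>The adjoint action \<open>E X - K X K^(-1) E\<close> belonging to the coproduct
  \<open>E \<otimes> 1 + K \<otimes> E\<close>. The sign \<open>\<epsilon>\<close> of the module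
  cancels under conjugation by \<open>K\<close>, so weights in \<open>End V\<close> carry
  none.\<close>

definition ad_E :: "('b \<Rightarrow> 'b) \<Rightarrow> 'b \<Rightarrow> 'b" where
  "ad_E X = (\<lambda>v. E (X v) - K (X (L (E v))))"

text \<open>For the coproduct \<open>F \<otimes> K^(-1) + 1 \<otimes> F\<close> the adjoint action
  of \<open>F\<close> is \<open>(F X - X F) K\<close>. As \<open>K\<close> is invertible, it
  vanishes exactly when \<open>X\<close> commutes with \<open>F\<close>.\<close>

definition ad_F :: "('b \<Rightarrow> 'b) \<Rightarrow> 'b \<Rightarrow> 'b" where
  "ad_F X = (\<lambda>v. F (X (K v)) - X (F (K v)))"

lemma ad_E_weight: "X \<in> End_weight k \<Longrightarrow> ad_E X = (\<lambda>v. E (X v) - scale (p powi k) (X (E v)))"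
  by (simp add: ad_E_def End_weight_def K_L)

sublocale ad: weighted_sl2 "\<lambda>c X v. scale c (X v)" p End_weight ad_E ad_F
proof -
  interpret V: vector_space "\<lambda>c (X :: 'b \<Rightarrow> 'b) v. scale c (X v)"
    by unfold_locales (simp_all add: fun_eq_iff scale_right_distrib scale_left_distrib)
  show "weighted_sl2 (\<lambda>c X v. scale c (X v)) p End_weight ad_E ad_F"
  proof unfold_locales
    show "V.subspace (End_weight k)" for k
      by (auto simp: End_weight_def V.subspace_def zero_fun_def plus_fun_def K_simps
          scale_right_distrib scale_left_commute lin_const_0 intro: lin_plus lin_scaled)
  next
    fix X k
    assume X: "X \<in> End_weight k"
    then have lX: "lin scale X" and KX: "\<And>v. K (X v) = scale (p powi k) (X (K v))"
      by (auto simp: End_weight_def)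
    note X_simps = lin_add[OF lX] lin_scale[OF lX] lin_diff[OF lX]
    have LXK: "L (X (K v)) = scale (p powi (- k)) (X v)" for v
    proof -
      have "X (K v) = scale (p powi (- k)) (K (X v))"
        by (simp add: KX powi_add[symmetric])
      then show ?thesis by (simp add: L_simps L_K)
    qed
    have "lin scale (\<lambda>v. E (X v) - scale (p powi k) (X (E v)))"
      by (rule linI) (simp_all add: E_simps X_simps add_diff_add scale_right_distrib
          scale_right_diff_distrib scale_left_commute)
    moreover have "K (E (X v) - scale (p powi k) (X (E v)))
        = scale (p powi (k + 2)) (E (X (K v)) - scale (p powi k) (X (E (K v))))" for v
      by (simp add: K_simps K_E KX E_simps X_simps scale_right_diff_distrib powi_add mult_ac)
    ultimately show "ad_E X \<in> End_weight (k + 2)"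
      unfolding ad_E_weight[OF X] by (simp add: End_weight_def)
    have "lin scale (ad_F X)"
      unfolding ad_F_def
      by (rule linI) (simp_all add: F_simps K_simps X_simps add_diff_add scale_right_diff_distrib)
    moreover have "K (ad_F X v) = scale (p powi (k - 2)) (ad_F X (K v))" for v
      using powi_add[of k "- 2"]
      by (simp add: ad_F_def K_simps K_F KX F_simps X_simps scale_right_diff_distrib mult_ac)
    ultimately show F: "ad_F X \<in> End_weight (k - 2)"
      by (simp add: End_weight_def)
    have "ad_E (ad_F X) v - ad_F (ad_E X) v = scale (qnum p k) (X v)" for v
    proof -
      have K': "K (E w) = scale (p powi 2) (E (K w))" for w by (rule K_E)
      have "ad_E (ad_F X) v = E (F (X (K v))) - E (X (F (K v)))
          - (scale (p powi k) (F (X (E (K v)))) - scale (p powi k) (X (F (E (K v)))))"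
        using powi_add[of "k - 2" 2]
        unfolding ad_E_weight[OF F] unfolding ad_F_def
        by (simp add: K' E_simps F_simps X_simps scale_right_diff_distrib)
      moreover have "ad_F (ad_E X) v = F (E (X (K v))) - scale (p powi k) (F (X (E (K v))))
          - (E (X (F (K v))) - scale (p powi k) (X (E (F (K v)))))"
        unfolding ad_E_weight[OF X] unfolding ad_F_def by (simp add: F_simps)
      ultimately have "ad_E (ad_F X) v - ad_F (ad_E X) v
          = (E (F (X (K v))) - F (E (X (K v))))
            - scale (p powi k) (X (E (F (K v)) - F (E (K v))))"
        by (simp add: X_simps scale_right_diff_distrib)
      \<comment> \<open>Both commutators become multiples of \<open>K - L\<close>. Moving
        \<open>K\<close> and \<open>L\<close> past \<open>X\<close> produces the same
        \<open>X K K\<close> term twice, which cancels; the two remaining multiples of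
        \<open>X\<close> combine to \<open>[k]\<close>.\<close>
      also have "\<dots> = scale (inverse (p - inverse p)) (scale (p powi k) (X (K (K v)))
          - scale (p powi (- k)) (X v)) - scale (inverse (p - inverse p))
            (scale (p powi k) (X (K (K v))) - scale (p powi k) (X v))"
        unfolding E_F
        by (simp add: X_simps KX LXK L_K scale_right_diff_distrib mult.commute)
      also have "\<dots> = scale (qnum p k) (X v)"
        by (simp add: qnum_def divide_inverse scale_right_diff_distrib left_diff_distrib
            right_diff_distrib scale_left_diff_distrib[symmetric] mult.commute)
      finally show ?thesis .
    qed
    then show "ad_E (ad_F X) = ad_F (ad_E X) + (\<lambda>v. scale (qnum p k) (X v))"
      by (auto simp: fun_eq_iff algebra_simps)
    show "ad_E (\<lambda>v. scale c (X v)) = (\<lambda>v. scale c (ad_E X v))" for c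
      by (simp add: ad_E_def fun_eq_iff E_simps K_simps scale_right_diff_distrib)
    show "ad_F (\<lambda>v. scale c (X v)) = (\<lambda>v. scale c (ad_F X v))" for c
      by (simp add: ad_F_def fun_eq_iff F_simps scale_right_diff_distrib)
  next
    show "ad_E (X + Y) = ad_E X + ad_E Y" for X Y
      by (simp add: ad_E_def fun_eq_iff E_simps K_simps)
  qed
qed

text \<open>A map of weight \<open>k\<close> sends weight \<open>a\<close> to weight
  \<open>a + k\<close>, and for \<open>\<bar>k\<bar> > 2 b\<close> these cannot both lie between
  \<open>-b\<close> and \<open>b\<close>.\<close>

lemma End_weight_eventually_0: "\<exists>b. \<forall>k. \<forall>X \<in> End_weight k. X \<noteq> 0 \<longrightarrow> \<bar>k\<bar> \<le> b"
proof -
  obtain b where b: "\<And>k v. v \<in> weight_space scale K \<epsilon> p k \<Longrightarrow> v \<noteq> 0 \<Longrightarrow> \<bar>k\<bar> \<le> b"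
    using weights_bounded by blast
  have "X = (\<lambda>v. 0)" if X: "X \<in> End_weight k" "\<bar>k\<bar> > 2 * b" for X k
  proof (rule lin_eq_on_span[OF _ lin_const_0 _ span_weight_spaces])
    show lX: "lin scale X" using X by (simp add: End_weight_def)
    fix v assume "v \<in> (\<Union>k. weight_space scale K \<epsilon> p k)"
    then obtain a where a: "v \<in> weight_space scale K \<epsilon> p a" by blast
    then have "X v \<in> weight_space scale K \<epsilon> p (a + k)"
      using X(1) by (simp add: weight_space_def End_weight_def lin_scale[OF lX] powi_add mult_ac)
    then show "X v = 0"
      using b[OF a] b[of "X v" "a + k"] X(2) lin_0[OF lX] by fastforce
  qed
  then show ?thesis by (intro exI[of _ "2 * b"]) (force simp: zero_fun_def)
qed

lemma ad_F_nilpotent: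
  assumes "X \<in> End_weight k" shows "\<exists>r. (ad_F ^^ r) X = 0"
proof -
  obtain b where b: "\<And>k X. X \<in> End_weight k \<Longrightarrow> X \<noteq> 0 \<Longrightarrow> \<bar>k\<bar> \<le> b"
    using End_weight_eventually_0 by blast
  have "\<not> \<bar>k - 2 * int (nat (b + \<bar>k\<bar> + 1))\<bar> \<le> b" by linarith
  then show ?thesis
    using ad.f_pow_M[OF assms, of "nat (b + \<bar>k\<bar> + 1)"] b by metis
qed

lemma ad_E_nilpotent:
  assumes "X \<in> End_weight k" shows "\<exists>r. (ad_E ^^ r) X = 0"
proof -
  obtain b where b: "\<And>k X. X \<in> End_weight k \<Longrightarrow> X \<noteq> 0 \<Longrightarrow> \<bar>k\<bar> \<le> b"
    using End_weight_eventually_0 by blast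
  have "\<not> \<bar>k + 2 * int (nat (b + \<bar>k\<bar> + 1))\<bar> \<le> b" by linarith
  then show ?thesis
    using ad.e_pow_M[OF assms, of "nat (b + \<bar>k\<bar> + 1)"] b by metis
qed

text \<open>On weight \<open>k\<close> the operator \<open>ad_E\<close> is left multiplication by
  \<open>E\<close> minus \<open>p^k\<close> times right multiplication by \<open>E\<close>, and each
  application raises the weight by 2. The coefficients therefore obey a Pascal recursion.\<close>

lemma ad_E_pow:
  assumes X: "X \<in> End_weight k"
  shows "(ad_E ^^ N) X v = (\<Sum>r\<le>N. scale ((-1) ^ r * qbinomial p N r
    * p powi (int r * (k + int N - 1))) ((E ^^ (N - r)) (X ((E ^^ r) v))))"
proof (induction N arbitrary: v)
  case 0
  then show ?case by simp
next
  case (Suc N)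
  have lX: "lin scale X" using X by (simp add: End_weight_def)
  define a where "a M r = (-1) ^ r * qbinomial p M r * p powi (int r * (k + int M - 1))" for M r
  define t where "t r = (E ^^ (Suc N - r)) (X ((E ^^ r) v))" for r
  \<comment> \<open>\<open>u\<close> and \<open>w\<close> are the two contributions of the Pascal
    rule, padded with 0 so that both sums run over all \<open>r \<le> N + 1\<close>.\<close>
  define u where "u r = (if r \<le> N then a N r else 0)" for r
  define w where "w r = (if r = 0 then 0 else p powi (k + 2 * int N) * a N (r - 1))" for r
  have aS: "a (Suc N) r = u r - w r" if r: "r \<le> Suc N" for r
  proof -
    consider "r = 0" | "1 \<le> r" "r \<le> N" | "r = Suc N"
      using r by linarith
    then show ?thesis
    proof cases
      case 1
      then show ?thesis by (simp add: a_def u_def w_def)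
    next
      case 2
      then obtain s where s: "r = Suc s" by (cases r) auto
      have "int r * (k + int (Suc N) - 1) + (- int r) = int r * (k + int N - 1)"
        "int r * (k + int (Suc N) - 1) + (int (Suc N) - int r)
          = (k + 2 * int N) + int s * (k + int N - 1)"
        by (simp_all add: s algebra_simps)
      then have *: "p powi (int r * (k + int (Suc N) - 1)) * p powi (- int r)
            = p powi (int r * (k + int N - 1))"
        "p powi (int r * (k + int (Suc N) - 1)) * p powi (int (Suc N) - int r)
            = p powi (k + 2 * int N) * p powi (int s * (k + int N - 1))"
        by (simp_all only: powi_add[symmetric])
      have "a (Suc N) r = (-1) ^ r * (p powi (int r * (k + int (Suc N) - 1)) * p powi (- int r))
            * qbinomial p N r
          + (-1) ^ r * (p powi (int r * (k + int (Suc N) - 1)) * p powi (int (Suc N) - int r))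
            * qbinomial p N (r - 1)"
        unfolding a_def qbinomial_pascal'[OF 2] by (simp add: algebra_simps)
      also have "\<dots> = u r - w r"
        unfolding * using 2 by (simp add: u_def w_def a_def s algebra_simps)
      finally show ?thesis .
    next
      case 3
      have "int r * (k + int (Suc N) - 1) = (k + 2 * int N) + int N * (k + int N - 1)"
        by (simp add: 3 algebra_simps)
      then have "p powi (int r * (k + int (Suc N) - 1))
          = p powi (k + 2 * int N) * p powi (int N * (k + int N - 1))"
        by (simp only: powi_add)
      then show ?thesis unfolding a_def w_def u_def using 3 by simp
    qed
  qed
  have Y: "(ad_E ^^ N) X \<in> End_weight (k + 2 * int N)"
    using ad.e_pow_M[OF X] .
  have "(ad_E ^^ Suc N) X v
      = E ((ad_E ^^ N) X v) - scale (p powi (k + 2 * int N)) ((ad_E ^^ N) X (E v))"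
    using ad_E_weight[OF Y] by simp
  also have "E ((ad_E ^^ N) X v) = (\<Sum>r\<le>N. scale (a N r) (t r))"
    unfolding Suc.IH lin_sum[OF lin_E]
    by (intro sum.cong) (simp_all add: E_simps a_def t_def Suc_diff_le)
  also have "\<dots> = (\<Sum>r\<le>Suc N. scale (u r) (t r))"
    by (simp add: u_def)
  also have "scale (p powi (k + 2 * int N)) ((ad_E ^^ N) X (E v))
      = (\<Sum>r\<le>N. scale (w (Suc r)) (t (Suc r)))"
    unfolding Suc.IH scale_sum_right
    by (intro sum.cong) (simp_all add: a_def w_def t_def funpow_swap1)
  also have "\<dots> = (\<Sum>r\<le>Suc N. scale (w r) (t r))"
    unfolding sum.atMost_Suc_shift by (simp add: w_def)
  also have "(\<Sum>r\<le>Suc N. scale (u r) (t r)) - (\<Sum>r\<le>Suc N. scale (w r) (t r))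
      = (\<Sum>r\<le>Suc N. scale (a (Suc N) r) (t r))"
    unfolding sum_subtractf[symmetric]
    by (intro sum.cong) (simp_all add: aS scale_left_diff_distrib)
  finally show ?case unfolding a_def t_def .
qed

text \<open>At weight \<open>-n\<close> and power \<open>n + 1\<close> the exponent
  \<open>r (k + N - 1)\<close> is 0, which leaves exactly the Serre coefficients.\<close>

lemma ad_E_pow_serre:
  assumes "X \<in> End_weight (- int n)"
  shows "(ad_E ^^ Suc n) X v = serre_op scale p E X (Suc n) v"
  unfolding serre_op_def by (subst ad_E_pow[OF assms]) (intro sum.cong, simp_all)

text \<open>The Serre relation says that \<open>ad_E^(n+1)\<close> kills \<open>X\<close>; at weight
  \<open>-n\<close> this forces \<open>ad_F X = 0\<close>.\<close>

lemma F_commutes_if_serre: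
  assumes X: "X \<in> End_weight (- int n)" and serre: "\<And>v. serre_op scale p E X (Suc n) v = 0"
  shows "F (X v) = X (F v)"
proof -
  have "(ad_E ^^ Suc n) X = 0"
    using ad_E_pow_serre[OF X] serre by (simp only: fun_eq_iff zero_fun_def) simp
  then have "ad_F X = 0"
    using ad_F_nilpotent[OF X] ad.f_eq_0_if_e_pow_eq_0[OF X] by blast
  then have "ad_F X (L v) = 0" by simp
  then show ?thesis by (simp add: ad_F_def K_L)
qed

text \<open>The reverse passage: \<open>X\<close> is a lowest vector of weight \<open>-n\<close> in
  \<open>End V\<close>, where \<open>ad_E\<close> is nilpotent.\<close>

lemma serre_if_F_commutes:
  assumes X: "X \<in> End_weight (- int n)" and comm: "\<And>v. F (X v) = X (F v)"
  shows "serre_op scale p E X (Suc n) v = 0"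
proof -
  have "ad_F X = 0" by (simp add: ad_F_def comm fun_eq_iff)
  then have "(ad_E ^^ Suc n) X = 0"
    using ad_E_nilpotent[OF X] ad.e_pow_eq_0_if_lowest[OF X] by blast
  then show ?thesis
    unfolding ad_E_pow_serre[OF X, symmetric] by simp
qed

end

section \<open>Consequences of the quantum Serre relation\<close>

context generic_parameter
begin

text \<open>Iterated, this is the quantum binomial theorem: it splits off one linear factor of the
  Serre coefficient polynomial at a time.\<close>

lemma gauss_sum_Suc:
  "(\<Sum>r\<le>Suc N. (-1) ^ r * qbinomial p (Suc N) r * x ^ r)
    = (1 - p powi (- int N) * x) * (\<Sum>r\<le>N. (-1) ^ r * qbinomial p N r * (p * x) ^ r)"
proof -
  define a where "a r = (-1) ^ r * qbinomial p N r * (p * x) ^ r" for r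
  define u where "u r = (if r \<le> N then a r else 0)" for r
  define w where "w r = (if r = 0 then 0 else p powi (- int N) * x * a (r - 1))" for r
  have term_eq: "(-1) ^ r * qbinomial p (Suc N) r * x ^ r = u r - w r" if r: "r \<le> Suc N" for r
  proof -
    consider "r = 0" | "1 \<le> r" "r \<le> N" | "r = Suc N"
      using r by linarith
    then show ?thesis
    proof cases
      case 1
      then show ?thesis by (simp add: a_def u_def w_def)
    next
      case 2
      then obtain s where s: "r = Suc s" by (cases r) auto
      have e: "int r - int (Suc N) = - int N + int s" by (simp add: s)
      have "p powi (int r - int (Suc N)) = p powi (- int N) * p ^ s"
        unfolding e powi_add by simp
      moreover have "p powi int r = p * p ^ s" by (simp only: s power_int_of_nat power_Suc)
      ultimately show ?thesis
        unfolding qbinomial_pascal[OF 2] using 2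
        by (simp add: u_def w_def a_def s power_mult_distrib algebra_simps)
    next
      case 3
      have "p powi (- int N) * p ^ N = 1"
        using p_nonzero by (simp add: power_int_minus)
      then have "p powi (- int N) * x * (p * x) ^ N = x ^ Suc N"
        by (simp add: power_mult_distrib)
      then show ?thesis
        using 3 by (auto simp: u_def w_def a_def mult.assoc mult.left_commute)
    qed
  qed
  have "(\<Sum>r\<le>Suc N. (-1) ^ r * qbinomial p (Suc N) r * x ^ r)
      = (\<Sum>r\<le>Suc N. u r) - (\<Sum>r\<le>Suc N. w r)"
    unfolding sum_subtractf[symmetric] by (intro sum.cong) (simp_all add: term_eq)
  also have "(\<Sum>r\<le>Suc N. u r) = (\<Sum>r\<le>N. a r)" by (simp add: u_def)
  also have "(\<Sum>r\<le>Suc N. w r) = p powi (- int N) * x * (\<Sum>r\<le>N. a r)"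
    unfolding sum.atMost_Suc_shift by (simp add: w_def sum_distrib_left)
  finally show ?thesis by (simp add: a_def algebra_simps)
qed

text \<open>In the step to \<open>N + 1\<close>, the split factor vanishes at \<open>p^N\<close>,
  the root with \<open>k = 0\<close>. For \<open>k > 0\<close> the argument \<open>p x\<close> of
  the remaining sum is the root with index \<open>k - 1\<close> for \<open>N\<close>.\<close>

lemma gauss_sum_root:
  "k < N \<Longrightarrow> (\<Sum>r\<le>N. (-1) ^ r * qbinomial p N r * (p powi (int N - 1 - 2 * int k)) ^ r) = 0"
proof (induction N arbitrary: k)
  case (Suc N)
  show ?case
  proof (cases k)
    case 0
    then show ?thesis
      unfolding gauss_sum_Suc using p_nonzero by (simp add: power_int_minus)
  next
    case (Suc j)
    have e: "1 + (int (Suc N) - 1 - 2 * int k) = int N - 1 - 2 * int j" by (simp add: Suc)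
    have "p * p powi (int (Suc N) - 1 - 2 * int k) = p powi (int N - 1 - 2 * int j)"
      unfolding e[symmetric] powi_add by simp
    then show ?thesis
      unfolding gauss_sum_Suc using Suc.IH[of j] Suc.prems Suc by simp
  qed
qed simp

end

text \<open>The coefficients \<open>d\<close> are the values at \<open>y\<close> of the Lagrange
  basis polynomials, hence independent of \<open>h\<close>. This is the inverse of a Vandermonde
  matrix in usable form.\<close>

lemma lagrange_functional:
  fixes Z :: "'a::field set"
  assumes "finite Z" "Z \<noteq> {}"
  shows "\<exists>d. \<forall>h. degree h < card Z \<longrightarrow> poly h y = (\<Sum>z\<in>Z. d z * poly h z)"
proof -
  define \<L> where "\<L> z = (\<Prod>w\<in>Z - {z}. [:- w, 1:])" for z
  have nz: "poly (\<L> z) z \<noteq> 0" for z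
    using assms(1) by (simp add: \<L>_def poly_prod)
  have ze: "poly (\<L> z) x = 0" if "x \<in> Z" "x \<noteq> z" for x z
    using assms(1) that by (auto simp: \<L>_def poly_prod)
  have deg: "degree (\<L> z) < card Z" if "z \<in> Z" for z
  proof -
    have "degree (\<L> z) \<le> (\<Sum>w\<in>Z - {z}. degree [:- w, 1:])"
      unfolding \<L>_def using degree_prod_sum_le[of "Z - {z}" "\<lambda>w. [:- w, 1:]"] assms(1)
      by (simp add: comp_def)
    also have "\<dots> = card Z - 1" using that assms by simp
    finally show ?thesis using that assms card_gt_0_iff[of Z] by linarith
  qed
  have "poly h y = (\<Sum>z\<in>Z. poly (\<L> z) y / poly (\<L> z) z * poly h z)" if h: "degree h < card Z" for h
  proof -
    define H where "H = (\<Sum>z\<in>Z. Polynomial.smult (poly h z / poly (\<L> z) z) (\<L> z))"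
    have "h = H"
    proof (rule poly_eqI_degree[of Z])
      fix x assume x: "x \<in> Z"
      have "poly H x = (\<Sum>z\<in>Z. if z = x then poly h x else 0)"
        unfolding H_def poly_sum by (intro sum.cong) (use x nz ze in auto)
      then show "poly h x = poly H x" using x assms(1) by simp
    next
      have "degree H \<le> card Z - 1"
        unfolding H_def
      proof (intro degree_sum_le order_trans[OF degree_smult_le])
        fix z assume "z \<in> Z"
        then show "degree (\<L> z) \<le> card Z - 1" using deg[of z] by linarith
      qed (rule assms(1))
      then show "card Z > degree H" using h by linarith
    qed (use h in auto)
    then have "poly h y = poly H y" by simp
    then show ?thesis by (simp add: H_def poly_sum mult_ac)
  qed
  then show ?thesis by (intro exI[of _ "\<lambda>z. poly (\<L> z) y / poly (\<L> z) z"]) simp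
qed

locale generic_vector_space = vector_space scale + generic_parameter p
  for scale :: "'a::field \<Rightarrow> 'b::ab_group_add \<Rightarrow> 'b" and p :: 'a
begin

text \<open>
  Substituting \<open>E^(D-b) X E^b\<close> for the monomial \<open>x^b\<close> turns the Serre relation into divisibility
  by a polynomial with roots in geometric progression. Modulo it any \<open>N\<close> distinct powers of \<open>x\<close>
  span everything, by invertibility of a Vandermonde matrix.
\<close>

lemma serre_exchange:
  assumes E: "lin scale E" and X: "lin scale X" and serre: "\<And>v. serre_op scale p E X N v = 0"
    and S: "finite S" "card S = N" "S \<subseteq> {..D}" and \<gamma>: "\<gamma> \<le> D" and "N > 0"
  shows "\<exists>c. \<forall>v. (E ^^ (D - \<gamma>)) (X ((E ^^ \<gamma>) v))
    = (\<Sum>\<beta>\<in>S. scale (c \<beta>) ((E ^^ (D - \<beta>)) (X ((E ^^ \<beta>) v))))"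
proof -
  \<comment> \<open>The power \<open>x k ^ \<beta>\<close> of a root is \<open>z \<beta> ^ k\<close>
    up to a factor independent of \<open>k\<close>. A relation between powers of \<open>x k\<close>
    at all \<open>N\<close> roots is thus interpolation at the nodes \<open>z \<beta>\<close>, with
    \<open>k\<close> now in the role of the degree; \<open>c\<close> is \<open>d\<close> corrected
    by those factors.\<close>
  define z where "z \<beta> = p powi (- 2 * int \<beta>)" for \<beta> :: nat
  have inj_z: "inj_on z S"
    unfolding z_def by (rule inj_onI) (simp add: powi_inject)
  have "z ` S \<noteq> {}" using S \<open>N > 0\<close> by auto
  then obtain d where d: "\<And>h. degree h < N \<Longrightarrow> poly h (z \<gamma>) = (\<Sum>w\<in>z ` S. d w * poly h w)"
    using lagrange_functional[of "z ` S" "z \<gamma>"] S inj_z by (auto simp: card_image)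
  define c where "c \<beta> = d (z \<beta>) * p powi ((int N - 1) * (int \<gamma> - int \<beta>))" for \<beta>
  define x where "x k = p powi (int N - 1 - 2 * int k)" for k :: nat
  have x_pow: "x k ^ \<beta> = p powi ((int N - 1) * int \<beta>) * z \<beta> ^ k" for k \<beta>
  proof -
    have "x k ^ \<beta> = p powi ((int N - 1 - 2 * int k) * int \<beta>)"
      by (simp only: x_def power_int_mult power_int_of_nat)
    also have "(int N - 1 - 2 * int k) * int \<beta> = (int N - 1) * int \<beta> + (- 2 * int \<beta>) * int k"
      by (simp add: algebra_simps)
    finally show ?thesis
      by (simp only: powi_add z_def power_int_mult power_int_of_nat)
  qed
  have inj_x: "inj_on x {..<N}"
    unfolding x_def by (rule inj_onI) (simp add: powi_inject)
  define G where "G = (\<Sum>r\<le>N. Polynomial.monom ((-1) ^ r * qbinomial p N r) r)"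
  define g where "g = Polynomial.monom 1 \<gamma> - (\<Sum>\<beta>\<in>S. Polynomial.monom (c \<beta>) \<beta>)"
  have coeff_G: "Polynomial.coeff G r = (if r \<le> N then (-1) ^ r * qbinomial p N r else 0)" for r
    by (simp add: G_def coeff_sum sum.delta)
  have deg_G: "degree G = N"
  proof (rule antisym)
    show "degree G \<le> N" by (rule degree_le) (simp add: coeff_G)
    show "N \<le> degree G" by (rule le_degree) (simp add: coeff_G)
  qed
  have root_G: "poly G (x k) = 0" if "k < N" for k
    using gauss_sum_root[OF that] by (simp add: G_def poly_sum poly_monom x_def)
  have root_g: "poly g (x k) = 0" if k: "k < N" for k
  proof -
    have "z \<gamma> ^ k = (\<Sum>w\<in>z ` S. d w * w ^ k)"
      using d[of "Polynomial.monom 1 k"] k by (simp add: poly_monom degree_monom_eq)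
    also have "\<dots> = (\<Sum>\<beta>\<in>S. d (z \<beta>) * z \<beta> ^ k)"
      by (simp add: sum.reindex[OF inj_z])
    finally have "x k ^ \<gamma> = (\<Sum>\<beta>\<in>S. p powi ((int N - 1) * int \<gamma>) * (d (z \<beta>) * z \<beta> ^ k))"
      by (simp add: x_pow sum_distrib_left)
    also have "\<dots> = (\<Sum>\<beta>\<in>S. c \<beta> * x k ^ \<beta>)"
    proof (rule sum.cong[OF refl])
      fix \<beta>
      have "(int N - 1) * int \<gamma> = (int N - 1) * (int \<gamma> - int \<beta>) + (int N - 1) * int \<beta>"
        by (simp add: algebra_simps)
      then have "p powi ((int N - 1) * int \<gamma>)
          = p powi ((int N - 1) * (int \<gamma> - int \<beta>)) * p powi ((int N - 1) * int \<beta>)"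
        by (simp only: powi_add)
      then show "p powi ((int N - 1) * int \<gamma>) * (d (z \<beta>) * z \<beta> ^ k) = c \<beta> * x k ^ \<beta>"
        by (simp only: c_def x_pow mult_ac)
    qed
    finally show ?thesis by (simp add: g_def poly_sum poly_monom)
  qed
  \<comment> \<open>The \<open>N\<close> roots of \<open>G\<close> are roots of \<open>g\<close>,
    and the remainder has degree below \<open>N\<close>.\<close>
  have "g mod G = 0"
  proof (rule poly_eqI_degree[of "x ` {..<N}"])
    fix y assume "y \<in> x ` {..<N}"
    then obtain k where k: "k < N" "y = x k" by auto
    have "poly g y = poly (g div G * G + g mod G) y" by simp
    then show "poly (g mod G) y = poly 0 y"
      unfolding poly_add poly_mult using root_g[OF k(1)] root_G[OF k(1)] k(2) by simp
  next
    have "G \<noteq> 0" using deg_G \<open>N > 0\<close> by auto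
    then show "card (x ` {..<N}) > degree (g mod G)"
      using degree_mod_less[of G g] deg_G \<open>N > 0\<close> inj_x by (auto simp: card_image)
  qed (use \<open>N > 0\<close> inj_x in \<open>simp add: card_image\<close>)
  then have g: "g = G * (g div G)"
    by (metis dvd_mult_div_cancel mod_eq_0_iff_dvd)
  \<comment> \<open>Homogeneous substitution in degree \<open>D\<close>. It sends
    \<open>x^j G\<close> to \<open>E^(D-j-N)\<close> after the Serre expression after
    \<open>E^j\<close>, which is 0.\<close>
  define \<Phi> where "\<Phi> f v = (\<Sum>b\<le>D. scale (Polynomial.coeff f b) ((E ^^ (D - b)) (X ((E ^^ b) v))))" for f v
  have \<Phi>_sum: "\<Phi> (sum f J) v = (\<Sum>j\<in>J. \<Phi> (f j) v)" for f :: "nat \<Rightarrow> 'a poly" and J v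
    unfolding \<Phi>_def coeff_sum scale_sum_left by (rule sum.swap)
  have \<Phi>_diff: "\<Phi> (f - h) v = \<Phi> f v - \<Phi> h v" for f h v
    by (simp add: \<Phi>_def scale_left_diff_distrib sum_subtractf)
  have \<Phi>_monom: "\<Phi> (Polynomial.monom a b) v = scale a ((E ^^ (D - b)) (X ((E ^^ b) v)))" if "b \<le> D" for a b v
  proof -
    have "\<Phi> (Polynomial.monom a b) v
        = (\<Sum>i\<le>D. if i = b then scale a ((E ^^ (D - b)) (X ((E ^^ b) v))) else 0)"
      unfolding \<Phi>_def by (rule sum.cong) auto
    then show ?thesis using that by simp
  qed
  have \<Phi>_G_monom: "\<Phi> (Polynomial.monom a j * G) v = 0" if "j + N \<le> D" for a j v
  proof -
    have "\<Phi> (Polynomial.monom a j * G) v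
        = (\<Sum>b\<in>{j..j + N}. scale (a * Polynomial.coeff G (b - j)) ((E ^^ (D - b)) (X ((E ^^ b) v))))"
      unfolding \<Phi>_def using that
      by (intro sum.mono_neutral_cong_right) (auto simp: coeff_monom_mult coeff_G)
    also have "\<dots> = (\<Sum>r\<le>N. scale (a * Polynomial.coeff G r) ((E ^^ (D - (j + r))) (X ((E ^^ (j + r)) v))))"
      by (rule sum.reindex_bij_witness[of _ "\<lambda>r. j + r" "\<lambda>b. b - j"]) auto
    also have "\<dots> = (\<Sum>r\<le>N. scale a ((E ^^ (D - (j + N)))
        (scale (Polynomial.coeff G r) ((E ^^ (N - r)) (X ((E ^^ r) ((E ^^ j) v)))))))"
    proof (rule sum.cong[OF refl])
      fix r assume "r \<in> {..N}"
      then have "D - (j + r) = (D - (j + N)) + (N - r)" using that by simp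
      then show "scale (a * Polynomial.coeff G r) ((E ^^ (D - (j + r))) (X ((E ^^ (j + r)) v)))
          = scale a ((E ^^ (D - (j + N)))
            (scale (Polynomial.coeff G r) ((E ^^ (N - r)) (X ((E ^^ r) ((E ^^ j) v))))))"
        by (simp add: lin_scale[OF lin_funpow[OF E]] funpow_add add.commute[of j])
    qed
    also have "\<dots> = scale a ((E ^^ (D - (j + N))) (serre_op scale p E X N ((E ^^ j) v)))"
      unfolding serre_op_def lin_sum[OF lin_funpow[OF E]] scale_sum_right
      by (intro sum.cong) (simp_all add: coeff_G)
    finally show ?thesis by (simp add: serre lin_0[OF lin_funpow[OF E]])
  qed
  have "\<Phi> g v = 0" for v
  proof (cases "g = 0")
    case True
    then show ?thesis by (simp add: \<Phi>_def)
  next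
    case False
    let ?h = "g div G"
    \<comment> \<open>The quotient then has degree at most \<open>D - N\<close>, so every
      \<open>x^j G\<close> occurring in \<open>g\<close> stays within the range that
      \<open>\<Phi>\<close> sees.\<close>
    have "degree g \<le> D"
      unfolding g_def using \<gamma> S
      by (intro degree_diff_le degree_sum_le) (auto intro: order_trans[OF degree_monom_le])
    moreover have "degree g = N + degree ?h"
      using degree_mult_eq[of G ?h] g False deg_G by (metis mult_eq_0_iff)
    ultimately have deg_h: "N + degree ?h \<le> D" by simp
    have "g = (\<Sum>j\<le>degree ?h. Polynomial.monom (Polynomial.coeff ?h j) j * G)"
      by (subst g) (simp add: sum_distrib_left[symmetric] poly_as_sum_of_monoms mult.commute[of _ G])
    then have "\<Phi> g v = (\<Sum>j\<le>degree ?h. \<Phi> (Polynomial.monom (Polynomial.coeff ?h j) j * G) v)"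
      by (simp only: \<Phi>_sum[symmetric])
    also have "\<dots> = 0"
      using deg_h by (intro sum.neutral) (simp add: \<Phi>_G_monom)
    finally show ?thesis .
  qed
  moreover have "\<Phi> g v = (E ^^ (D - \<gamma>)) (X ((E ^^ \<gamma>) v))
      - (\<Sum>\<beta>\<in>S. scale (c \<beta>) ((E ^^ (D - \<beta>)) (X ((E ^^ \<beta>) v))))" for v
    unfolding g_def \<Phi>_diff \<Phi>_sum \<Phi>_monom[OF \<gamma>] using S(3)
    by (simp, intro sum.cong) (auto simp: \<Phi>_monom)
  ultimately show ?thesis by (intro exI[of _ c]) simp
qed

end

section \<open>The filtration by centres of strings\<close>

locale borel_sl2_module = generic_vector_space scale p
  for scale :: "'a::field \<Rightarrow> 'b::ab_group_add \<Rightarrow> 'b" and p :: 'a +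
  fixes \<epsilon> :: 'a and E K :: "'b \<Rightarrow> 'b"
  assumes sign: "\<epsilon> \<in> {1, -1}"
    and lin_E: "lin scale E" and lin_K: "lin scale K"
    and K_E: "K (E v) = scale (p powi 2) (E (K v))"
    and span_weight_spaces: "span (\<Union>k. weight_space scale K \<epsilon> p k) = UNIV"
    and weights_bounded: "\<exists>b. \<forall>k. \<forall>v \<in> weight_space scale K \<epsilon> p k. v \<noteq> 0 \<longrightarrow> \<bar>k\<bar> \<le> b"
begin

abbreviation V :: "int \<Rightarrow> 'b set" where "V \<equiv> weight_space scale K \<epsilon> p"

lemma subspace_V: "subspace (V k)"
  by (auto simp: weight_space_def subspace_def lin_0[OF lin_K] lin_add[OF lin_K] lin_scale[OF lin_K]
      scale_right_distrib scale_left_commute)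

lemma V_Int: "v \<in> V a \<Longrightarrow> v \<in> V b \<Longrightarrow> v \<noteq> 0 \<Longrightarrow> a = b"
  using sign by (auto simp: weight_space_def powi_inject)

lemma V_eq_joint_eigenspace: "V k = joint_eigenspace scale (\<lambda>_::unit. K) (\<lambda>_. \<epsilon> * p powi k)"
  by (simp add: weight_space_def joint_eigenspace_def)

lemma V_components_eq_0:
  assumes "finite I" "\<And>a. a \<in> I \<Longrightarrow> v a \<in> V a" "sum v I = 0" "a \<in> I"
  shows "v a = 0"
proof -
  let ?\<kappa> = "\<lambda>a (_::unit). \<epsilon> * p powi a"
  have inj: "inj_on ?\<kappa> I"
    using sign by (auto intro!: inj_onI simp: fun_eq_iff powi_inject)
  define w where "w \<kappa> = v (the_inv_into I ?\<kappa> \<kappa>)" for \<kappa>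
  have w: "w (?\<kappa> a) = v a" if "a \<in> I" for a
    using the_inv_into_f_f[OF inj that] by (simp add: w_def)
  have "sum w (?\<kappa> ` I) = sum v I"
    unfolding sum.reindex[OF inj] comp_def by (intro sum.cong) (simp_all add: w)
  then have "w (?\<kappa> a) \<in> {0}"
    using assms w
    by (intro joint_eigenspace_components_in_subspace[of "?\<kappa> ` I" "\<lambda>_::unit. K" "{0}" w])
      (auto simp: lin_K lin_0[OF lin_K] subspace_def V_eq_joint_eigenspace)
  then show ?thesis using w assms(4) by simp
qed

lemma V_in_span_Int:
  assumes "G \<subseteq> (\<Union>k. V k)" "v \<in> span G" "v \<in> V k" "v \<noteq> 0"
  shows "\<exists>g \<in> G. g \<in> V k \<and> g \<noteq> 0"
proof (rule ccontr)
  assume no: "\<not> ?thesis"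
  have "v \<in> span (G \<inter> V k)"
    using span_joint_eigenvectors_Int[of "\<lambda>_::unit. K" G v "\<lambda>_. \<epsilon> * p powi k"] lin_K assms
    unfolding V_eq_joint_eigenspace by blast
  also have "span (G \<inter> V k) \<subseteq> {0}"
    using no by (intro span_minimal) (auto simp: subspace_def)
  finally show False using assms(4) by simp
qed

lemma lin_E_pow: "lin scale (E ^^ j)"
  using lin_E by (rule lin_funpow)

lemma E_V: "v \<in> V k \<Longrightarrow> E v \<in> V (k + 2)"
  by (simp add: weight_space_def K_E lin_scale[OF lin_E] powi_add algebra_simps)

lemma E_pow_V: "v \<in> V k \<Longrightarrow> (E ^^ j) v \<in> V (k + 2 * int j)"
proof (induction j)
  case (Suc j)
  then show ?case using E_V[of "(E ^^ j) v" "k + 2 * int j"] by (simp add: algebra_simps)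
qed simp

lemma E_pow_eq_0_mono: "(E ^^ i) v = 0 \<Longrightarrow> i \<le> j \<Longrightarrow> (E ^^ j) v = 0"
  using funpow_add[of "j - i" i E] lin_0[OF lin_E_pow] by simp

lemma E_pow_nilpotent: "v \<in> V k \<Longrightarrow> \<exists>j. (E ^^ j) v = 0"
proof -
  assume v: "v \<in> V k"
  obtain b where b: "\<And>k v. v \<in> V k \<Longrightarrow> v \<noteq> 0 \<Longrightarrow> \<bar>k\<bar> \<le> b"
    using weights_bounded by blast
  have "\<not> \<bar>k + 2 * int (nat (b + \<bar>k\<bar> + 1))\<bar> \<le> b" by linarith
  then show ?thesis
    using E_pow_V[OF v, of "nat (b + \<bar>k\<bar> + 1)"] b by metis
qed

text \<open>
  A string generated by \<open>v \<in> V a\<close> with \<open>E^(l+1) v = 0\<close> has its weights in \<open>{a, a + 2, ..., a + 2l}\<close>,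
  so its centre is at most \<open>a + l\<close>.
\<close>

definition string_vectors :: "int \<Rightarrow> 'b set" where
  "string_vectors c
    = {(E ^^ j) v | j v. \<exists>a. v \<in> V a \<and> a \<le> c \<and> (E ^^ nat (c - a + 1)) v = 0}"

definition centre_filtration :: "int \<Rightarrow> 'b set" where
  "centre_filtration c = span (string_vectors c)"

lemma subspace_centre_filtration: "subspace (centre_filtration c)"
  by (simp add: centre_filtration_def)

lemma E_pow_string_vector:
  "v \<in> V a \<Longrightarrow> a \<le> c \<Longrightarrow> (E ^^ nat (c - a + 1)) v = 0 \<Longrightarrow> (E ^^ j) v \<in> centre_filtration c"
  unfolding centre_filtration_def by (rule span_base) (auto simp: string_vectors_def)

lemma string_vector:
  "v \<in> V a \<Longrightarrow> a \<le> c \<Longrightarrow> (E ^^ nat (c - a + 1)) v = 0 \<Longrightarrow> v \<in> centre_filtration c"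
  using E_pow_string_vector[of v a c 0] by simp

lemma E_centre_filtration: "x \<in> centre_filtration c \<Longrightarrow> E x \<in> centre_filtration c"
proof -
  have "E g \<in> centre_filtration c" if g: "g \<in> string_vectors c" for g
  proof -
    obtain j v a where "g = (E ^^ j) v" "v \<in> V a" "a \<le> c" "(E ^^ nat (c - a + 1)) v = 0"
      using g by (auto simp: string_vectors_def)
    then show ?thesis using E_pow_string_vector[of v a c "Suc j"] by simp
  qed
  then show "x \<in> centre_filtration c \<Longrightarrow> E x \<in> centre_filtration c"
    using lin_span_image_subset[OF lin_E _ subspace_centre_filtration]
    by (auto simp: centre_filtration_def)
qed

lemma E_pow_centre_filtration: "x \<in> centre_filtration c \<Longrightarrow> (E ^^ j) x \<in> centre_filtration c"
  by (induction j) (simp_all add: E_centre_filtration)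

lemma semicommute_pow:
  assumes "lin scale Y" "\<And>v. Y (E v) = scale \<mu> (E (Y v))"
  shows "Y ((E ^^ j) v) = scale (\<mu> ^ j) ((E ^^ j) (Y v))"
  by (induction j) (simp_all add: assms(2) lin_scale[OF lin_E] mult.commute)

text \<open>Meant for \<open>Y\<close> equal to some \<open>K_j\<close> or its inverse: the start
  \<open>v\<close> of a string goes to \<open>Y v\<close>, of the same weight and killed by the same
  power of \<open>E\<close>.\<close>

lemma semicommute_centre_filtration:
  assumes Y: "lin scale Y" and "\<mu> \<noteq> 0" "\<And>v. Y (E v) = scale \<mu> (E (Y v))"
    and V: "\<And>v a. v \<in> V a \<Longrightarrow> Y v \<in> V a" and x: "x \<in> centre_filtration c"
  shows "Y x \<in> centre_filtration c"
proof -
  note pow = semicommute_pow[OF Y assms(3)]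
  have "Y g \<in> centre_filtration c" if "g \<in> string_vectors c" for g
  proof -
    from that obtain j v a where g: "g = (E ^^ j) v" "v \<in> V a" "a \<le> c" "(E ^^ nat (c - a + 1)) v = 0"
      by (auto simp: string_vectors_def)
    have "scale (\<mu> ^ nat (c - a + 1)) ((E ^^ nat (c - a + 1)) (Y v)) = 0"
      using g(4) pow[of "nat (c - a + 1)" v] lin_0[OF Y] by simp
    then have "(E ^^ nat (c - a + 1)) (Y v) = 0" using \<open>\<mu> \<noteq> 0\<close> by simp
    then have "(E ^^ j) (Y v) \<in> centre_filtration c"
      using E_pow_string_vector V[OF g(2)] g(3) by blast
    then show ?thesis
      unfolding g(1) pow using subspace_centre_filtration subspace_scale by blast
  qed
  then show ?thesis
    using lin_span_image_subset[OF Y _ subspace_centre_filtration] x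
    by (auto simp: centre_filtration_def)
qed

text \<open>Induction on \<open>d\<close> for \<open>X E^d v\<close>, where \<open>v\<close> starts
  a string and \<open>l = c - a\<close>. Exchange expresses it through terms with smaller
  \<open>d\<close> and terms containing \<open>E^\<beta> v = 0\<close> for
  \<open>\<beta> > l\<close>, either directly or after applying a power of \<open>E\<close>; in the
  second case the error is itself the start of an admissible string.\<close>

lemma serre_centre_filtration:
  assumes X: "lin scale X" and KX: "\<And>v. K (X v) = scale (p powi (- int n)) (X (K v))"
    and serre: "\<And>v. serre_op scale p E X (Suc n) v = 0" and x: "x \<in> centre_filtration c"
  shows "X x \<in> centre_filtration c"
proof -
  have X_V: "X v \<in> V (a - int n)" if "v \<in> V a" for v a
    using that powi_add[of a "- int n"] by (simp add: weight_space_def KX lin_scale[OF X] mult_ac)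
  have "X ((E ^^ d) v) \<in> centre_filtration c"
    if v: "v \<in> V a" "a \<le> c" "(E ^^ nat (c - a + 1)) v = 0" for v a d
  proof (induction d rule: less_induct)
    case (less d)
    define l where "l = nat (c - a)"
    have l: "nat (c - a + 1) = Suc l" "c - a = int l" using v(2) by (simp_all add: l_def)
    have E_0: "(E ^^ j) v = 0" if "l < j" for j
      using E_pow_eq_0_mono[OF v(3)] that l by simp
    consider "l < d" | "d \<le> l" "n < d" | "d \<le> l" "d \<le> n" by linarith
    then show ?case
    proof cases
      case 1
      then show ?thesis
        using E_0 lin_0[OF X] subspace_0[OF subspace_centre_filtration] by simp
    next
      case 2
      \<comment> \<open>The \<open>n + 1\<close> exponents \<open>0..n\<close> suffice for the
        exchange in degree \<open>d\<close>, and since \<open>n < d\<close> the induction hypothesis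
        covers all of them.\<close>
      obtain cf where cf: "(E ^^ (d - d)) (X ((E ^^ d) v))
          = (\<Sum>\<beta>\<in>{..n}. scale (cf \<beta>) ((E ^^ (d - \<beta>)) (X ((E ^^ \<beta>) v))))"
        using serre_exchange[OF lin_E X serre, of "{..n}" d d] 2 by auto
      have "(\<Sum>\<beta>\<in>{..n}. scale (cf \<beta>) ((E ^^ (d - \<beta>)) (X ((E ^^ \<beta>) v)))) \<in> centre_filtration c"
        using less.IH 2
        by (intro subspace_sum[OF subspace_centre_filtration]
            subspace_scale[OF subspace_centre_filtration] E_pow_centre_filtration) auto
      then show ?thesis using cf by simp
    next
      case 3
      \<comment> \<open>\<open>D\<close> is chosen so that the exponents below \<open>d\<close>,
        together with those from \<open>l + 1\<close> to \<open>D\<close>, on which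
        \<open>E^\<beta> v = 0\<close>, number exactly \<open>n + 1\<close>.\<close>
      define D where "D = n + l + 1 - d"
      have D: "l < D" "d \<le> D" using 3 by (auto simp: D_def)
      have "card ({..<d} \<union> {l + 1..D}) = Suc n"
        using 3 by (subst card_Un_disjoint) (auto simp: D_def)
      moreover have "{..<d} \<union> {l + 1..D} \<subseteq> {..D}" using D by auto
      ultimately obtain cf where cf: "(E ^^ (D - d)) (X ((E ^^ d) v))
          = (\<Sum>\<beta>\<in>{..<d} \<union> {l + 1..D}. scale (cf \<beta>) ((E ^^ (D - \<beta>)) (X ((E ^^ \<beta>) v))))"
        using serre_exchange[OF lin_E X serre, of "{..<d} \<union> {l + 1..D}" D d] D by auto
      also have "\<dots> = (\<Sum>\<beta><d. scale (cf \<beta>) ((E ^^ (D - \<beta>)) (X ((E ^^ \<beta>) v))))"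
        by (rule sum.mono_neutral_right) (auto simp: E_0 lin_0[OF X] lin_0[OF lin_E_pow])
      finally have *: "(E ^^ (D - d)) (X ((E ^^ d) v))
          = (\<Sum>\<beta><d. scale (cf \<beta>) ((E ^^ (D - \<beta>)) (X ((E ^^ \<beta>) v))))" .
      \<comment> \<open>The exchanged sum with the common power \<open>E^(D-d)\<close> stripped off
        the left. It lies in the filtration by induction and differs from \<open>X E^d v\<close> by
        a vector that \<open>E^(D-d)\<close> kills.\<close>
      define y where "y = (\<Sum>\<beta><d. scale (cf \<beta>) ((E ^^ (d - \<beta>)) (X ((E ^^ \<beta>) v))))"
      have y: "y \<in> centre_filtration c"
        unfolding y_def using less.IH
        by (intro subspace_sum[OF subspace_centre_filtration]
            subspace_scale[OF subspace_centre_filtration] E_pow_centre_filtration) auto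
      have "(E ^^ (D - d)) y = (\<Sum>\<beta><d. scale (cf \<beta>) ((E ^^ (D - \<beta>)) (X ((E ^^ \<beta>) v))))"
        unfolding y_def lin_sum[OF lin_E_pow]
      proof (rule sum.cong[OF refl])
        fix \<beta> assume "\<beta> \<in> {..<d}"
        then have "D - \<beta> = (D - d) + (d - \<beta>)" using D by auto
        then show "(E ^^ (D - d)) (scale (cf \<beta>) ((E ^^ (d - \<beta>)) (X ((E ^^ \<beta>) v))))
            = scale (cf \<beta>) ((E ^^ (D - \<beta>)) (X ((E ^^ \<beta>) v)))"
          by (simp add: lin_scale[OF lin_E_pow] funpow_add)
      qed
      then have kill: "(E ^^ (D - d)) (X ((E ^^ d) v) - y) = 0"
        by (simp add: lin_diff[OF lin_E_pow] *)
      let ?a = "a - int n + 2 * int d"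
      have "(E ^^ (d - \<beta>)) (X ((E ^^ \<beta>) v)) \<in> V ?a" if "\<beta> \<le> d" for \<beta>
      proof -
        have "a + 2 * int \<beta> - int n + 2 * int (d - \<beta>) = ?a" using that by simp
        then show ?thesis
          using E_pow_V[OF X_V[OF E_pow_V[OF v(1)]], of "d - \<beta>" \<beta>] that
          by (simp add: algebra_simps of_nat_diff)
      qed
      note weight = this
      have wt: "X ((E ^^ d) v) - y \<in> V ?a"
        using weight[of d] weight unfolding y_def
        by (intro subspace_diff[OF subspace_V] subspace_sum[OF subspace_V]
            subspace_scale[OF subspace_V]) auto
      \<comment> \<open>The weight of the error and the power of \<open>E\<close> killing it fit the
        bound in \<open>string_vectors\<close> exactly.\<close>
      have "c - ?a + 1 = int (D - d)" and a_le: "?a \<le> c"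
        using 3 l(2) by (auto simp: D_def)
      then have "nat (c - ?a + 1) = D - d" by (simp only: nat_int)
      then have "X ((E ^^ d) v) - y \<in> centre_filtration c"
        using kill by (intro string_vector[OF wt a_le]) (simp only:)
      then show ?thesis
        using subspace_add[OF subspace_centre_filtration _ y] by fastforce
    qed
  qed
  then have "X g \<in> centre_filtration c" if "g \<in> string_vectors c" for g
    using that by (auto simp: string_vectors_def)
  then show ?thesis
    using lin_span_image_subset[OF X _ subspace_centre_filtration] x
    by (auto simp: centre_filtration_def)
qed

text \<open>For the least \<open>c\<close> with a nonzero filtration step, step \<open>c\<close> is
  everything and step \<open>c - 1\<close> is zero. Weights below \<open>c\<close> then reflect at
  \<open>c\<close>, and each weight is bounded by a reflected one; symmetry at 0 forces
  \<open>c = 0\<close>.\<close>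

lemma centred:
  assumes irr: "\<And>c. centre_filtration c = {0} \<or> centre_filtration c = UNIV"
    and "u \<noteq> (0 :: 'b)"
    and sym: "\<And>k. V k \<noteq> {0} \<Longrightarrow> V (- k) \<noteq> {0}"
  shows "centre_filtration 0 = UNIV" and "centre_filtration (- 1) = {0}"
proof -
  have V_0: "0 \<in> V k" for k using subspace_0[OF subspace_V] .
  obtain b where b: "\<And>k v. v \<in> V k \<Longrightarrow> v \<noteq> 0 \<Longrightarrow> \<bar>k\<bar> \<le> b"
    using weights_bounded by blast
  have "(\<Union>k. V k) \<subseteq> {0} \<Longrightarrow> span (\<Union>k. V k) \<subseteq> {0}"
    by (intro span_minimal) (auto simp: subspace_def)
  then obtain v0 a0 where v0: "v0 \<in> V a0" "v0 \<noteq> 0"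
    using span_weight_spaces \<open>u \<noteq> 0\<close> by auto
  \<comment> \<open>No weight lies below \<open>-b\<close>, so the step at \<open>- b - 1\<close> is
    zero; counting from there makes a least nonzero step available.\<close>
  define f where "f m = centre_filtration (- b - 1 + int m)" for m
  have f_0: "f 0 = {0}"
  proof -
    have "string_vectors (- b - 1) \<subseteq> {0}"
      using b lin_0[OF lin_E_pow] by (force simp: string_vectors_def)
    then have "f 0 \<subseteq> {0}"
      unfolding f_def centre_filtration_def by (intro span_minimal) (auto simp: subspace_def)
    then show ?thesis
      using subspace_0[OF subspace_centre_filtration] by (auto simp: f_def)
  qed
  have "\<exists>m. f m \<noteq> {0}"
  proof -
    obtain j where j: "(E ^^ j) v0 = 0" using E_pow_nilpotent[OF v0(1)] by blast
    let ?m = "nat (a0 + int j + b + 1)"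
    have c: "- b - 1 + int ?m = a0 + int j"
      using b[OF v0] by linarith
    have "v0 \<in> f ?m"
      unfolding f_def c
      by (rule string_vector[OF v0(1)]) (use E_pow_eq_0_mono[OF j, of "Suc j"] in \<open>auto simp: nat_add_distrib\<close>)
    then show ?thesis using v0(2) by blast
  qed
  then obtain m where m: "f m \<noteq> {0}" "\<And>i. i < m \<Longrightarrow> f i = {0}"
    using exists_least_iff[of "\<lambda>m. f m \<noteq> {0}"] by blast
  have "m > 0" using m(1) f_0 by (cases m) auto
  define c where "c = - b - 1 + int m"
  have c_UNIV: "centre_filtration c = UNIV"
    using m(1) irr[of c] by (simp add: f_def c_def)
  have c_0: "centre_filtration (c - 1) = {0}"
    using m(2)[of "m - 1"] \<open>m > 0\<close> by (simp add: f_def c_def of_nat_diff algebra_simps)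
  \<comment> \<open>A nonzero vector of weight \<open>a \<le> c\<close> survives
    \<open>E^(c-a)\<close>, since otherwise it would start a string lying in step
    \<open>c - 1\<close>.\<close>
  have reflect: "V (2 * c - a) \<noteq> {0}" if a: "V a \<noteq> {0}" "a \<le> c" for a
  proof -
    obtain v where v: "v \<in> V a" "v \<noteq> 0" using a(1) V_0 by blast
    have "(E ^^ nat (c - a)) v \<noteq> 0"
    proof (cases "a = c")
      case False
      show ?thesis
      proof
        assume "(E ^^ nat (c - a)) v = 0"
        then have "v \<in> centre_filtration (c - 1)"
          using False a(2) by (intro string_vector[OF v(1)]) auto
        then show False using c_0 v(2) by simp
      qed
    qed (use v in simp)
    moreover have "(E ^^ nat (c - a)) v \<in> V (2 * c - a)"
      using E_pow_V[OF v(1), of "nat (c - a)"] a(2) by (simp add: algebra_simps)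
    ultimately show ?thesis by blast
  qed
  \<comment> \<open>Every weight occurs on a string that starts at some \<open>a' \<le> c\<close>
    and ends no later than \<open>2 c - a'\<close>.\<close>
  have bound: "\<exists>a'. V a' \<noteq> {0} \<and> a' \<le> c \<and> a \<le> 2 * c - a'" if a: "V a \<noteq> {0}" for a
  proof -
    obtain v where v: "v \<in> V a" "v \<noteq> 0" using a V_0 by blast
    have "string_vectors c \<subseteq> (\<Union>k. V k)"
      using E_pow_V by (fastforce simp: string_vectors_def)
    moreover have "v \<in> span (string_vectors c)"
      using c_UNIV by (simp add: centre_filtration_def)
    ultimately obtain g where g: "g \<in> string_vectors c" "g \<in> V a" "g \<noteq> 0"
      using V_in_span_Int v by blast
    then obtain j w a' where w: "g = (E ^^ j) w" "w \<in> V a'" "a' \<le> c"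
      "(E ^^ nat (c - a' + 1)) w = 0"
      by (auto simp: string_vectors_def)
    have "w \<noteq> 0" using g(3) w(1) lin_0[OF lin_E_pow] by auto
    have "a = a' + 2 * int j"
      using V_Int[OF g(2) _ g(3)] E_pow_V[OF w(2), of j] w(1) by simp
    moreover have "j < nat (c - a' + 1)"
      using E_pow_eq_0_mono[OF w(4), of j] g(3) w(1) by (meson not_le)
    ultimately show ?thesis
      using w(2,3) \<open>w \<noteq> 0\<close> by (intro exI[of _ a']) auto
  qed
  define S where "S = {a. V a \<noteq> {0}}"
  have "S \<subseteq> {- b..b}"
    using b V_0 by (fastforce simp: S_def)
  then have fin: "finite S" by (rule finite_subset) simp
  have "a0 \<in> S" using v0 by (auto simp: S_def)
  \<comment> \<open>The least weight decides: the bound for the weight \<open>-d\<close> gives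
    \<open>c \<ge> 0\<close>, while reflecting \<open>d\<close> at \<open>c\<close> and then at 0
    gives the weight \<open>d - 2 c\<close>, hence \<open>c \<le> 0\<close>.\<close>
  define d where "d = Min S"
  have d: "d \<in> S" "\<And>a. a \<in> S \<Longrightarrow> d \<le> a"
    using fin \<open>a0 \<in> S\<close> by (auto simp: d_def intro: Min_in)
  have "- d \<in> S" using d(1) sym by (simp add: S_def)
  then obtain a' where "a' \<in> S" "- d \<le> 2 * c - a'"
    using bound[of "- d"] by (auto simp: S_def)
  then have "c \<ge> 0" using d(2)[of a'] by linarith
  obtain a'' where "a'' \<in> S" "a'' \<le> c" using bound[of d] d(1) by (auto simp: S_def)
  then have "d \<le> c" using d(2) by fastforce
  then have "2 * c - d \<in> S" using reflect d(1) by (simp add: S_def)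
  then have "d - 2 * c \<in> S" using sym[of "2 * c - d"] by (simp add: S_def)
  then have "c = 0" using d(2)[of "d - 2 * c"] \<open>c \<ge> 0\<close> by linarith
  then show "centre_filtration 0 = UNIV" "centre_filtration (- 1) = {0}"
    using c_UNIV c_0 by simp_all
qed

end


section \<open>Recovering the lowering operator\<close>

locale centred_borel_sl2_module = borel_sl2_module scale p \<epsilon> E K
  for scale :: "'a::field \<Rightarrow> 'b::ab_group_add \<Rightarrow> 'b" and p \<epsilon> :: 'a and E K :: "'b \<Rightarrow> 'b" +
  assumes filtration_0: "centre_filtration 0 = UNIV"
    and filtration_neg: "centre_filtration (- 1) = {0}"
begin

text \<open>The future kernel of the lowering operator, described by \<open>E\<close> and
  \<open>K\<close> alone: in a quantum sl(2)-module a vector of weight \<open>-m\<close> killed by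
  \<open>E^(m+1)\<close> is killed by \<open>F\<close>.\<close>

definition lowest :: "nat \<Rightarrow> 'b set" where
  "lowest m = {v \<in> V (- int m). (E ^^ Suc m) v = 0}"

lemma subspace_lowest: "subspace (lowest m)"
  using subspace_V[of "- int m"] lin_E_pow[of "Suc m"]
  unfolding lowest_def subspace_def
  by (simp add: lin_0 lin_add lin_scale del: funpow.simps)

text \<open>For \<open>m > 0\<close> such a vector would start a string centred at most at
  \<open>-1\<close>.\<close>

lemma E_pow_injective:
  assumes "v \<in> V (- int m)" "(E ^^ m) v = 0" shows "v = 0"
proof (cases "m = 0")
  case False
  have "v \<in> centre_filtration (- 1)"
    by (rule string_vector[OF assms(1)]) (use False assms(2) in auto)
  then show ?thesis using filtration_neg by simp
qed (use assms in simp)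

lemma span_E_pow_lowest: "span {(E ^^ j) v | j v m. v \<in> lowest m} = UNIV"
proof -
  have "string_vectors 0 \<subseteq> {(E ^^ j) v | j v m. v \<in> lowest m}"
  proof
    fix x assume "x \<in> string_vectors 0"
    then obtain j v a where v: "x = (E ^^ j) v" "v \<in> V a" "a \<le> 0" "(E ^^ nat (0 - a + 1)) v = 0"
      by (auto simp: string_vectors_def)
    have "nat (0 - a + 1) = Suc (nat (- a))" using v(3) by simp
    then have "v \<in> lowest (nat (- a))"
      using v(2-4) by (simp add: lowest_def del: funpow.simps)
    then show "x \<in> {(E ^^ j) v | j v m. v \<in> lowest m}" using v(1) by blast
  qed
  from span_mono[OF this] show ?thesis
    using filtration_0 by (auto simp: centre_filtration_def)
qed

lemma E_pow_lowest_eq_0: "v \<in> lowest m \<Longrightarrow> m < j \<Longrightarrow> (E ^^ j) v = 0"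
  using E_pow_eq_0_mono[of "Suc m" v j] by (simp add: lowest_def)

lemma E_pow_lowest_V: "v \<in> lowest m \<Longrightarrow> (E ^^ j) v \<in> V (2 * int j - int m)"
  using E_pow_V[of v "- int m" j] by (simp add: lowest_def)

text \<open>A common bound on string lengths makes every decomposition a sum over the same finite
  index set.\<close>

definition string_bound :: nat where
  "string_bound = (SOME b. \<forall>m v. v \<in> lowest m \<longrightarrow> v \<noteq> 0 \<longrightarrow> m \<le> b)"

lemma string_bound: "v \<in> lowest m \<Longrightarrow> v \<noteq> 0 \<Longrightarrow> m \<le> string_bound"
proof -
  obtain b where b: "\<And>k v. v \<in> V k \<Longrightarrow> v \<noteq> 0 \<Longrightarrow> \<bar>k\<bar> \<le> b"
    using weights_bounded by blast
  have "\<exists>b. \<forall>m v. v \<in> lowest m \<longrightarrow> v \<noteq> 0 \<longrightarrow> m \<le> b"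
    using b by (intro exI[of _ "nat b"]) (fastforce simp: lowest_def)
  from someI_ex[OF this] show "v \<in> lowest m \<Longrightarrow> v \<noteq> 0 \<Longrightarrow> m \<le> string_bound"
    unfolding string_bound_def by blast
qed

definition string_indices :: "(nat \<times> nat) set" where
  "string_indices = (SIGMA m:{..string_bound}. {..m})"

text \<open>The index \<open>(m, j)\<close> stands for \<open>E^j\<close> applied to a lowest vector
  of weight \<open>-m\<close>. Entries off the index set are forced to be 0 so that uniqueness
  becomes equality of functions.\<close>

definition is_decomposition :: "(nat \<times> nat \<Rightarrow> 'b) \<Rightarrow> 'b \<Rightarrow> bool" where
  "is_decomposition l v \<longleftrightarrow> (\<forall>i. l i \<in> lowest (fst i)) \<and> (\<forall>i. i \<notin> string_indices \<longrightarrow> l i = 0)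
    \<and> v = (\<Sum>i\<in>string_indices. (E ^^ snd i) (l i))"

lemma finite_string_indices: "finite string_indices"
  by (simp add: string_indices_def)

lemma is_decomposition_add:
  "is_decomposition l v \<Longrightarrow> is_decomposition l' v' \<Longrightarrow> is_decomposition (\<lambda>i. l i + l' i) (v + v')"
  by (auto simp: is_decomposition_def lin_add[OF lin_E_pow] sum.distrib
      intro: subspace_add[OF subspace_lowest])

lemma is_decomposition_scale:
  "is_decomposition l v \<Longrightarrow> is_decomposition (\<lambda>i. scale c (l i)) (scale c v)"
  by (auto simp: is_decomposition_def lin_scale[OF lin_E_pow] scale_sum_right
      intro: subspace_scale[OF subspace_lowest])

lemma is_decomposition_single:
  assumes "v \<in> lowest m" "j \<le> m"
  shows "is_decomposition (\<lambda>i. if i = (m, j) then v else 0) ((E ^^ j) v)"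
proof -
  have "v = 0 \<or> (m, j) \<in> string_indices"
    using string_bound[OF assms(1)] assms(2) by (auto simp: string_indices_def)
  moreover have "(\<Sum>i\<in>string_indices. (E ^^ snd i) (if i = (m, j) then v else 0))
      = (\<Sum>i\<in>string_indices. if i = (m, j) then (E ^^ j) v else 0)"
    by (intro sum.cong) (auto simp: lin_0[OF lin_E_pow])
  ultimately show ?thesis
    unfolding is_decomposition_def
    using assms(1) finite_string_indices subspace_0[OF subspace_lowest]
    by (auto simp: lin_0[OF lin_E_pow])
qed

lemma ex_decomposition: "\<exists>l. is_decomposition l v"
proof -
  let ?W = "{v. \<exists>l. is_decomposition l v}"
  have zero: "is_decomposition (\<lambda>i. 0) 0"
    by (simp add: is_decomposition_def subspace_0[OF subspace_lowest] lin_0[OF lin_E_pow])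
  have "subspace ?W"
    unfolding subspace_def using zero is_decomposition_add is_decomposition_scale by blast
  moreover have "{(E ^^ j) v | j v m. v \<in> lowest m} \<subseteq> ?W"
  proof clarify
    fix j v m assume v: "v \<in> lowest m"
    show "\<exists>l. is_decomposition l ((E ^^ j) v)"
      using is_decomposition_single[OF v] E_pow_lowest_eq_0[OF v] zero by (metis not_le)
  qed
  ultimately have "span {(E ^^ j) v | j v m. v \<in> lowest m} \<subseteq> ?W" by (rule span_minimal[rotated])
  then show ?thesis using span_E_pow_lowest by auto
qed

text \<open>
  Applying \<open>E^t\<close> to a relation that only involves string positions \<open>(m, j)\<close> with \<open>m - j \<le> t\<close>
  leaves the terms with \<open>m - j = t\<close>, moved to the tops of their strings, where their weights differ.
\<close>

lemma decomposition_0: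
  assumes "is_decomposition l 0" shows "l i = 0"
proof -
  have low: "l i \<in> lowest (fst i)" for i using assms unfolding is_decomposition_def by blast
  \<comment> \<open>Induction downwards on the distance \<open>m - j\<close> to the top of the
    string, phrased upwards through its complement in \<open>string_bound\<close>.\<close>
  have "\<forall>i\<in>string_indices. string_bound - (fst i - snd i) = k \<longrightarrow> l i = 0" for k
  proof (induction k rule: less_induct)
    case (less k)
    show ?case
    proof (intro ballI impI)
      fix i assume i: "i \<in> string_indices" "string_bound - (fst i - snd i) = k"
      define t where "t = fst i - snd i"
      have above: "l i' = 0" if "i' \<in> string_indices" "fst i' - snd i' > t" for i'
      proof -
        have "fst i' \<le> string_bound" using that(1) by (auto simp: string_indices_def)
        then have "string_bound - (fst i' - snd i') < k"
          using that(2) i(2) by (auto simp: t_def)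
        then show ?thesis using less.IH that(1) by blast
      qed
      have t: "t \<le> string_bound" using i(1) by (auto simp: t_def string_indices_def)
      let ?D = "(\<lambda>m. (m, m - t)) ` {t..string_bound}"
      have inj: "inj_on (\<lambda>m. (m, m - t)) {t..string_bound}" by (auto intro: inj_onI)
      have "0 = (E ^^ t) (\<Sum>i\<in>string_indices. (E ^^ snd i) (l i))"
        using assms by (simp add: is_decomposition_def lin_0[OF lin_E_pow])
      also have "\<dots> = (\<Sum>i\<in>string_indices. (E ^^ (t + snd i)) (l i))"
        by (simp add: lin_sum[OF lin_E_pow] funpow_add)
      also have "\<dots> = (\<Sum>i\<in>?D. (E ^^ (t + snd i)) (l i))"
      proof (rule sum.mono_neutral_right[OF finite_string_indices])
        show "?D \<subseteq> string_indices" by (auto simp: string_indices_def)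
        show "\<forall>i'\<in>string_indices - ?D. (E ^^ (t + snd i')) (l i') = 0"
        proof
          fix i' assume i': "i' \<in> string_indices - ?D"
          obtain m j where mj: "i' = (m, j)" by (cases i')
          have "j \<le> m" "m \<le> string_bound" using i' mj by (auto simp: string_indices_def)
          moreover have "m - j \<noteq> t"
          proof
            assume "m - j = t"
            then have "i' = (m, m - t)" "m \<in> {t..string_bound}"
              using mj \<open>j \<le> m\<close> \<open>m \<le> string_bound\<close> by auto
            then show False using i' by blast
          qed
          ultimately show "(E ^^ (t + snd i')) (l i') = 0"
            using above[of i'] i' mj E_pow_lowest_eq_0[OF low[of i'], of "t + j"]
            by (cases "m - j > t") (auto simp: lin_0[OF lin_E_pow])
        qed
      qed
      also have "\<dots> = (\<Sum>m\<in>{t..string_bound}. (E ^^ m) (l (m, m - t)))"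
        unfolding sum.reindex[OF inj] by (intro sum.cong) auto
      also have "\<dots> = (\<Sum>a\<in>int ` {t..string_bound}. (E ^^ nat a) (l (nat a, nat a - t)))"
        by (simp add: sum.reindex)
      finally have sum_0: "(\<Sum>a\<in>int ` {t..string_bound}. (E ^^ nat a) (l (nat a, nat a - t))) = 0"
        by simp
      have "snd i \<le> fst i" "fst i \<le> string_bound" using i(1) by (auto simp: string_indices_def)
      then have fst_i: "fst i \<in> {t..string_bound}" "l (fst i, fst i - t) = l i"
        by (auto simp: t_def)
      have "(E ^^ nat (int (fst i))) (l (nat (int (fst i)), nat (int (fst i)) - t)) = 0"
      proof (rule V_components_eq_0[OF _ _ sum_0])
        fix a assume "a \<in> int ` {t..string_bound}"
        then obtain m where "a = int m" by blast
        then show "(E ^^ nat a) (l (nat a, nat a - t)) \<in> V a"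
          using E_pow_lowest_V[OF low[of "(m, m - t)"], of m] by simp
      qed (use fst_i in auto)
      then have "(E ^^ fst i) (l i) = 0" using fst_i by simp
      then show "l i = 0" using E_pow_injective low[of i] by (auto simp: lowest_def)
    qed
  qed
  then show ?thesis using assms unfolding is_decomposition_def by blast
qed

lemma decomposition_unique:
  assumes "is_decomposition l v" "is_decomposition l' v" shows "l = l'"
proof
  fix i
  have "is_decomposition (\<lambda>i. l i + scale (- 1) (l' i)) (v + scale (- 1) v)"
    by (intro is_decomposition_add is_decomposition_scale assms)
  then have "l i + scale (- 1) (l' i) = 0"
    using decomposition_0[of "\<lambda>i. l i + scale (- 1) (l' i)" i] by simp
  then show "l i = l' i" by simp
qed

definition components :: "'b \<Rightarrow> nat \<times> nat \<Rightarrow> 'b" where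
  "components v = (SOME l. is_decomposition l v)"

lemma components: "is_decomposition (components v) v"
  unfolding components_def by (rule someI_ex[OF ex_decomposition])

lemma components_eq: "is_decomposition l v \<Longrightarrow> components v = l"
  using components decomposition_unique by blast

text \<open>The coefficients are those of the \<open>(m+1)\<close>-dimensional irreducible module in
  the basis \<open>E^j v\<close>. At \<open>j = 0\<close> the factor \<open>[j]\<close> is 0, which
  makes the truncated \<open>j - 1\<close> harmless.\<close>

definition F :: "'b \<Rightarrow> 'b" where
  "F v = (\<Sum>i\<in>string_indices. scale (\<epsilon> * (qnum p (int (snd i)) * qnum p (int (fst i) - int (snd i) + 1)))
    ((E ^^ (snd i - 1)) (components v i)))"

lemma lin_F: "lin scale F"
proof (rule linI)
  fix x y
  have "components (x + y) = (\<lambda>i. components x i + components y i)"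
    by (intro components_eq is_decomposition_add components)
  then show "F (x + y) = F x + F y"
    by (simp add: F_def lin_add[OF lin_E_pow] scale_right_distrib sum.distrib)
next
  fix c x
  have "components (scale c x) = (\<lambda>i. scale c (components x i))"
    by (intro components_eq is_decomposition_scale components)
  then show "F (scale c x) = scale c (F x)"
    by (simp add: F_def lin_scale[OF lin_E_pow] scale_sum_right mult.commute)
qed

text \<open>No upper bound on \<open>j\<close> is imposed, which spares boundary cases later: at
  \<open>j = m + 1\<close> the factor \<open>[m - j + 1]\<close> is 0, and beyond it both powers of
  \<open>E\<close> kill \<open>v\<close>.\<close>

lemma F_E_pow_lowest:
  assumes v: "v \<in> lowest m"
  shows "F ((E ^^ j) v) = scale (\<epsilon> * (qnum p (int j) * qnum p (int m - int j + 1))) ((E ^^ (j - 1)) v)"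
proof -
  consider "j \<le> m" | "j = Suc m" | "Suc m < j" by linarith
  then show ?thesis
  proof cases
    case 1
    note dec = is_decomposition_single[OF v 1]
    have "F ((E ^^ j) v) = (\<Sum>i\<in>string_indices. if i = (m, j)
      then scale (\<epsilon> * (qnum p (int j) * qnum p (int m - int j + 1))) ((E ^^ (j - 1)) v) else 0)"
      unfolding F_def components_eq[OF dec]
      by (intro sum.cong) (auto simp: lin_0[OF lin_E_pow])
    moreover have "v = 0 \<or> (m, j) \<in> string_indices"
      using string_bound[OF v] 1 by (auto simp: string_indices_def)
    ultimately show ?thesis
      using finite_string_indices by (auto simp: lin_0[OF lin_E_pow])
  next
    case 2
    then show ?thesis
      using E_pow_lowest_eq_0[OF v, of j] by (simp add: lin_0[OF lin_F] del: funpow.simps)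
  next
    case 3
    then show ?thesis
      using E_pow_lowest_eq_0[OF v, of j] E_pow_lowest_eq_0[OF v, of "j - 1"]
      by (simp add: lin_0[OF lin_F])
  qed
qed

text \<open>\<open>Y\<close> maps each \<open>lowest m\<close> into itself, as it preserves weights
  and semicommutes with \<open>E\<close>. The string formulas at \<open>v\<close> and
  \<open>Y v\<close> then differ by one factor \<open>\<mu>\<close>, for the one power of
  \<open>E\<close> that \<open>F\<close> removes.\<close>

lemma semicommute_F:
  assumes Y: "lin scale Y" and "\<mu> \<noteq> 0" and YE: "\<And>v. Y (E v) = scale \<mu> (E (Y v))"
    and V: "\<And>v a. v \<in> V a \<Longrightarrow> Y v \<in> V a"
  shows "F (Y v) = scale \<mu> (Y (F v))"
proof -
  note pow = semicommute_pow[OF Y YE]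
  have "(\<lambda>v. F (Y v)) = (\<lambda>v. scale \<mu> (Y (F v)))"
  proof (rule lin_eq_on_span[OF _ _ _ span_E_pow_lowest,
        OF lin_compose[OF lin_F Y] lin_scaled[OF lin_compose[OF Y lin_F]]])
    fix x assume "x \<in> {(E ^^ j) v | j v m. v \<in> lowest m}"
    then obtain j v m where x: "x = (E ^^ j) v" and v: "v \<in> lowest m" by blast
    have "scale (\<mu> ^ Suc m) ((E ^^ Suc m) (Y v)) = 0"
      using v lin_0[OF Y] unfolding pow[symmetric] by (simp add: lowest_def del: funpow.simps)
    then have "Y v \<in> lowest m"
      using v V \<open>\<mu> \<noteq> 0\<close> by (simp add: lowest_def del: funpow.simps)
    moreover have "F v = 0"
      using F_E_pow_lowest[OF v, of 0] by simp
    moreover have "F (Y v) = 0"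
      using F_E_pow_lowest[OF \<open>Y v \<in> lowest m\<close>, of 0] by simp
    ultimately show "F (Y x) = scale \<mu> (Y (F x))"
      unfolding x pow lin_scale[OF lin_F] F_E_pow_lowest[OF v] lin_scale[OF Y]
      by (cases j) (simp_all add: F_E_pow_lowest pow mult_ac del: funpow.simps)
  qed
  then show ?thesis by meson
qed

lemma F_E_relation:
  assumes L: "lin scale L" "\<And>v. L (K v) = v"
  shows "E (F v) - F (E v) = scale (inverse (p - inverse p)) (K v - L v)"
proof -
  have "(\<lambda>v. E (F v) - F (E v)) = (\<lambda>v. scale (inverse (p - inverse p)) (K v - L v))"
  proof (rule lin_eq_on_span[OF _ _ _ span_E_pow_lowest,
        OF lin_minus[OF lin_compose[OF lin_E lin_F] lin_compose[OF lin_F lin_E]]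
          lin_scaled[OF lin_minus[OF lin_K L(1)]]])
    fix x assume "x \<in> {(E ^^ j) v | j v m. v \<in> lowest m}"
    then obtain j v m where x: "x = (E ^^ j) v" and v: "v \<in> lowest m" by blast
    let ?k = "2 * int j - int m"
    have "x \<in> V ?k" unfolding x by (rule E_pow_lowest_V[OF v])
    then have K: "K x = scale (\<epsilon> * p powi ?k) x" by (simp add: weight_space_def)
    have "inverse \<epsilon> = \<epsilon>" "\<epsilon> \<noteq> 0" using sign by auto
    moreover have "scale (\<epsilon> * p powi ?k) (L x) = x"
      using L(2)[of x] unfolding K lin_scale[OF L(1)] .
    ultimately have Lx: "L x = scale (\<epsilon> * p powi (- ?k)) x"
      using p_nonzero by (metis (no_types, lifting) inverse_mult_distrib left_inverse
          mult_eq_0_iff power_int_eq_0_iff power_int_minus scale_one scale_scale)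
    have c: "qnum p (int j) * qnum p (int m - int j + 1)
        - qnum p (int (Suc j)) * qnum p (int m - int (Suc j) + 1) = qnum p ?k"
    proof -
      have "- (int m - int j + 1) = - int m + int j - 1" "- (int m - int j) = - int m + int j"
        by simp_all
      then have "qnum p (- int m + int j - 1) = - qnum p (int m - int j + 1)"
        "qnum p (- int m + int j) = - qnum p (int m - int j)"
        using qnum_minus by metis+
      then show ?thesis
        using qnum_recurrence[of "- int m" "int j"] by (simp add: algebra_simps)
    qed
    \<comment> \<open>For \<open>j = 0\<close> the two vectors may differ, but then the factor
      \<open>[j]\<close> is 0.\<close>
    have E_pred: "scale (qnum p (int j) * a) (E ((E ^^ (j - 1)) v)) = scale (qnum p (int j) * a) x" for a
      unfolding x by (cases j) simp_all
    have "E (F x) = scale (\<epsilon> * (qnum p (int j) * qnum p (int m - int j + 1))) x"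
      unfolding x F_E_pow_lowest[OF v] lin_scale[OF lin_E]
      using E_pred[of "\<epsilon> * qnum p (int m - int j + 1)"] by (simp add: x mult_ac)
    moreover have "F (E x) = scale (\<epsilon> * (qnum p (int (Suc j)) * qnum p (int m - int (Suc j) + 1))) x"
      using F_E_pow_lowest[OF v, of "Suc j"] by (simp add: x)
    ultimately have "E (F x) - F (E x) = scale (\<epsilon> * qnum p ?k) x"
      unfolding c[symmetric] by (simp add: scale_left_diff_distrib right_diff_distrib)
    also have "\<dots> = scale (inverse (p - inverse p)) (K x - L x)"
      unfolding K Lx scale_left_diff_distrib[symmetric]
      by (simp add: qnum_def divide_inverse right_diff_distrib left_diff_distrib mult_ac)
    finally show "E (F x) - F (E x) = scale (inverse (p - inverse p)) (K x - L x)" .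
  qed
  then show ?thesis by meson
qed

lemma uq_sl2_module_F:
  assumes L: "lin scale L" "\<And>v. L (K v) = v" "\<And>v. K (L v) = v"
  shows "uq_sl2_module scale p \<epsilon> E F K L"
proof -
  have "F (K v) = scale (p powi 2) (K (F v))" for v
    by (rule semicommute_F) (use p_nonzero K_E in \<open>auto simp: lin_K weight_space_def lin_scale[OF lin_K]\<close>)
  then have KF: "K (F v) = scale (p powi (- 2)) (F (K v))" for v
    using p_nonzero by (simp add: power_int_minus)
  show ?thesis
    by unfold_locales
      (use sign K_E KF L F_E_relation span_weight_spaces weights_bounded in
        \<open>simp_all add: lin_add[OF lin_E] lin_add[OF lin_F] lin_add[OF lin_K] lin_add[OF L(1)]
          lin_scale[OF lin_E] lin_scale[OF lin_F] lin_scale[OF lin_K] lin_scale[OF L(1)]\<close>)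
qed

text \<open>Any lowering operator kills the lowest vectors, and its commutation with powers of
  \<open>E\<close> then determines it on the strings, which span.\<close>

lemma F_unique:
  assumes "uq_sl2_module scale p \<epsilon> E F' K L" shows "F' = F"
proof -
  interpret F': uq_sl2_module scale p \<epsilon> E F' K L by fact
  show ?thesis
  proof (rule lin_eq_on_span[OF F'.lin_F lin_F _ span_E_pow_lowest])
    fix x assume "x \<in> {(E ^^ j) v | j v m. v \<in> lowest m}"
    then obtain j v m where x: "x = (E ^^ j) v" and v: "v \<in> lowest m" by blast
    have v': "v \<in> V (- int m)" using v by (simp add: lowest_def)
    have "F' v = 0"
      using F'.F_eq_0_if_E_pow_eq_0[OF v'] v by (simp add: lowest_def)
    then show "F' x = F x"
    proof (cases j)
      case 0
      then show ?thesis using F_E_pow_lowest[OF v, of 0] \<open>F' v = 0\<close> by (simp add: x)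
    next
      case (Suc i)
      have "qnum p (- int m + int i) = - qnum p (int m - int (Suc i) + 1)"
        using qnum_minus[of "int m - int i"] by (simp add: algebra_simps)
      moreover have "int i + 1 = int (Suc i)" by simp
      ultimately show ?thesis
        using F'.F_E_pow[OF v', of i] F_E_pow_lowest[OF v, of j] \<open>F' v = 0\<close>
        by (simp only: x Suc lin_0[OF lin_E_pow] diff_Suc_1 mult_minus_right scale_minus_left
            diff_minus_eq_add add_0_left)
    qed
  qed
qed

end

section \<open>Families of Borel modules\<close>

locale borel_family = vector_space smul
  for smul :: "'a::field \<Rightarrow> 'v::ab_group_add \<Rightarrow> 'v" +
  fixes A :: "int ^ 'n::finite ^ 'n" and s :: "'n \<Rightarrow> nat" and q :: 'a and \<epsilon> :: "'n \<Rightarrow> 'a"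
    and E K L :: "'n \<Rightarrow> 'v \<Rightarrow> 'v"
  assumes cartan_diag: "A $ i $ i = 2"
    and cartan_offdiag: "i \<noteq> j \<Longrightarrow> A $ i $ j \<le> 0"
    and s_pos: "s i > 0"
    and symmetrizable: "int (s i) * A $ i $ j = int (s j) * A $ j $ i"
    and q_nonzero: "q \<noteq> 0"
    and q_generic: "\<And>k::nat. k > 0 \<Longrightarrow> q ^ k \<noteq> 1"
    and sign: "\<epsilon> i \<in> {1, -1}"
    and finite_dimensional: "\<exists>B. finite B \<and> span B = UNIV"
    and lin_E: "lin smul (E i)" and lin_K: "lin smul (K i)" and lin_L: "lin smul (L i)"
    and K_L: "K i (L i v) = v" and L_K: "L i (K i v) = v"
    and K_K: "K i (K j v) = K j (K i v)"
    and K_E: "K i (E j v) = smul ((q ^ s i) powi (A $ i $ j)) (E j (K i v))"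
    and semisimple: "span {v. \<exists>\<theta>. K i v = smul \<theta> v} = UNIV"
    and eigenvalue: "v \<noteq> 0 \<Longrightarrow> K i v = smul \<theta> v \<Longrightarrow> \<exists>m::int. \<theta> = \<epsilon> i * (q ^ s i) powi m"
begin

abbreviation V :: "'n \<Rightarrow> int \<Rightarrow> 'v set" where
  "V i \<equiv> weight_space smul (K i) (\<epsilon> i) (q ^ s i)"

lemma generic_q: "generic_parameter (q ^ s i)"
proof
  show "q ^ s i \<noteq> 0" using q_nonzero by simp
  fix k :: nat assume "k > 0"
  then show "(q ^ s i) ^ k \<noteq> 1"
    using q_generic[of "s i * k"] s_pos[of i] by (simp add: power_mult)
qed

sublocale q: generic_parameter "q ^ s i" for i
  by (rule generic_q)

lemma sign_nonzero: "\<epsilon> i \<noteq> 0"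
  using sign[of i] by auto

lemma L_E: "L i (E j v) = smul ((q ^ s i) powi (- (A $ i $ j))) (E j (L i v))"
proof -
  have "E j v = smul ((q ^ s i) powi (- (A $ i $ j))) (K i (E j (L i v)))"
    by (simp add: K_E K_L q.powi_add[symmetric])
  then show ?thesis by (metis L_K lin_scale[OF lin_L])
qed

lemma L_K': "L i (K j v) = K j (L i v)"
  by (metis K_K K_L L_K)

lemma K_V: "v \<in> V j a \<Longrightarrow> K i v \<in> V j a"
  by (simp add: weight_space_def K_K[of j i] lin_scale[OF lin_K])

lemma L_V: "v \<in> V j a \<Longrightarrow> L i v \<in> V j a"
  by (simp add: weight_space_def L_K'[symmetric] lin_scale[OF lin_L])

text \<open>Finite dimension enters here: \<open>K i\<close> has finitely many eigenvalues, and
  since \<open>q ^ s i\<close> is not a root of unity, distinct weights have distinct eigenvalues;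
  so the weights are bounded.\<close>

lemma borel_sl2: "borel_sl2_module smul (q ^ s i) (\<epsilon> i) (E i) (K i)"
proof (intro borel_sl2_module.intro borel_sl2_module_axioms.intro generic_vector_space.intro)
  show "vector_space smul" by (rule vector_space_axioms)
  show "generic_parameter (q ^ s i)" by (rule generic_q)
  let ?J = "joint_eigenspace smul (\<lambda>_::unit. K i)"
  have V_J: "V i k = ?J (\<lambda>_. \<epsilon> i * (q ^ s i) powi k)" for k
    by (simp add: weight_space_def joint_eigenspace_def)
  have sub: "{v. \<exists>\<theta>. K i v = smul \<theta> v} \<subseteq> span (\<Union>k. V i k)"
  proof clarify
    fix v \<theta> assume v: "K i v = smul \<theta> v"
    show "v \<in> span (\<Union>k. V i k)"
    proof (cases "v = 0")
      case False
      then obtain m where "\<theta> = \<epsilon> i * (q ^ s i) powi m" using eigenvalue v by blast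
      then show ?thesis using v by (intro span_base) (auto simp: weight_space_def)
    qed (simp add: span_zero)
  qed
  then show span: "span (\<Union>k. V i k) = UNIV"
    using span_minimal[OF sub] semisimple[of i] by auto
  have "span (\<Union>\<kappa>. ?J \<kappa>) = UNIV"
    using span span_mono[of "\<Union>k. V i k" "\<Union>\<kappa>. ?J \<kappa>"] unfolding V_J by blast
  then have fin: "finite {\<kappa>. \<exists>v \<in> ?J \<kappa>. v \<noteq> 0}"
    using finite_joint_eigenvalues[of "\<lambda>_::unit. K i"] lin_K finite_dimensional by blast
  have inj: "inj (\<lambda>k (_::unit). \<epsilon> i * (q ^ s i) powi k)"
    using sign_nonzero[of i] by (auto intro!: injI simp: fun_eq_iff q.powi_inject)
  have "finite ((\<lambda>k (_::unit). \<epsilon> i * (q ^ s i) powi k) -` {\<kappa>. \<exists>v \<in> ?J \<kappa>. v \<noteq> 0})"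
    by (rule finite_vimageI[OF fin inj])
  then have "finite {k. \<exists>v \<in> V i k. v \<noteq> 0}" (is "finite ?S")
    by (simp add: V_J vimage_def)
  then have "k \<le> Max (abs ` ?S)" if "k \<in> abs ` ?S" for k
    using that by (intro Max_ge) auto
  then show "\<exists>b. \<forall>k. \<forall>v \<in> V i k. v \<noteq> 0 \<longrightarrow> \<bar>k\<bar> \<le> b"
    by (intro exI[of _ "Max (abs ` ?S)"]) auto
qed (use sign lin_E lin_K K_E[of i i] in \<open>simp_all add: cartan_diag\<close>)

sublocale sl2: borel_sl2_module smul "q ^ s i" "\<epsilon> i" "E i" "K i" for i
  by (rule borel_sl2)

end

section \<open>All lowering operators of an irreducible Borel module and their relations\<close>

locale irreducible_borel_family = borel_family +
  assumes serre: "i \<noteq> j \<Longrightarrow> serre_op smul (q ^ s i) (E i) (E j) (nat (1 - A $ i $ j)) v = 0"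
    and nontrivial: "\<exists>u::'b. u \<noteq> 0"
    and irreducible: "\<And>W. subspace W \<Longrightarrow> (\<And>i w. w \<in> W \<Longrightarrow> E i w \<in> W) \<Longrightarrow>
      (\<And>i w. w \<in> W \<Longrightarrow> K i w \<in> W) \<Longrightarrow> (\<And>i w. w \<in> W \<Longrightarrow> L i w \<in> W) \<Longrightarrow> W = {0} \<or> W = UNIV"
    and symmetric: "V i k \<noteq> {0} \<Longrightarrow> V i (- k) \<noteq> {0}"
begin

lemma serre_Suc: "i \<noteq> j \<Longrightarrow> serre_op smul (q ^ s i) (E i) (E j) (Suc (nat (- (A $ i $ j)))) v = 0"
proof -
  assume ij: "i \<noteq> j"
  have "Suc (nat (- (A $ i $ j))) = nat (1 - A $ i $ j)"
    using cartan_offdiag[OF ij] by simp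
  then show ?thesis using serre[OF ij] by simp
qed

lemma K_E_off: "i \<noteq> j \<Longrightarrow> K i (E j v) = smul ((q ^ s i) powi (- int (nat (- (A $ i $ j))))) (E j (K i v))"
  using cartan_offdiag[of i j] by (simp add: K_E)

text \<open>Stability under \<open>E j\<close> for \<open>j \<noteq> i\<close> rests on the Serre
  relation; \<open>K j\<close> and \<open>L j\<close> merely semicommute with \<open>E i\<close> and
  preserve its weight spaces.\<close>

lemma centre_filtration_trivial: "sl2.centre_filtration i c = {0} \<or> sl2.centre_filtration i c = UNIV"
proof (rule irreducible)
  show "subspace (sl2.centre_filtration i c)" by (rule sl2.subspace_centre_filtration)
  fix j w assume w: "w \<in> sl2.centre_filtration i c"
  show "E j w \<in> sl2.centre_filtration i c"
  proof (cases "i = j")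
    case True
    then show ?thesis using sl2.E_centre_filtration w by simp
  next
    case False
    then show ?thesis
      using sl2.serre_centre_filtration[OF lin_E K_E_off serre_Suc w] by blast
  qed
  show "K j w \<in> sl2.centre_filtration i c"
    by (rule sl2.semicommute_centre_filtration[OF lin_K _ K_E K_V w]) (simp add: q_nonzero)
  show "L j w \<in> sl2.centre_filtration i c"
    by (rule sl2.semicommute_centre_filtration[OF lin_L _ L_E L_V w]) (simp add: q_nonzero)
qed

lemma centred_borel_sl2: "centred_borel_sl2_module smul (q ^ s i) (\<epsilon> i) (E i) (K i)"
proof -
  obtain u :: 'b where u: "u \<noteq> 0" using nontrivial by blast
  show ?thesis
    by unfold_locales
      (rule sl2.centred[OF centre_filtration_trivial u symmetric], assumption)+
qed

sublocale sl2: centred_borel_sl2_module smul "q ^ s i" "\<epsilon> i" "E i" "K i" for i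
  by (rule centred_borel_sl2)

abbreviation F :: "'c \<Rightarrow> 'b \<Rightarrow> 'b" where "F \<equiv> sl2.F"

lemma uq_sl2: "uq_sl2_module smul (q ^ s i) (\<epsilon> i) (E i) (F i) (K i) (L i)"
  by (rule sl2.uq_sl2_module_F) (simp_all add: lin_L L_K K_L)

sublocale usl2: uq_sl2_module smul "q ^ s i" "\<epsilon> i" "E i" "F i" "K i" "L i" for i
  by (rule uq_sl2)

lemma K_F: "K i (F j v) = smul ((q ^ s i) powi (- (A $ i $ j))) (F j (K i v))"
proof -
  have "F j (K i v) = smul ((q ^ s i) powi (A $ i $ j)) (K i (F j v))"
    by (rule sl2.semicommute_F[OF lin_K _ K_E K_V]) (simp add: q_nonzero)
  then show ?thesis by (simp add: q.powi_add[symmetric])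
qed

lemma L_F: "L i (F j v) = smul ((q ^ s i) powi (A $ i $ j)) (F j (L i v))"
proof -
  have "F j v = smul ((q ^ s i) powi (A $ i $ j)) (K i (F j (L i v)))"
    by (simp add: K_F K_L q.powi_add[symmetric])
  then show ?thesis by (metis L_K lin_scale[OF lin_L])
qed

text \<open>For the adjoint action with index \<open>j\<close>, the operator \<open>E i\<close> has
  weight \<open>A_ji\<close>, and the Serre relation makes it a lowest vector.\<close>

lemma F_E_commute: "i \<noteq> j \<Longrightarrow> F j (E i v) = E i (F j v)"
proof (rule usl2.F_commutes_if_serre)
  assume ij: "i \<noteq> j"
  then show "E i \<in> usl2.End_weight j (- int (nat (- (A $ j $ i))))"
    unfolding usl2.End_weight_def using K_E_off[of j i] by (simp add: lin_E)
  show "serre_op smul (q ^ s j) (E j) (E i) (Suc (nat (- (A $ j $ i)))) v = 0" for v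
    using serre_Suc[of j i] ij by simp
qed

text \<open>In the swapped module \<open>F i\<close> is the raising operator. With respect to it
  \<open>F j\<close> has weight \<open>A_ij\<close>, and it commutes with the new lowering operator
  \<open>E i\<close>.\<close>

lemma serre_F:
  assumes "i \<noteq> j"
  shows "serre_op smul (q ^ s i) (F i) (F j) (nat (1 - A $ i $ j)) v = 0"
proof -
  interpret swap: uq_sl2_module smul "q ^ s i" "\<epsilon> i" "F i" "E i" "L i" "K i"
    by (rule usl2.swapped)
  have n: "nat (1 - A $ i $ j) = Suc (nat (- (A $ i $ j)))"
    "- int (nat (- (A $ i $ j))) = A $ i $ j"
    using cartan_offdiag[OF assms] by simp_all
  show ?thesis
    unfolding n(1)
  proof (rule swap.serre_if_F_commutes)
    show "F j \<in> swap.End_weight (- int (nat (- (A $ i $ j))))"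
      unfolding swap.End_weight_def n(2) by (simp add: L_F usl2.lin_F)
    show "E i (F j v) = F j (E i v)" for v
      using F_E_commute[OF assms] by simp
  qed
qed

end

section \<open>Irreducibility over the Borel subalgebra\<close>

text \<open>In the application \<open>\<Omega>\<close> is the set of weights, \<open>r i\<close> a
  simple reflection, \<open>f\<close> the multiplicity in a Borel submodule and \<open>N\<close> the
  level. Taking multiplicity 1 shows \<open>N = 0\<close>. The sums of
  \<open>f \<mu> * \<mu> i\<close> are then nonnegative with a vanishing positive combination, so
  each is 0 and every inequality is an equality.\<close>

lemma reflection_sum_rigid:
  fixes \<Omega> :: "('n::finite \<Rightarrow> int) set" and f :: "('n \<Rightarrow> int) \<Rightarrow> nat" and c :: "'n \<Rightarrow> real"
    and r :: "'n \<Rightarrow> ('n \<Rightarrow> int) \<Rightarrow> 'n \<Rightarrow> int"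
  assumes fin: "finite \<Omega>" and c: "\<And>i. c i > 0"
    and r: "\<And>i \<mu>. \<mu> \<in> \<Omega> \<Longrightarrow> r i \<mu> \<in> \<Omega>" "\<And>i \<mu>. r i (r i \<mu>) = \<mu>" "\<And>i \<mu>. r i \<mu> i = - \<mu> i"
    and le: "\<And>i \<mu>. \<mu> \<in> \<Omega> \<Longrightarrow> \<mu> i \<le> 0 \<Longrightarrow> f \<mu> \<le> f (r i \<mu>)"
    and const: "\<And>\<mu>. \<mu> \<in> \<Omega> \<Longrightarrow> (\<Sum>i\<in>UNIV. c i * real_of_int (\<mu> i)) = N"
    and \<mu>: "\<mu> \<in> \<Omega>" "\<mu> i \<le> 0"
  shows "f (r i \<mu>) = f \<mu>"
proof -
  have refl: "(\<Sum>\<mu>\<in>\<Omega>. g (r i \<mu>)) = (\<Sum>\<mu>\<in>\<Omega>. g \<mu>)" for g :: "('n \<Rightarrow> int) \<Rightarrow> real" and i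
    by (rule sum.reindex_bij_witness[of _ "r i" "r i"]) (auto simp: r)
  \<comment> \<open>Adding the reflected sum turns a trace into a sum whose terms, for
    \<open>g = f\<close>, all have the same sign.\<close>
  have weighted: "2 * (\<Sum>\<mu>\<in>\<Omega>. real (g \<mu>) * real_of_int (\<mu> i))
      = (\<Sum>\<mu>\<in>\<Omega>. (real (g \<mu>) - real (g (r i \<mu>))) * real_of_int (\<mu> i))" for g :: "('n \<Rightarrow> int) \<Rightarrow> nat" and i
  proof -
    have "(\<Sum>\<mu>\<in>\<Omega>. real (g (r i \<mu>)) * real_of_int (r i \<mu> i)) = (\<Sum>\<mu>\<in>\<Omega>. real (g \<mu>) * real_of_int (\<mu> i))"
      by (rule refl)
    then have "(\<Sum>\<mu>\<in>\<Omega>. real (g (r i \<mu>)) * real_of_int (\<mu> i)) = - (\<Sum>\<mu>\<in>\<Omega>. real (g \<mu>) * real_of_int (\<mu> i))"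
      by (simp add: r sum_negf)
    then show ?thesis by (simp add: left_diff_distrib sum_subtractf)
  qed
  have total: "(\<Sum>i\<in>UNIV. c i * (\<Sum>\<mu>\<in>\<Omega>. real (g \<mu>) * real_of_int (\<mu> i))) = N * (\<Sum>\<mu>\<in>\<Omega>. real (g \<mu>))"
    for g :: "('n \<Rightarrow> int) \<Rightarrow> nat"
  proof -
    have "(\<Sum>i\<in>UNIV. c i * (\<Sum>\<mu>\<in>\<Omega>. real (g \<mu>) * real_of_int (\<mu> i)))
        = (\<Sum>\<mu>\<in>\<Omega>. real (g \<mu>) * (\<Sum>i\<in>UNIV. c i * real_of_int (\<mu> i)))"
      by (simp add: sum_distrib_left sum.swap[of _ UNIV] mult_ac)
    then show ?thesis using const by (simp add: sum_distrib_left mult.commute)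
  qed
  have "N * real (card \<Omega>) = 0"
    using total[of "\<lambda>_. 1"] weighted[of "\<lambda>_. 1"] by simp
  moreover have "card \<Omega> > 0" using fin \<mu>(1) by (auto simp: card_gt_0_iff)
  ultimately have "N = 0" by simp
  have term_nonneg: "(real (f \<mu>) - real (f (r i \<mu>))) * real_of_int (\<mu> i) \<ge> 0" if "\<mu> \<in> \<Omega>" for \<mu> i
  proof (cases "\<mu> i \<le> 0")
    case True
    then show ?thesis using le[OF that True] by (simp add: mult_nonpos_nonpos)
  next
    case False
    then have "f (r i \<mu>) \<le> f \<mu>"
      using le[of "r i \<mu>" i] that by (simp add: r)
    then show ?thesis using False by simp
  qed
  have nonneg: "(\<Sum>\<mu>\<in>\<Omega>. real (f \<mu>) * real_of_int (\<mu> i)) \<ge> 0" for i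
  proof -
    have "(\<Sum>\<mu>\<in>\<Omega>. (real (f \<mu>) - real (f (r i \<mu>))) * real_of_int (\<mu> i)) \<ge> 0"
      by (rule sum_nonneg) (rule term_nonneg)
    then show ?thesis using weighted[of f i] by simp
  qed
  have "(\<Sum>i\<in>UNIV. c i * (\<Sum>\<mu>\<in>\<Omega>. real (f \<mu>) * real_of_int (\<mu> i))) = 0"
    using total[of f] \<open>N = 0\<close> by simp
  then have "\<forall>i\<in>UNIV. c i * (\<Sum>\<mu>\<in>\<Omega>. real (f \<mu>) * real_of_int (\<mu> i)) = 0"
    by (subst (asm) sum_nonneg_eq_0_iff) (simp_all add: mult_nonneg_nonneg[OF less_imp_le[OF c] nonneg])
  then have "c i * (\<Sum>\<mu>\<in>\<Omega>. real (f \<mu>) * real_of_int (\<mu> i)) = 0" by blast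
  then have "(\<Sum>\<mu>\<in>\<Omega>. real (f \<mu>) * real_of_int (\<mu> i)) = 0"
    using c[of i] by (metis less_irrefl mult_eq_0_iff)
  then have "(\<Sum>\<mu>\<in>\<Omega>. (real (f \<mu>) - real (f (r i \<mu>))) * real_of_int (\<mu> i)) = 0"
    using weighted[of f i] by simp
  then have "(real (f \<mu>) - real (f (r i \<mu>))) * real_of_int (\<mu> i) = 0"
    using \<mu>(1) by (subst (asm) sum_nonneg_eq_0_iff) (use fin term_nonneg in auto)
  \<comment> \<open>At \<open>\<mu> i = 0\<close> the vanishing term says nothing; there the
    inequality holds in both directions.\<close>
  moreover have "f (r i \<mu>) \<le> f \<mu>" if "\<mu> i = 0"
    using le[of "r i \<mu>" i] \<mu>(1) that by (simp add: r)
  ultimately show ?thesis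
    using le[OF \<mu>] by (cases "\<mu> i = 0") auto
qed

section \<open>Joint weights, simple reflections and the level of a module over the full
  algebra\<close>

locale uq_family = borel_family +
  fixes F :: "'c \<Rightarrow> 'b \<Rightarrow> 'b" and u :: "'c \<Rightarrow> real"
  assumes lin_F: "lin smul (F i)"
    and K_F: "K i (F j v) = smul ((q ^ s i) powi (- (A $ i $ j))) (F j (K i v))"
    and E_F: "E i (F i v) - F i (E i v)
      = smul (inverse (q ^ s i - inverse (q ^ s i))) (K i v - L i v)"
    and u_pos: "u i > 0"
    and u_null: "(\<Sum>j\<in>UNIV. real_of_int (A $ i $ j) * u j) = 0"
    and uq_irreducible: "\<And>W. subspace W \<Longrightarrow> (\<And>i w. w \<in> W \<Longrightarrow> E i w \<in> W) \<Longrightarrow>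
      (\<And>i w. w \<in> W \<Longrightarrow> F i w \<in> W) \<Longrightarrow>
      (\<And>i w. w \<in> W \<Longrightarrow> K i w \<in> W) \<Longrightarrow> (\<And>i w. w \<in> W \<Longrightarrow> L i w \<in> W) \<Longrightarrow> W = {0} \<or> W = UNIV"
begin

lemma uq_sl2: "uq_sl2_module smul (q ^ s i) (\<epsilon> i) (E i) (F i) (K i) (L i)"
proof (intro uq_sl2_module.intro uq_sl2_module_axioms.intro)
  show "K i (F i v) = smul ((q ^ s i) powi (- 2)) (F i (K i v))" for v
    using K_F[of i i v] by (simp add: cartan_diag)
qed (rule vector_space_axioms generic_q sign lin_E lin_F lin_K lin_L K_L L_K E_F sl2.K_E
    sl2.span_weight_spaces sl2.weights_bounded)+

sublocale usl2: uq_sl2_module smul "q ^ s i" "\<epsilon> i" "E i" "F i" "K i" "L i" for i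
  by (rule uq_sl2)

text \<open>The power of \<open>E i\<close> or \<open>F i\<close> that leads from weight
  \<open>k\<close> to weight \<open>-k\<close> is injective.\<close>

lemma V_symmetric: "V i k \<noteq> {0} \<Longrightarrow> V i (- k) \<noteq> {0}"
proof -
  interpret swap: uq_sl2_module smul "q ^ s i" "\<epsilon> i" "F i" "E i" "L i" "K i"
    by (rule usl2.swapped)
  assume "V i k \<noteq> {0}"
  then obtain v where v: "v \<in> V i k" "v \<noteq> 0"
    using subspace_0[OF sl2.subspace_V] by blast
  show "V i (- k) \<noteq> {0}"
  proof (cases "k \<le> 0")
    case True
    then have "(E i ^^ nat (- k)) v \<noteq> 0"
      using usl2.E_pow_injective[of v i "nat (- k)"] v by auto
    moreover have "(E i ^^ nat (- k)) v \<in> V i (- k)"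
      using sl2.E_pow_V[OF v(1), of "nat (- k)"] True by simp
    ultimately show ?thesis by blast
  next
    case False
    have "v \<in> weight_space smul (L i) (\<epsilon> i) (q ^ s i) (- int (nat k))"
      using usl2.L_weight[OF v(1)] False by (simp add: weight_space_def)
    then have "smul (\<epsilon> i ^ nat k) ((F i ^^ nat k) v) \<noteq> 0"
      using swap.E_pow_injective[of v "nat k"] v sign_nonzero[of i] by auto
    moreover have "smul (\<epsilon> i ^ nat k) ((F i ^^ nat k) v) \<in> V i (- k)"
      using usl2.wt.f_pow_M[OF v(1), of "nat k"] False by (simp add: usl2.F_pow_scale)
    ultimately show ?thesis by blast
  qed
qed

definition character :: "('c \<Rightarrow> int) \<Rightarrow> 'c \<Rightarrow> 'a" where
  "character \<mu> i = \<epsilon> i * (q ^ s i) powi \<mu> i"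

definition JV :: "('c \<Rightarrow> int) \<Rightarrow> 'b set" where
  "JV \<mu> = joint_eigenspace smul K (character \<mu>)"

lemma JV_iff: "v \<in> JV \<mu> \<longleftrightarrow> (\<forall>i. v \<in> V i (\<mu> i))"
  by (simp add: JV_def joint_eigenspace_def character_def weight_space_def)

lemma subspace_JV: "subspace (JV \<mu>)"
  unfolding JV_def using lin_K by (rule subspace_joint_eigenspace)

lemma character_inject: "character \<mu> = character \<nu> \<longleftrightarrow> \<mu> = \<nu>"
  using sign_nonzero by (auto simp: character_def fun_eq_iff q.powi_inject)

text \<open>Translation of a weight by \<open>m\<close> times the simple root of index
  \<open>j\<close>. With \<open>m = - \<mu> j\<close> it is the simple reflection.\<close>

definition shift :: "'c \<Rightarrow> int \<Rightarrow> ('c \<Rightarrow> int) \<Rightarrow> 'c \<Rightarrow> int" where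
  "shift j m \<mu> = (\<lambda>i. \<mu> i + m * A $ i $ j)"

lemma shift_shift: "shift j m (shift j m' \<mu>) = shift j (m' + m) \<mu>"
  by (simp add: shift_def fun_eq_iff algebra_simps)

lemma shift_0: "shift j 0 \<mu> = \<mu>"
  by (simp add: shift_def)

lemma E_JV: "v \<in> JV \<mu> \<Longrightarrow> E j v \<in> JV (shift j 1 \<mu>)"
  by (simp add: JV_iff weight_space_def K_E lin_scale[OF lin_E] shift_def q.powi_add mult_ac)

lemma F_JV: "v \<in> JV \<mu> \<Longrightarrow> F j v \<in> JV (shift j (- 1) \<mu>)"
  using q.powi_add[of _ _ "- (A $ _ $ j)"]
  by (simp add: JV_iff weight_space_def K_F lin_scale[OF lin_F] shift_def mult_ac)

lemma E_pow_JV: "v \<in> JV \<mu> \<Longrightarrow> (E j ^^ m) v \<in> JV (shift j (int m) \<mu>)"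
proof (induction m)
  case (Suc m)
  then show ?case using E_JV[OF Suc.IH[OF Suc.prems], of j] by (simp add: shift_shift add.commute)
qed (simp add: shift_0)

lemma F_pow_JV: "v \<in> JV \<mu> \<Longrightarrow> (F j ^^ m) v \<in> JV (shift j (- int m) \<mu>)"
proof (induction m)
  case (Suc m)
  then show ?case using F_JV[OF Suc.IH[OF Suc.prems], of j] by (simp add: shift_shift algebra_simps)
qed (simp add: shift_0)

definition weights :: "('c \<Rightarrow> int) set" where
  "weights = {\<mu>. \<exists>v \<in> JV \<mu>. v \<noteq> 0}"

lemma Union_joint_eigenspace: "(\<Union>\<kappa>. joint_eigenspace smul K \<kappa>) = (\<Union>\<mu>. JV \<mu>)"
proof (intro equalityI subsetI)
  fix v assume "v \<in> (\<Union>\<kappa>. joint_eigenspace smul K \<kappa>)"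
  then obtain \<kappa> where \<kappa>: "v \<in> joint_eigenspace smul K \<kappa>" by blast
  show "v \<in> (\<Union>\<mu>. JV \<mu>)"
  proof (cases "v = 0")
    case True
    then show ?thesis using subspace_0[OF subspace_JV] by blast
  next
    case False
    have "\<forall>i. \<exists>m. \<kappa> i = \<epsilon> i * (q ^ s i) powi m"
      using eigenvalue[OF False] \<kappa> by (simp add: joint_eigenspace_def)
    then obtain \<mu> where "\<And>i. \<kappa> i = \<epsilon> i * (q ^ s i) powi \<mu> i" by metis
    then have "\<kappa> = character \<mu>" by (simp add: character_def fun_eq_iff)
    then show ?thesis using \<kappa> by (auto simp: JV_def)
  qed
qed (auto simp: JV_def)

lemma span_joint_eigenspaces: "span (\<Union>\<kappa>. joint_eigenspace smul K \<kappa>) = UNIV"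
  by (rule commuting_semisimple_span_joint_eigenvectors[OF lin_K K_K semisimple])

lemma finite_weights: "finite weights"
proof -
  obtain B where "finite B" "span B = UNIV" using finite_dimensional by blast
  then have "finite {\<kappa>. \<exists>v \<in> joint_eigenspace smul K \<kappa>. v \<noteq> 0}"
    using finite_joint_eigenvalues[of K] lin_K span_joint_eigenspaces by blast
  from finite_vimageI[OF this, of character] show ?thesis
    by (simp add: weights_def JV_def vimage_def inj_def character_inject)
qed

text \<open>Since \<open>s\<close> symmetrizes \<open>A\<close> and \<open>u\<close> is a right null
  vector, the numbers \<open>u i * s i\<close> form a left null vector. Up to scaling this is the
  level of a weight, which translation by roots does not change.\<close>

definition height :: "('c \<Rightarrow> int) \<Rightarrow> real" where
  "height \<mu> = (\<Sum>i\<in>UNIV. (u i * real (s i)) * real_of_int (\<mu> i))"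

lemma height_shift: "height (shift j m \<mu>) = height \<mu>"
proof -
  have "(\<Sum>i\<in>UNIV. (u i * real (s i)) * real_of_int (A $ i $ j))
      = (\<Sum>i\<in>UNIV. real (s j) * (real_of_int (A $ j $ i) * u i))"
  proof (rule sum.cong[OF refl])
    fix i
    have "real_of_int (int (s i) * A $ i $ j) = real_of_int (int (s j) * A $ j $ i)"
      by (simp only: symmetrizable)
    then have "real (s i) * real_of_int (A $ i $ j) = real (s j) * real_of_int (A $ j $ i)"
      by simp
    then show "(u i * real (s i)) * real_of_int (A $ i $ j) = real (s j) * (real_of_int (A $ j $ i) * u i)"
      by (simp add: mult_ac)
  qed
  also have "\<dots> = 0" by (simp add: sum_distrib_left[symmetric] u_null)
  finally have "(\<Sum>i\<in>UNIV. (u i * real (s i)) * real_of_int (A $ i $ j)) = 0" .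
  then have "(\<Sum>i\<in>UNIV. (u i * real (s i)) * (real_of_int m * real_of_int (A $ i $ j))) = 0"
    by (simp add: mult.left_commute[of _ "real_of_int m"] sum_distrib_left[symmetric])
  then show ?thesis
    by (simp add: height_def shift_def distrib_left sum.distrib)
qed

lemma weights_shift: "\<mu> \<in> weights \<Longrightarrow> shift i (- \<mu> i) \<mu> \<in> weights"
proof -
  interpret swap: uq_sl2_module smul "q ^ s i" "\<epsilon> i" "F i" "E i" "L i" "K i"
    by (rule usl2.swapped)
  assume "\<mu> \<in> weights"
  then obtain v where v: "v \<in> JV \<mu>" "v \<noteq> 0" by (auto simp: weights_def)
  have vi: "v \<in> V i (\<mu> i)" using v(1) by (simp add: JV_iff)
  show ?thesis
  proof (cases "\<mu> i \<le> 0")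
    case True
    then have "(E i ^^ nat (- \<mu> i)) v \<noteq> 0"
      using usl2.E_pow_injective[of v i "nat (- \<mu> i)"] v vi by auto
    then show ?thesis
      using E_pow_JV[OF v(1), of "nat (- \<mu> i)" i] True by (auto simp: weights_def)
  next
    case False
    have "v \<in> weight_space smul (L i) (\<epsilon> i) (q ^ s i) (- int (nat (\<mu> i)))"
      using usl2.L_weight[OF vi] False by (simp add: weight_space_def)
    then have "(F i ^^ nat (\<mu> i)) v \<noteq> 0"
      using swap.E_pow_injective[of v "nat (\<mu> i)"] v by auto
    then show ?thesis
      using F_pow_JV[OF v(1), of "nat (\<mu> i)" i] False by (auto simp: weights_def)
  qed
qed

text \<open>
  This is Schur's lemma for the central element \<open>\<Prod>K\<^sub>i\<^bsup>u i\<^esup>\<close>, stated with weights because the null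
  vector \<open>u\<close> is only real.
\<close>

lemma height_constant: "\<mu> \<in> weights \<Longrightarrow> \<nu> \<in> weights \<Longrightarrow> height \<mu> = height \<nu>"
proof -
  assume \<mu>: "\<mu> \<in> weights" and \<nu>: "\<nu> \<in> weights"
  \<comment> \<open>The weight spaces of the same level as \<open>\<mu>\<close>: their span is
    nonzero and stable under all generators, so it is everything.\<close>
  define G where "G = (\<Union>\<xi> \<in> {\<xi>. height \<xi> = height \<mu>}. JV \<xi>)"
  have inv: "T w \<in> span G" if T: "lin smul T" "\<And>\<xi> g. g \<in> JV \<xi> \<Longrightarrow> \<exists>m j. T g \<in> JV (shift j m \<xi>)"
    and w: "w \<in> span G" for T w
  proof (rule lin_span_image_subset[OF T(1) _ subspace_span w])
    fix g assume "g \<in> G"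
    then obtain \<xi> where \<xi>: "height \<xi> = height \<mu>" "g \<in> JV \<xi>" by (auto simp: G_def)
    obtain m j where "T g \<in> JV (shift j m \<xi>)" using T(2)[OF \<xi>(2)] by blast
    then show "T g \<in> span G"
      using \<xi>(1)
      by (intro span_base) (auto simp: G_def height_shift intro!: exI[of _ "shift j m \<xi>"])
  qed
  have KL: "T g \<in> JV (shift j 0 \<xi>)" if "g \<in> JV \<xi>" "T = K i \<or> T = L i" for T g \<xi> i j
    using that K_V L_V by (auto simp: JV_iff shift_0)
  have "span G = {0} \<or> span G = UNIV"
  proof (rule uq_irreducible)
    fix i w assume w: "w \<in> span G"
    show "E i w \<in> span G" by (rule inv[OF lin_E _ w]) (use E_JV in blast)
    show "F i w \<in> span G" by (rule inv[OF lin_F _ w]) (use F_JV in blast)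
    show "K i w \<in> span G" by (rule inv[OF lin_K _ w]) (use KL in blast)
    show "L i w \<in> span G" by (rule inv[OF lin_L _ w]) (use KL in blast)
  qed simp
  moreover obtain v where "v \<in> JV \<mu>" "v \<noteq> 0" using \<mu> by (auto simp: weights_def)
  then have "span G \<noteq> {0}" using span_base[of v G] by (auto simp: G_def)
  ultimately have span_G: "span G = UNIV" by blast
  obtain x where x: "x \<in> JV \<nu>" "x \<noteq> 0" using \<nu> by (auto simp: weights_def)
  have "x \<in> span (G \<inter> joint_eigenspace smul K (character \<nu>))"
    by (rule span_joint_eigenvectors_Int[OF lin_K])
      (use x(1) span_G in \<open>auto simp: G_def JV_def\<close>)
  moreover have "G \<inter> JV \<nu> \<subseteq> {0}" if "height \<mu> \<noteq> height \<nu>"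
  proof
    fix g assume g: "g \<in> G \<inter> JV \<nu>"
    then obtain \<xi> where \<xi>: "height \<xi> = height \<mu>" "g \<in> JV \<xi>" by (auto simp: G_def)
    then have "\<xi> \<noteq> \<nu>" using that by auto
    then show "g \<in> {0}"
      using joint_eigenspace_Int[of g K "character \<xi>" "character \<nu>"] g \<xi>(2)
      by (auto simp: JV_def character_inject)
  qed
  ultimately show ?thesis
    using x(2) span_minimal[of "G \<inter> JV \<nu>" "{0}"] by (auto simp: JV_def subspace_def)
qed

text \<open>Injectivity of \<open>E^m\<close> shows that the multiplicity in \<open>W\<close> does
  not drop from a weight with \<open>\<mu> i = -m\<close> to its reflection. Rigidity makes the
  multiplicities equal, and an injective image of full dimension is the whole space.\<close>

lemma E_pow_image_eq:
  assumes W: "subspace W" and W_E: "\<And>i w. w \<in> W \<Longrightarrow> E i w \<in> W" and \<mu>: "\<mu> i = - int m"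
  shows "(E i ^^ m) ` (W \<inter> JV \<mu>) = W \<inter> JV (shift i (int m) \<mu>)"
proof -
  \<comment> \<open>A basis extracted from the finite spanning set gives access to dimension
    theory.\<close>
  obtain B0 where B0: "finite B0" "span B0 = UNIV" using finite_dimensional by blast
  obtain B where B: "B \<subseteq> B0" "independent B" "B0 \<subseteq> span B"
    using maximal_independent_subset[of B0] by blast
  have "span B = UNIV" using span_minimal[OF B(3)] B0(2) by auto
  interpret fd: finite_dimensional_vector_space smul B
    by unfold_locales (use B B0 finite_subset \<open>span B = UNIV\<close> in auto)
  interpret pair: finite_dimensional_vector_space_pair_1 smul B smul
    by unfold_locales
  define r where "r i \<mu> = shift i (- \<mu> i) \<mu>" for i \<mu>
  define f where "f \<mu> = dim (W \<inter> JV \<mu>)" for \<mu>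
  have sub: "subspace (W \<inter> JV \<mu>)" for \<mu>
    using W subspace_JV by (rule subspace_inter)
  have W_pow: "(E i ^^ m) w \<in> W" if "w \<in> W" for w i m
    by (induction m) (use that W_E in auto)
  have image: "(E i ^^ m) ` (W \<inter> JV \<mu>) \<subseteq> W \<inter> JV (shift i (int m) \<mu>)" for i \<mu> m
    using W_pow E_pow_JV by blast
  have dim: "dim ((E i ^^ m) ` (W \<inter> JV \<mu>)) = f \<mu>" if "\<mu> i = - int m" for i \<mu> m
    unfolding f_def
  proof (rule pair.dim_image_eq[OF sl2.lin_E_pow])
    have span_eq: "span (W \<inter> JV \<mu>) = W \<inter> JV \<mu>" using sub span_eq_iff by blast
    show "inj_on (E i ^^ m) (span (W \<inter> JV \<mu>))"
    proof (rule inj_onI)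
      fix x y assume xy: "x \<in> span (W \<inter> JV \<mu>)" "y \<in> span (W \<inter> JV \<mu>)" "(E i ^^ m) x = (E i ^^ m) y"
      then have "x - y \<in> JV \<mu>"
        unfolding span_eq using subspace_diff[OF subspace_JV] by blast
      then have "x - y \<in> V i (- int m)" using that by (metis JV_iff)
      moreover have "(E i ^^ m) (x - y) = 0"
        using xy(3) by (simp add: lin_diff[OF sl2.lin_E_pow])
      ultimately have "x - y = 0" by (rule usl2.E_pow_injective)
      then show "x = y" by simp
    qed
  qed
  have r_eq: "r i \<mu> = shift i (int m) \<mu>" if "\<mu> i = - int m" for i \<mu> m
    using that by (simp add: r_def)
  have "f (r i \<mu>) = f \<mu>"
  proof (cases "\<mu> \<in> weights")
    case True
    show ?thesis
    proof (rule reflection_sum_rigid[OF finite_weights])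
      show "u i * real (s i) > 0" for i using u_pos s_pos by simp
      show "r i \<mu> \<in> weights" if "\<mu> \<in> weights" for i \<mu>
        using weights_shift that by (simp add: r_def)
      show "r i (r i \<mu>) = \<mu>" "r i \<mu> i = - \<mu> i" for i \<mu>
        by (simp_all add: r_def shift_def cartan_diag)
      show "f \<mu> \<le> f (r i \<mu>)" if "\<mu> \<in> weights" "\<mu> i \<le> 0" for i \<mu>
      proof -
        have m: "\<mu> i = - int (nat (- \<mu> i))" using that(2) by simp
        show ?thesis
          unfolding r_eq[of \<mu> i, OF m] dim[of \<mu> i, OF m, symmetric]
          unfolding f_def using image by (rule fd.dim_subset)
      qed
      show "(\<Sum>i\<in>UNIV. u i * real (s i) * real_of_int (\<nu> i)) = height \<mu>" if "\<nu> \<in> weights" for \<nu>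
        using height_constant[OF that True] by (simp add: height_def)
    qed (use True \<mu> in auto)
  next
    case False
    \<comment> \<open>Reflections preserve the set of weights, so both intersections are
      zero.\<close>
    have "r i \<mu> \<notin> weights"
    proof
      assume "r i \<mu> \<in> weights"
      then have "r i (r i \<mu>) \<in> weights" using weights_shift by (simp add: r_def)
      then show False using False by (simp add: r_def shift_def cartan_diag)
    qed
    then have "W \<inter> JV \<mu> \<subseteq> {0}" "W \<inter> JV (r i \<mu>) \<subseteq> {0}"
      using False by (auto simp: weights_def)
    then show ?thesis
      unfolding f_def by (metis fd.dim_eq_0)
  qed
  then show ?thesis
    using fd.subspace_dim_equal[OF _ sub image[where i = i and m = m and \<mu> = \<mu>]]
      dim[of \<mu> i m, OF \<mu>] r_eq[of \<mu> i m, OF \<mu>] lin_subspace_image[OF sl2.lin_E_pow sub]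
    by (simp add: f_def)
qed


lemma E_pow_surj:
  assumes W: "subspace W" "\<And>i w. w \<in> W \<Longrightarrow> E i w \<in> W"
    and w: "w \<in> W" "w \<in> JV (shift i (int m) \<mu>)" and "\<mu> i = - int m"
  shows "\<exists>v \<in> W. v \<in> JV \<mu> \<and> (E i ^^ m) v = w"
proof -
  have "(E i ^^ m) ` (W \<inter> JV \<mu>) = W \<inter> JV (shift i (int m) \<mu>)"
    by (rule E_pow_image_eq) (use W assms(5) in auto)
  then have "w \<in> (E i ^^ m) ` (W \<inter> JV \<mu>)" using w by simp
  then show ?thesis by auto
qed

text \<open>For nonpositive \<open>i\<close>-weight, \<open>w\<close> is corrected by some
  \<open>E w'\<close>, with \<open>w'\<close> in \<open>W\<close> one step lower, to a vector killed
  by \<open>F\<close>, and induction handles \<open>w'\<close>. A vector of positive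
  \<open>i\<close>-weight is a power of \<open>E\<close> applied to a vector of \<open>W\<close> of
  opposite weight.\<close>

lemma F_preserves_weight_vectors:
  assumes W: "subspace W" and W_E: "\<And>i w. w \<in> W \<Longrightarrow> E i w \<in> W"
    and w: "w \<in> W" "w \<in> JV \<mu>"
  shows "F i w \<in> W"
proof -
  obtain b where b: "\<And>k v. v \<in> V i k \<Longrightarrow> v \<noteq> 0 \<Longrightarrow> \<bar>k\<bar> \<le> b"
    using sl2.weights_bounded[of i] by blast
  have W_pow: "(E i ^^ m) v \<in> W" if "v \<in> W" for v m
    by (induction m) (use that W_E in auto)
  have neg: "F i w \<in> W" if "w \<in> W" "w \<in> JV \<mu>" "\<mu> i \<le> 0" for w \<mu>
    using that
  \<comment> \<open>The \<open>i\<close>-weight drops by 2 in each step and cannot go below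
    \<open>-b\<close> while the vector is nonzero.\<close>
  proof (induction "nat (\<mu> i + b + 1)" arbitrary: w \<mu> rule: less_induct)
    case less
    define m where "m = nat (- \<mu> i)"
    have m: "\<mu> i = - int m" using less.prems(3) by (simp add: m_def)
    define \<nu> where "\<nu> = shift i (- 1) \<mu>"
    have \<nu>: "\<nu> i = - int (m + 2)" "shift i (int (m + 2)) \<nu> = shift i (int (Suc m)) \<mu>"
      by (simp_all add: \<nu>_def shift_shift) (simp add: shift_def cartan_diag m)
    have "(E i ^^ Suc m) w \<in> W" "(E i ^^ Suc m) w \<in> JV (shift i (int (m + 2)) \<nu>)"
      unfolding \<nu>(2) using W_pow less.prems(1) E_pow_JV[OF less.prems(2)] by blast+
    \<comment> \<open>The vector \<open>E^(m+1) w\<close> has \<open>i\<close>-weight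
      \<open>m + 2\<close>, and surjectivity pulls it back to weight \<open>-(m+2)\<close> without
      leaving \<open>W\<close>.\<close>
    then obtain w' where w': "w' \<in> W" "w' \<in> JV \<nu>" "(E i ^^ (m + 2)) w' = (E i ^^ Suc m) w"
      using E_pow_surj[where i = i and m = "m + 2" and \<mu> = \<nu>, OF W W_E _ _ \<nu>(1)] by blast
    have \<nu>_i: "\<nu> i = \<mu> i - 2" using \<nu>(1) m by simp
    have w'_V: "w' \<in> V i (\<mu> i - 2)" using w'(2) unfolding JV_iff \<nu>_i[symmetric] by blast
    have "E i w' \<in> V i (\<mu> i)" using sl2.E_V[OF w'_V] by simp
    moreover have "w \<in> V i (\<mu> i)" using less.prems(2) by (simp add: JV_iff)
    ultimately have "w - E i w' \<in> V i (- int m)"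
      using subspace_diff[OF sl2.subspace_V] m by simp
    moreover have "(E i ^^ Suc m) (w - E i w') = 0"
      using w'(3) by (simp add: lin_diff[OF sl2.lin_E_pow] lin_diff[OF lin_E] funpow_swap1)
    ultimately have "F i (w - E i w') = 0" by (rule usl2.F_eq_0_if_E_pow_eq_0)
    then have F_w: "F i w = E i (F i w') - smul (\<epsilon> i * qnum (q ^ s i) (\<mu> i - 2)) w'"
      using usl2.E_F_weight[OF w'_V] by (simp add: lin_diff[OF lin_F])
    have "F i w' \<in> W"
    proof (cases "w' = 0")
      case True
      then show ?thesis using lin_0[OF lin_F] subspace_0[OF W] by simp
    next
      case False
      then have "\<bar>\<mu> i - 2\<bar> \<le> b" using b w'_V by blast
      then have "nat (\<nu> i + b + 1) < nat (\<mu> i + b + 1)" using \<nu>(1) m by simp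
      moreover have "\<nu> i \<le> 0" using \<nu>(1) by simp
      ultimately show ?thesis using less.hyps w'(1,2) by blast
    qed
    then show ?case
      unfolding F_w using W W_E w'(1) by (intro subspace_diff subspace_scale) auto
  qed
  show ?thesis
  proof (cases "\<mu> i \<le> 0")
    case True
    then show ?thesis using neg w by blast
  next
    case False
    then obtain j where j: "\<mu> i = int (Suc j)"
      by (metis not_le zero_less_imp_eq_int gr0_implies_Suc)
    define \<nu> where "\<nu> = shift i (- int (Suc j)) \<mu>"
    have \<nu>: "\<nu> i = - int (Suc j)" "shift i (int (Suc j)) \<nu> = \<mu>"
      by (simp_all add: \<nu>_def shift_shift shift_0) (simp add: shift_def cartan_diag j)
    obtain v where v: "v \<in> W" "v \<in> JV \<nu>" "(E i ^^ Suc j) v = w"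
      using E_pow_surj[where i = i and m = "Suc j" and \<mu> = \<nu>, OF W W_E _ _ \<nu>(1)] w \<nu>(2)
      by metis
    have "v \<in> V i (\<nu> i)" using v(2) by (simp add: JV_iff)
    \<comment> \<open>\<open>F E^(j+1) v\<close> is a combination of \<open>E^(j+1) F v\<close> and
      \<open>E^j v\<close>, and \<open>v\<close> has negative \<open>i\<close>-weight, where the
      claim is already known.\<close>
    from usl2.F_E_pow[OF this, of j] show ?thesis
      unfolding v(3) using neg[OF v(1,2)] \<nu>(1) v(1) W W_pow
      by (simp add: subspace_diff subspace_scale del: funpow.simps)
  qed
qed

text \<open>Being stable under the \<open>K i\<close>, the subspace is spanned by joint weight
  vectors, and \<open>F i\<close> sends these into it.\<close>

lemma borel_irreducible:
  assumes W: "subspace W" and W_E: "\<And>i w. w \<in> W \<Longrightarrow> E i w \<in> W"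
    and W_K: "\<And>i w. w \<in> W \<Longrightarrow> K i w \<in> W" and W_L: "\<And>i w. w \<in> W \<Longrightarrow> L i w \<in> W"
  shows "W = {0} \<or> W = UNIV"
proof (rule uq_irreducible[OF W W_E _ W_K W_L])
  fix i w assume w: "w \<in> W"
  have "W \<subseteq> span (W \<inter> (\<Union>\<mu>. JV \<mu>))"
    using invariant_subspace_span_joint_eigenvectors[of K, OF lin_K span_joint_eigenspaces W W_K]
    unfolding Union_joint_eigenspace .
  then have "w \<in> span (W \<inter> (\<Union>\<mu>. JV \<mu>))" using w by blast
  moreover have "F i g \<in> W" if "g \<in> W \<inter> (\<Union>\<mu>. JV \<mu>)" for g
  proof -
    from that obtain \<mu> where "g \<in> W" "g \<in> JV \<mu>" by blast
    then show ?thesis using W W_E by (intro F_preserves_weight_vectors)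
  qed
  ultimately show "F i w \<in> W"
    using lin_span_image_subset[where f = "F i" and W = W, OF lin_F _ W] by blast
qed

end

section \<open>Modules over presented algebras\<close>

lemma ring_free_ring: "ring (free_ring :: ('g, 'a::field) free_algebra ring)"
proof (rule ringI)
  show "abelian_group (free_ring :: ('g, 'a) free_algebra ring)"
    by (rule abelian_groupI) (auto simp: free_ring_def add_ac intro: exI[of _ "- x" for x])
  show "monoid (free_ring :: ('g, 'a) free_algebra ring)"
    by (rule monoidI) (auto simp: free_ring_def mult.assoc)
qed (auto simp: free_ring_def algebra_simps)

definition quot :: "('g, 'a::field) free_algebra set \<Rightarrow> ('g, 'a) free_algebra \<Rightarrow> ('g, 'a) free_algebra set"
  where "quot rels x = (Idl\<^bsub>free_ring\<^esub> rels) +>\<^bsub>free_ring\<^esub> x"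

lemma ideal_genideal: "ideal (Idl\<^bsub>free_ring\<^esub> rels) (free_ring :: ('g, 'a::field) free_algebra ring)"
  by (rule ring.genideal_ideal[OF ring_free_ring]) (simp add: free_ring_def)

lemma presented_gen_eq_quot: "presented_gen rels g = quot rels (fvar g)"
  by (simp add: presented_gen_def quot_def)

lemma carrier_presented_algebra: "carrier (presented_algebra rels) = range (quot rels)"
  by (auto simp: presented_algebra_def Let_def FactRing_def A_RCOSETS_def' quot_def free_ring_def)

lemma quot_hom: "quot rels \<in> ring_hom free_ring (free_ring Quot Idl\<^bsub>free_ring\<^esub> rels)"
proof -
  have "quot rels = (+>\<^bsub>free_ring\<^esub>) (Idl\<^bsub>free_ring\<^esub> rels)"
    by (simp add: fun_eq_iff quot_def)
  then show ?thesis using ideal.rcos_ring_hom[OF ideal_genideal] by simp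
qed

lemma add_presented_algebra: "quot rels x \<oplus>\<^bsub>presented_algebra rels\<^esub> quot rels y = quot rels (x + y)"
  using ring_hom_add[OF quot_hom, of x y rels]
  by (simp add: presented_algebra_def Let_def free_ring_def)

lemma mult_presented_algebra: "quot rels x \<otimes>\<^bsub>presented_algebra rels\<^esub> quot rels y = quot rels (x * y)"
  using ring_hom_mult[OF quot_hom, of x y rels]
  by (simp add: presented_algebra_def Let_def free_ring_def)

lemma one_presented_algebra: "\<one>\<^bsub>presented_algebra rels\<^esub> = quot rels 1"
  using ring_hom_one[OF quot_hom, of rels]
  by (simp add: presented_algebra_def Let_def free_ring_def)

lemma zero_presented_algebra: "\<zero>\<^bsub>presented_algebra rels\<^esub> = quot rels 0"
  using ring_hom_zero[OF quot_hom ring_free_ring ideal.quotient_is_ring[OF ideal_genideal], of rels]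
  by (simp add: presented_algebra_def Let_def free_ring_def)

lemma smult_presented_algebra: "c \<odot>\<^bsub>presented_algebra rels\<^esub> quot rels x = quot rels (fconst c * x)"
  using mult_presented_algebra[of rels "fconst c" x]
  by (simp add: presented_algebra_def Let_def quot_def)

lemmas presented_algebra_simps = add_presented_algebra mult_presented_algebra one_presented_algebra
  zero_presented_algebra smult_presented_algebra

lemma ring_presented_algebra: "ring (presented_algebra rels)"
proof (rule ringI)
  show "abelian_group (presented_algebra rels)"
  proof (rule abelian_groupI)
    fix x assume "x \<in> carrier (presented_algebra rels)"
    then obtain a where "x = quot rels a" by (auto simp: carrier_presented_algebra)
    then show "\<exists>y\<in>carrier (presented_algebra rels). y \<oplus>\<^bsub>presented_algebra rels\<^esub> x = \<zero>\<^bsub>presented_algebra rels\<^esub>"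
      by (intro bexI[of _ "quot rels (- a)"]) (auto simp: carrier_presented_algebra presented_algebra_simps)
  qed (auto simp: carrier_presented_algebra presented_algebra_simps add_ac)
  show "monoid (presented_algebra rels)"
    by (rule monoidI) (auto simp: carrier_presented_algebra presented_algebra_simps mult.assoc)
qed (auto simp: carrier_presented_algebra presented_algebra_simps algebra_simps)

lemma a_inv_presented_algebra: "\<ominus>\<^bsub>presented_algebra rels\<^esub> quot rels x = quot rels (- x)"
proof -
  interpret ring "presented_algebra rels" by (rule ring_presented_algebra)
  show ?thesis
    by (rule minus_equality) (auto simp: carrier_presented_algebra presented_algebra_simps)
qed

lemma quot_eq_iff: "quot rels x = quot rels y \<longleftrightarrow> x - y \<in> Idl\<^bsub>free_ring\<^esub> rels"
proof -
  interpret ring free_ring by (rule ring_free_ring)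
  have "\<ominus>\<^bsub>free_ring\<^esub> y = - y"
    by (rule minus_equality) (auto simp: free_ring_def)
  then have "x \<ominus>\<^bsub>free_ring\<^esub> y = x - y"
    unfolding a_minus_def by (simp add: free_ring_def)
  then show ?thesis
    using quotient_eq_iff_same_a_r_cos[OF ideal_genideal, of x y rels]
    by (simp add: quot_def) (simp add: free_ring_def)
qed

lemma quot_relation: "x \<in> rels \<Longrightarrow> quot rels x = quot rels 0"
  using ring.genideal_self[OF ring_free_ring, of rels] by (auto simp: quot_eq_iff free_ring_def)

section \<open>Evaluation of free algebra elements at operators\<close>

definition evaluate ::
    "('a \<Rightarrow> 'v \<Rightarrow> 'v) \<Rightarrow> ('g \<Rightarrow> 'v \<Rightarrow> 'v) \<Rightarrow> ('g, 'a::field) free_algebra \<Rightarrow> 'v \<Rightarrow> 'v::ab_group_add" where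
  "evaluate s T x v = (\<Sum>w\<in>Poly_Mapping.keys x. s (Poly_Mapping.lookup x w) (foldr T (letters w) v))"

lemma free_algebra_sum_monomials:
  fixes x :: "('g, 'a::field) free_algebra"
  shows "x = (\<Sum>w\<in>Poly_Mapping.keys x. Poly_Mapping.single w (Poly_Mapping.lookup x w))"
  by (rule poly_mapping_eqI)
    (auto simp: lookup_sum lookup_single when_def in_keys_iff sum.delta)

context vector_space
begin

lemma evaluate_superset:
  "finite A \<Longrightarrow> Poly_Mapping.keys x \<subseteq> A
    \<Longrightarrow> evaluate scale T x v = (\<Sum>w\<in>A. scale (Poly_Mapping.lookup x w) (foldr T (letters w) v))"
  unfolding evaluate_def by (rule sum.mono_neutral_left) (auto simp: in_keys_iff)

lemma evaluate_add: "evaluate scale T (x + y) v = evaluate scale T x v + evaluate scale T y v"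
proof -
  let ?A = "Poly_Mapping.keys x \<union> Poly_Mapping.keys y"
  have "Poly_Mapping.keys (x + y) \<subseteq> ?A" by (rule keys_add)
  then show ?thesis
    using evaluate_superset[of ?A x T v] evaluate_superset[of ?A y T v]
      evaluate_superset[of ?A "x + y" T v]
    by (simp add: lookup_add scale_left_distrib sum.distrib)
qed

lemma evaluate_0: "evaluate scale T 0 v = 0"
  by (simp add: evaluate_def)

lemma evaluate_uminus: "evaluate scale T (- x) v = - evaluate scale T x v"
  using evaluate_add[of T "- x" x v] by (simp add: evaluate_0 eq_neg_iff_add_eq_0)

lemma evaluate_diff: "evaluate scale T (x - y) v = evaluate scale T x v - evaluate scale T y v"
  using evaluate_add[of T x "- y" v] by (simp add: evaluate_uminus)

lemma evaluate_sum: "evaluate scale T (sum f A) v = (\<Sum>a\<in>A. evaluate scale T (f a) v)"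
  by (induction A rule: infinite_finite_induct) (simp_all add: evaluate_0 evaluate_add)

lemma evaluate_single: "evaluate scale T (Poly_Mapping.single w c) v = scale c (foldr T (letters w) v)"
  by (cases "c = 0") (simp_all add: evaluate_def)

lemma lin_foldr: "(\<And>g. lin scale (T g)) \<Longrightarrow> lin scale (foldr T gs)"
  by (induction gs) (simp_all add: lin_ident id_def comp_def lin_compose)

lemma lin_evaluate: "(\<And>g. lin scale (T g)) \<Longrightarrow> lin scale (evaluate scale T x)"
  unfolding evaluate_def[abs_def] by (intro lin_sum_fun lin_scaled lin_foldr)

lemma evaluate_mult:
  assumes T: "\<And>g. lin scale (T g)"
  shows "evaluate scale T (x * y) v = evaluate scale T x (evaluate scale T y v)"
proof -
  let ?x = "\<lambda>w. Poly_Mapping.single w (Poly_Mapping.lookup x w)"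
  let ?y = "\<lambda>w. Poly_Mapping.single w (Poly_Mapping.lookup y w)"
  have fold: "lin scale (foldr T gs)" for gs using T by (rule lin_foldr)
  have "x * y = (\<Sum>w\<in>Poly_Mapping.keys x. ?x w) * (\<Sum>u\<in>Poly_Mapping.keys y. ?y u)"
    using free_algebra_sum_monomials[of x] free_algebra_sum_monomials[of y] by simp
  also have "\<dots> = (\<Sum>w\<in>Poly_Mapping.keys x. \<Sum>u\<in>Poly_Mapping.keys y. ?x w * ?y u)"
    by (rule sum_product)
  finally have "evaluate scale T (x * y) v
      = (\<Sum>w\<in>Poly_Mapping.keys x. \<Sum>u\<in>Poly_Mapping.keys y. evaluate scale T (?x w * ?y u) v)"
    by (simp only: evaluate_sum)
  also have "\<dots> = evaluate scale T x (evaluate scale T y v)"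
    unfolding evaluate_def[of scale T x] evaluate_def[of scale T y]
    by (simp add: mult_single evaluate_single plus_free_word_def lin_sum[OF fold] lin_scale[OF fold]
        scale_sum_right)
  finally show ?thesis .
qed

lemma evaluate_fvar: "evaluate scale T (fvar g) v = T g v"
  by (simp add: fvar_def evaluate_single)

lemma evaluate_fconst: "evaluate scale T (fconst c) v = scale c v"
  by (simp add: fconst_def evaluate_single zero_free_word_def)

lemma evaluate_1:
  fixes T :: "'g \<Rightarrow> 'b \<Rightarrow> 'b"
  shows "evaluate scale T 1 v = v"
proof -
  have "1 = (fconst 1 :: ('g, 'a) free_algebra)" by (simp add: fconst_def)
  then show ?thesis using evaluate_fconst[of T 1 v] by simp
qed

lemma evaluate_power:
  "(\<And>g. lin scale (T g)) \<Longrightarrow> evaluate scale T (x ^ n) v = (evaluate scale T x ^^ n) v"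
  by (induction n) (simp_all add: evaluate_1 evaluate_mult)

lemma evaluate_in_subspace:
  assumes "subspace W" "\<And>g w. w \<in> W \<Longrightarrow> T g w \<in> W" "w \<in> W"
  shows "evaluate scale T x w \<in> W"
proof -
  have "foldr T gs w \<in> W" for gs
    by (induction gs) (use assms in auto)
  then show ?thesis
    unfolding evaluate_def using assms(1) by (intro subspace_sum subspace_scale)
qed

end

locale presented_action = vector_space scale
  for scale :: "'a::field \<Rightarrow> 'b::ab_group_add \<Rightarrow> 'b" +
  fixes rels :: "('g, 'a) free_algebra set" and T :: "'g \<Rightarrow> 'b \<Rightarrow> 'b"
  assumes lin_T: "lin scale (T g)"
    and relations: "x \<in> rels \<Longrightarrow> evaluate scale T x v = 0"
begin

text \<open>The choice of a representative does not matter, because the whole ideal of relations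
  evaluates to 0.\<close>

definition action :: "('g, 'a) free_algebra set \<Rightarrow> 'b \<Rightarrow> 'b" where
  "action Q = evaluate scale T (SOME x. Q = quot rels x)"

text \<open>The elements that evaluate to the zero map form a two-sided ideal containing the
  relations.\<close>

lemma evaluate_genideal:
  assumes "x \<in> Idl\<^bsub>free_ring\<^esub> rels" shows "evaluate scale T x v = 0"
proof -
  let ?I = "{x. \<forall>v. evaluate scale T x v = 0}"
  interpret R: ring "free_ring :: ('g, 'a) free_algebra ring" by (rule ring_free_ring)
  have lin: "evaluate scale T x 0 = 0" for x
    using lin_0[OF lin_evaluate[OF lin_T]] .
  have inv: "\<ominus>\<^bsub>free_ring\<^esub> y = - y" for y :: "('g, 'a) free_algebra"
    by (rule R.minus_equality) (auto simp: free_ring_def)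
  have "ideal ?I free_ring"
  proof (rule idealI[OF ring_free_ring])
    show "subgroup ?I (add_monoid (free_ring :: ('g, 'a) free_algebra ring))"
    proof (rule R.add.subgroupI)
      fix a assume "a \<in> ?I"
      then show "\<ominus>\<^bsub>free_ring\<^esub> a \<in> ?I" unfolding inv by (simp add: evaluate_uminus)
    qed (auto simp: free_ring_def evaluate_add intro: exI[of _ 0] evaluate_0)
  qed (auto simp: free_ring_def evaluate_mult[OF lin_T] lin)
  then have "Idl\<^bsub>free_ring\<^esub> rels \<subseteq> ?I"
    by (rule R.genideal_minimal) (auto simp: relations)
  then show ?thesis using assms by auto
qed

lemma action_quot: "action (quot rels x) = evaluate scale T x"
proof
  fix v
  have "quot rels x = quot rels (SOME y. quot rels x = quot rels y)"
    by (rule someI[of _ x]) simp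
  from evaluate_genideal[OF quot_eq_iff[THEN iffD1, OF this]] show "action (quot rels x) v = evaluate scale T x v"
    by (simp add: action_def evaluate_diff)
qed

lemma alg_module_action: "alg_module scale (presented_algebra rels) action"
proof (intro alg_module.intro alg_module_axioms.intro)
  show "vector_space scale" by (rule vector_space_axioms)
next
  fix x assume "x \<in> carrier (presented_algebra rels)"
  then obtain a where x: "x = quot rels a" by (auto simp: carrier_presented_algebra)
  show "lin scale (action x)"
    unfolding x action_quot by (rule lin_evaluate[OF lin_T])
  show "action (c \<odot>\<^bsub>presented_algebra rels\<^esub> x) v = scale c (action x v)" for c v
    unfolding x smult_presented_algebra action_quot
    by (simp add: evaluate_mult[OF lin_T] evaluate_fconst)
  fix y assume "y \<in> carrier (presented_algebra rels)"
  then obtain b where y: "y = quot rels b" by (auto simp: carrier_presented_algebra)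
  show "action (x \<oplus>\<^bsub>presented_algebra rels\<^esub> y) v = action x v + action y v" for v
    unfolding x y add_presented_algebra action_quot by (rule evaluate_add)
  show "action (x \<otimes>\<^bsub>presented_algebra rels\<^esub> y) v = action x (action y v)" for v
    unfolding x y mult_presented_algebra action_quot by (rule evaluate_mult[OF lin_T])
next
  show "action \<one>\<^bsub>presented_algebra rels\<^esub> v = v" for v
    unfolding one_presented_algebra action_quot by (simp add: evaluate_1)
qed

end

text \<open>
  Only the generators in \<open>H\<close> need to lie in the subalgebra \<open>S\<close>; the values of \<open>T\<close> on the other
  generators are irrelevant.
\<close>

locale subalgebra_action = vector_space scale
  for scale :: "'a::field \<Rightarrow> 'b::ab_group_add \<Rightarrow> 'b" +
  fixes rels :: "('g, 'a) free_algebra set" and S :: "('g, 'a) free_algebra set set"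
    and H :: "'g set" and T :: "'g \<Rightarrow> 'b \<Rightarrow> 'b"
    and act :: "('g, 'a) free_algebra set \<Rightarrow> 'b \<Rightarrow> 'b"
  assumes module: "alg_module scale (presented_algebra rels\<lparr>carrier := S\<rparr>) act"
    and S_add: "quot rels x \<in> S \<Longrightarrow> quot rels y \<in> S \<Longrightarrow> quot rels (x + y) \<in> S"
    and S_mult: "quot rels x \<in> S \<Longrightarrow> quot rels y \<in> S \<Longrightarrow> quot rels (x * y) \<in> S"
    and S_const: "quot rels (fconst c) \<in> S"
    and S_gen: "g \<in> H \<Longrightarrow> quot rels (fvar g) \<in> S"
    and lin_T: "lin scale (T g)"
    and act_gen: "g \<in> H \<Longrightarrow> act (quot rels (fvar g)) = T g"
begin

interpretation M: alg_module scale "presented_algebra rels\<lparr>carrier := S\<rparr>" act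
  by (rule module)

text \<open>Membership in \<open>S\<close> is carried along with the action, since the module laws
  are available only for elements of the subalgebra.\<close>

definition evaluates :: "('g, 'a) free_algebra \<Rightarrow> bool" where
  "evaluates x \<longleftrightarrow> quot rels x \<in> S \<and> (\<forall>v. act (quot rels x) v = evaluate scale T x v)"

lemma evaluates_add: "evaluates x \<Longrightarrow> evaluates y \<Longrightarrow> evaluates (x + y)"
  using M.act_add[of "quot rels x" "quot rels y"]
  by (simp add: evaluates_def S_add add_presented_algebra evaluate_add)

lemma evaluates_mult: "evaluates x \<Longrightarrow> evaluates y \<Longrightarrow> evaluates (x * y)"
  using M.act_mult[of "quot rels x" "quot rels y"]
  by (simp add: evaluates_def S_mult mult_presented_algebra evaluate_mult[OF lin_T])

lemma quot_1_in_S: "quot rels 1 \<in> S"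
  using S_const[of 1] by (simp add: fconst_def)

lemma evaluates_fconst: "evaluates (fconst c)"
  using M.act_smult[of "quot rels 1" c] M.act_one quot_1_in_S
  by (simp add: evaluates_def S_const smult_presented_algebra one_presented_algebra evaluate_fconst)

lemma evaluates_fvar: "g \<in> H \<Longrightarrow> evaluates (fvar g)"
  by (simp add: evaluates_def S_gen act_gen evaluate_fvar)

lemma evaluates_1: "evaluates 1"
  using evaluates_fconst[of 1] by (simp add: fconst_def)

lemma evaluates_0: "evaluates 0"
  using evaluates_fconst[of 0] by (simp add: fconst_def)

lemma evaluates_uminus: "evaluates x \<Longrightarrow> evaluates (- x)"
proof -
  have "fconst (- 1) = (- 1 :: ('g, 'a) free_algebra)"
    by (simp add: fconst_def single_uminus)
  then show "evaluates x \<Longrightarrow> evaluates (- x)"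
    using evaluates_mult[OF evaluates_fconst[of "- 1"], of x] by simp
qed

lemma evaluates_diff: "evaluates x \<Longrightarrow> evaluates y \<Longrightarrow> evaluates (x - y)"
  using evaluates_add[OF _ evaluates_uminus, of x y] by simp

lemma evaluates_sum: "(\<And>a. a \<in> A \<Longrightarrow> evaluates (f a)) \<Longrightarrow> evaluates (sum f A)"
  by (induction A rule: infinite_finite_induct) (simp_all add: evaluates_0 evaluates_add)

lemma evaluates_power: "evaluates x \<Longrightarrow> evaluates (x ^ n)"
  by (induction n) (simp_all add: evaluates_1 evaluates_mult)

lemmas evaluates_intros = evaluates_add evaluates_mult evaluates_fconst evaluates_fvar evaluates_1
  evaluates_0 evaluates_diff evaluates_sum evaluates_power

text \<open>A relation has the same class as 0. This is how defining relations become identities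
  between the operators \<open>T g\<close>.\<close>

lemma relation_evaluates_to_0:
  assumes "x \<in> rels" "evaluates x" shows "evaluate scale T x v = 0"
  using assms(2) evaluates_0 quot_relation[OF assms(1)] by (simp add: evaluates_def evaluate_0)

lemma evaluates_all:
  assumes "H = UNIV" shows "evaluates x"
proof -
  have word: "evaluates (Poly_Mapping.single (Word gs) c)" for gs c
  proof (induction gs)
    case Nil
    then show ?case using evaluates_fconst[of c] by (simp add: fconst_def zero_free_word_def)
  next
    case (Cons g gs)
    have "Poly_Mapping.single (Word (g # gs)) c = fvar g * Poly_Mapping.single (Word gs) c"
      by (simp add: fvar_def mult_single plus_free_word_def)
    then show ?case using Cons evaluates_mult evaluates_fvar assms by simp
  qed
  have "evaluates (Poly_Mapping.single w c)" for w c
    using word[of "letters w" c] by simp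
  then show ?thesis
    by (subst free_algebra_sum_monomials) (rule evaluates_sum)
qed

text \<open>Stability of \<open>W\<close> is part of the induction because only the generators in
  \<open>H\<close> are known to preserve \<open>W\<close>, while the representative \<open>x\<close>
  arises along the way.\<close>

lemma generated_subalgebra_evaluates:
  assumes "h \<in> generated_subalgebra (presented_algebra rels) ((\<lambda>g. quot rels (fvar g)) ` H)"
    and W: "subspace W" "\<And>g w. g \<in> H \<Longrightarrow> w \<in> W \<Longrightarrow> T g w \<in> W"
  shows "\<exists>x. h = quot rels x \<and> evaluates x \<and> (\<forall>w\<in>W. evaluate scale T x w \<in> W)"
  using assms(1) unfolding generated_subalgebra_def
proof (induction rule: generate_ring.induct)
  case one
  then show ?case
    by (intro exI[of _ 1]) (simp add: one_presented_algebra evaluates_1 evaluate_1)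
next
  case (incl h)
  then show ?case
  proof
    assume "h \<in> range (\<lambda>c. c \<odot>\<^bsub>presented_algebra rels\<^esub> \<one>\<^bsub>presented_algebra rels\<^esub>)"
    then obtain c where "h = quot rels (fconst c)"
      by (auto simp: presented_algebra_simps)
    then show ?thesis
      using W(1) by (intro exI[of _ "fconst c"])
        (simp add: evaluates_fconst evaluate_fconst subspace_scale)
  next
    assume "h \<in> (\<lambda>g. quot rels (fvar g)) ` H"
    then obtain g where "g \<in> H" "h = quot rels (fvar g)" by auto
    then show ?thesis
      using W(2) by (intro exI[of _ "fvar g"]) (simp add: evaluates_fvar evaluate_fvar)
  qed
next
  case (a_inv h)
  then obtain x where "h = quot rels x" "evaluates x" "\<forall>w\<in>W. evaluate scale T x w \<in> W" by blast
  then show ?case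
    using W(1) by (intro exI[of _ "- x"])
      (simp add: a_inv_presented_algebra evaluates_uminus evaluate_uminus subspace_neg)
next
  case (eng_add h h')
  then obtain x y where "h = quot rels x" "evaluates x" "\<forall>w\<in>W. evaluate scale T x w \<in> W"
    "h' = quot rels y" "evaluates y" "\<forall>w\<in>W. evaluate scale T y w \<in> W" by blast
  then show ?case
    using W(1) by (intro exI[of _ "x + y"])
      (simp add: add_presented_algebra evaluates_add evaluate_add subspace_add)
next
  case (eng_mult h h')
  then obtain x y where "h = quot rels x" "evaluates x" "\<forall>w\<in>W. evaluate scale T x w \<in> W"
    "h' = quot rels y" "evaluates y" "\<forall>w\<in>W. evaluate scale T y w \<in> W" by blast
  then show ?case
    by (intro exI[of _ "x * y"])
      (simp add: mult_presented_algebra evaluates_mult evaluate_mult[OF lin_T])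
qed

end

lemma quot_generated_subalgebra:
  fixes rels :: "('g, 'a::field) free_algebra set" and H :: "'g set"
  defines "S \<equiv> generated_subalgebra (presented_algebra rels) ((\<lambda>g. quot rels (fvar g)) ` H)"
  shows "quot rels x \<in> S \<Longrightarrow> quot rels y \<in> S \<Longrightarrow> quot rels (x + y) \<in> S"
    and "quot rels x \<in> S \<Longrightarrow> quot rels y \<in> S \<Longrightarrow> quot rels (x * y) \<in> S"
    and "quot rels (fconst c) \<in> S"
    and "g \<in> H \<Longrightarrow> quot rels (fvar g) \<in> S"
    and "S \<subseteq> carrier (presented_algebra rels)"
proof -
  interpret ring "presented_algebra rels" by (rule ring_presented_algebra)
  show "quot rels x \<in> S \<Longrightarrow> quot rels y \<in> S \<Longrightarrow> quot rels (x + y) \<in> S"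
    unfolding S_def generated_subalgebra_def add_presented_algebra[symmetric]
    by (rule generate_ring.eng_add)
  show "quot rels x \<in> S \<Longrightarrow> quot rels y \<in> S \<Longrightarrow> quot rels (x * y) \<in> S"
    unfolding S_def generated_subalgebra_def mult_presented_algebra[symmetric]
    by (rule generate_ring.eng_mult)
  have "quot rels (fconst c) = c \<odot>\<^bsub>presented_algebra rels\<^esub> \<one>\<^bsub>presented_algebra rels\<^esub>"
    by (simp add: presented_algebra_simps)
  then show "quot rels (fconst c) \<in> S"
    unfolding S_def generated_subalgebra_def by (auto intro: generate_ring.incl)
  show "g \<in> H \<Longrightarrow> quot rels (fvar g) \<in> S"
    unfolding S_def generated_subalgebra_def by (auto intro: generate_ring.incl)
  show "S \<subseteq> carrier (presented_algebra rels)"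
    unfolding S_def generated_subalgebra_def
    by (rule generate_ring_incl) (auto simp: carrier_presented_algebra presented_algebra_simps)
qed

section \<open>Modules over the quantized enveloping algebra\<close>

definition borel_gens :: "'n uq_gen set" where
  "borel_gens = range GenE \<union> range GenK \<union> range GenKinv"

lemma borel_gens_intros: "GenE i \<in> borel_gens" "GenK i \<in> borel_gens" "GenKinv i \<in> borel_gens"
  by (auto simp: borel_gens_def)

lemma uq_gen_eq_quot: "uq_gen A s q g = quot (uq_relations A s q) (fvar g)"
  by (simp add: uq_gen_def presented_gen_eq_quot)

lemma carrier_uq: "carrier (uq A s q) = range (quot (uq_relations A s q))"
  by (simp add: uq_def carrier_presented_algebra)

lemma carrier_uq_borel:
  "carrier (uq_borel A s q) = generated_subalgebra (presented_algebra (uq_relations A s q))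
    ((\<lambda>g. quot (uq_relations A s q) (fvar g)) ` borel_gens)"
  by (simp add: uq_borel_def uq_def uq_gen_eq_quot borel_gens_def cong: image_cong)

lemma uq_borel_eq:
  "uq_borel A s q = presented_algebra (uq_relations A s q)\<lparr>carrier := carrier (uq_borel A s q)\<rparr>"
  by (simp add: uq_borel_def uq_def)

lemma uq_eq: "uq A s q = presented_algebra (uq_relations A s q)\<lparr>carrier := carrier (uq A s q)\<rparr>"
  by (simp add: uq_def)

lemma carrier_uq_borel_subset: "carrier (uq_borel A s q) \<subseteq> carrier (uq A s q)"
  using quot_generated_subalgebra(5)[of "uq_relations A s q" borel_gens]
  by (simp add: carrier_uq_borel uq_def)

lemma (in vector_space) evaluate_serre_poly:
  assumes T: "\<And>g. lin scale (T g)"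
  shows "evaluate scale T (serre_poly A s q (\<lambda>i. fvar (G i)) i j) v
    = serre_op scale (q ^ s i) (T (G i)) (T (G j)) (nat (1 - A $ i $ j)) v"
proof -
  have "evaluate scale T (fvar g) = T g" for g
    by (simp add: fun_eq_iff evaluate_fvar)
  then show ?thesis
    by (simp add: serre_poly_def serre_op_def Let_def evaluate_sum evaluate_mult[OF T]
        evaluate_fconst evaluate_power[OF T] atLeast0AtMost)
qed

lemma uq_relation_intros:
  "fK i * fKinv i - 1 \<in> uq_relations A s q"
  "fKinv i * fK i - 1 \<in> uq_relations A s q"
  "fK i * fK j - fK j * fK i \<in> uq_relations A s q"
  "fK i * fE j * fKinv i - fconst ((q ^ s i) powi (A $ i $ j)) * fE j \<in> uq_relations A s q"
  "fK i * fF j * fKinv i - fconst ((q ^ s i) powi (- (A $ i $ j))) * fF j \<in> uq_relations A s q"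
  "fE i * fF j - fF j * fE i
    - (if i = j then fconst (inverse (q ^ s i - inverse (q ^ s i))) * (fK i - fKinv i) else 0)
    \<in> uq_relations A s q"
  "i \<noteq> j \<Longrightarrow> serre_poly A s q fE i j \<in> uq_relations A s q"
  "i \<noteq> j \<Longrightarrow> serre_poly A s q fF i j \<in> uq_relations A s q"
  unfolding uq_relations_def by blast+

locale uq_action = subalgebra_action scale "uq_relations A s q" S H T act
  for scale :: "'a::field \<Rightarrow> 'b::ab_group_add \<Rightarrow> 'b"
    and A :: "int ^ 'n::finite ^ 'n" and s :: "'n \<Rightarrow> nat" and q :: 'a
    and S :: "('n uq_gen, 'a) free_algebra set set" and H :: "'n uq_gen set"
    and T :: "'n uq_gen \<Rightarrow> 'b \<Rightarrow> 'b"
    and act :: "('n uq_gen, 'a) free_algebra set \<Rightarrow> 'b \<Rightarrow> 'b" +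
  assumes borel_gens_subset: "borel_gens \<subseteq> H"
begin

lemma gens_in_H: "GenE i \<in> H" "GenK i \<in> H" "GenKinv i \<in> H"
  by (rule subsetD[OF borel_gens_subset], rule borel_gens_intros)+

lemmas evaluate_simps = evaluate_mult[OF lin_T] evaluate_add evaluate_diff evaluate_fvar
  evaluate_fconst evaluate_1 evaluate_0

lemma K_Kinv: "T (GenK i) (T (GenKinv i) v) = v"
  and Kinv_K: "T (GenKinv i) (T (GenK i) v) = v"
  and K_K: "T (GenK i) (T (GenK j) v) = T (GenK j) (T (GenK i) v)"
  using relation_evaluates_to_0[OF uq_relation_intros(1), of i v]
    relation_evaluates_to_0[OF uq_relation_intros(2), of i v]
    relation_evaluates_to_0[OF uq_relation_intros(3), of i j v]
  by (simp_all add: evaluates_intros gens_in_H evaluate_simps)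

text \<open>The relation is applied to \<open>K v\<close>, which cancels its trailing inverse of
  \<open>K\<close>.\<close>

lemma K_E: "T (GenK i) (T (GenE j) v) = scale ((q ^ s i) powi (A $ i $ j)) (T (GenE j) (T (GenK i) v))"
  using relation_evaluates_to_0[OF uq_relation_intros(4), of i j "T (GenK i) v"]
  by (simp add: evaluates_intros gens_in_H evaluate_simps Kinv_K)

lemma serre_E:
  assumes "i \<noteq> j"
  shows "serre_op scale (q ^ s i) (T (GenE i)) (T (GenE j)) (nat (1 - A $ i $ j)) v = 0"
proof -
  have "evaluates (serre_poly A s q fE i j)"
    unfolding serre_poly_def Let_def by (intro evaluates_intros gens_in_H)
  from relation_evaluates_to_0[OF uq_relation_intros(7)[OF assms] this] show ?thesis
    by (simp add: evaluate_serre_poly[OF lin_T])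
qed

lemma K_F:
  assumes "H = UNIV"
  shows "T (GenK i) (T (GenF j) v)
    = scale ((q ^ s i) powi (- (A $ i $ j))) (T (GenF j) (T (GenK i) v))"
  using relation_evaluates_to_0[OF uq_relation_intros(5) evaluates_all[OF assms], of i j "T (GenK i) v"]
  by (simp add: evaluate_simps Kinv_K)

lemma E_F:
  assumes "H = UNIV"
  shows "T (GenE i) (T (GenF i) v) - T (GenF i) (T (GenE i) v)
    = scale (inverse (q ^ s i - inverse (q ^ s i))) (T (GenK i) v - T (GenKinv i) v)"
  using relation_evaluates_to_0[OF uq_relation_intros(6) evaluates_all[OF assms], of i i v]
  by (simp add: evaluate_simps)

lemma borel_family:
  assumes "gen_cartan_matrix A" "symmetrizer A s" "q \<noteq> 0" "\<And>k::nat. k > 0 \<Longrightarrow> q ^ k \<noteq> 1"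
    and "\<And>i. \<epsilon> i \<in> {1, -1}" "finite_dim"
    and "\<And>i. acts_semisimply (T (GenK i))"
    and "\<And>i \<theta>. \<theta> \<in> vector_space.eigenvalues scale (T (GenK i)) \<Longrightarrow> \<exists>m::int. \<theta> = \<epsilon> i * (q ^ s i) powi m"
  shows "borel_family scale A s q \<epsilon> (\<lambda>i. T (GenE i)) (\<lambda>i. T (GenK i)) (\<lambda>i. T (GenKinv i))"
proof (intro borel_family.intro borel_family_axioms.intro)
  show "vector_space scale" by (rule vector_space_axioms)
  show "\<exists>B. finite B \<and> span B = UNIV" using assms(6) by (simp add: finite_dim_def)
  show "span {v. \<exists>\<theta>. T (GenK i) v = scale \<theta> v} = UNIV" for i
    using assms(7) by (simp add: acts_semisimply_def)
  show "\<exists>m::int. \<theta> = \<epsilon> i * (q ^ s i) powi m" if "v \<noteq> 0" "T (GenK i) v = scale \<theta> v" for v i \<theta>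
    using assms(8)[of \<theta> i] that by (auto simp: eigenvalues_def)
qed (use assms(1-5) in \<open>auto simp: gen_cartan_matrix_def symmetrizer_def lin_T K_Kinv Kinv_K K_E
    intro: K_K\<close>)

end

lemma (in vector_space) eigenvalue_iff_weight_space:
  assumes "lin scale K"
  shows "\<epsilon> * p powi k \<in> vector_space.eigenvalues scale K \<longleftrightarrow> weight_space scale K \<epsilon> p k \<noteq> {0}"
  using lin_0[OF assms] by (auto simp: vector_space.eigenvalues_def[OF vector_space_axioms] weight_space_def)

lemma uq_action_borel:
  assumes "alg_module smul (uq_borel A s q) act"
    and "\<And>g. lin smul (T g)"
    and "\<And>g. g \<in> borel_gens \<Longrightarrow> act (quot (uq_relations A s q) (fvar g)) = T g"
  shows "uq_action smul A s q (carrier (uq_borel A s q)) borel_gens T act"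
proof (intro uq_action.intro uq_action_axioms.intro subalgebra_action.intro
    subalgebra_action_axioms.intro)
  show "vector_space smul" using assms(1) by (rule alg_module.axioms(1))
  show "alg_module smul (presented_algebra (uq_relations A s q)\<lparr>carrier := carrier (uq_borel A s q)\<rparr>) act"
    using assms(1) uq_borel_eq by metis
qed (use assms(2,3) in \<open>auto simp: carrier_uq_borel intro: quot_generated_subalgebra\<close>)

lemma uq_action_uq:
  assumes "alg_module smul (uq A s q) act"
    and "\<And>g. act (quot (uq_relations A s q) (fvar g)) = T g"
  shows "uq_action smul A s q (carrier (uq A s q)) UNIV T act"
proof (intro uq_action.intro uq_action_axioms.intro subalgebra_action.intro
    subalgebra_action_axioms.intro)
  show "vector_space smul" using assms(1) by (rule alg_module.axioms(1))
  show "alg_module smul (presented_algebra (uq_relations A s q)\<lparr>carrier := carrier (uq A s q)\<rparr>) act"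
    using assms(1) uq_eq by metis
  show "lin smul (T g)" for g
    using alg_module.act_linear[OF assms(1), of "quot (uq_relations A s q) (fvar g)"] assms(2)
    by (simp add: carrier_uq)
qed (use assms(2) in \<open>auto simp: carrier_uq\<close>)

lemma alg_module_borel:
  assumes "alg_module smul (uq A s q) act"
  shows "alg_module smul (uq_borel A s q) act"
proof -
  interpret alg_module smul "uq A s q" act by fact
  have ops: "x \<oplus>\<^bsub>uq_borel A s q\<^esub> y = x \<oplus>\<^bsub>uq A s q\<^esub> y"
    "x \<otimes>\<^bsub>uq_borel A s q\<^esub> y = x \<otimes>\<^bsub>uq A s q\<^esub> y"
    "c \<odot>\<^bsub>uq_borel A s q\<^esub> x = c \<odot>\<^bsub>uq A s q\<^esub> x" "\<one>\<^bsub>uq_borel A s q\<^esub> = \<one>\<^bsub>uq A s q\<^esub>" for x y c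
    by (simp_all add: uq_borel_def)
  show ?thesis
    by (intro alg_module.intro alg_module_axioms.intro)
      (use carrier_uq_borel_subset[of A s q] vector_space_axioms in
        \<open>auto simp: ops act_linear act_add act_smult act_mult act_one subset_iff\<close>)
qed

section \<open>Extension from the Borel subalgebra and restriction to it\<close>

lemma borel_extends:
  fixes A :: "int ^ 'n::finite ^ 'n" and s :: "'n \<Rightarrow> nat" and q :: "'a::field"
    and smul :: "'a \<Rightarrow> 'v::ab_group_add \<Rightarrow> 'v"
  assumes A: "gen_cartan_matrix A" and s: "symmetrizer A s"
    and q: "q \<noteq> 0" "\<And>k::nat. k > 0 \<Longrightarrow> q ^ k \<noteq> 1"
    and \<epsilon>: "\<And>i. \<epsilon> i \<in> {1, -1}"
    and act: "fd_irreducible smul (uq_borel A s q) act" "borel_type smul A s q act \<epsilon>"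
  shows "\<exists>act'. extends_to_uq smul A s q act act' \<and>
    (\<forall>act''. extends_to_uq smul A s q act act'' \<longrightarrow> (\<forall>x \<in> carrier (uq A s q). act'' x = act' x)) \<and>
    fd_irreducible smul (uq A s q) act' \<and> uq_type smul A s q act' \<epsilon>"
proof -
  define rels where "rels = uq_relations A s q"
  have module: "alg_module smul (uq_borel A s q) act"
    and fd: "vector_space.finite_dim smul"
    and irr: "alg_module.irreducible_module smul (uq_borel A s q) act"
    using act(1) by (auto simp: fd_irreducible_def)
  interpret M: alg_module smul "uq_borel A s q" act by (rule module)
  \<comment> \<open>The Borel action does not specify operators for \<open>GenF\<close>; 0 is a
    linear placeholder.\<close>
  define T where "T g = (if g \<in> borel_gens then act (quot rels (fvar g)) else (\<lambda>_. 0))" for g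
  have gen_carrier: "quot rels (fvar g) \<in> carrier (uq_borel A s q)" if "g \<in> borel_gens" for g
    unfolding carrier_uq_borel rels_def using that by (rule quot_generated_subalgebra)
  have lin_T: "lin smul (T g)" for g
    using M.act_linear gen_carrier by (auto simp: T_def M.lin_const_0)
  interpret T: uq_action smul A s q "carrier (uq_borel A s q)" borel_gens T act
    by (rule uq_action_borel[OF module lin_T]) (simp add: T_def rels_def)
  have T_K: "T (GenK i) = act (uq_gen A s q (GenK i))" for i
    by (simp add: T_def borel_gens_intros uq_gen_eq_quot rels_def)
  have type: "M.acts_semisimply (T (GenK i))"
    "\<exists>\<Delta>. M.eigenvalues (T (GenK i)) = (\<lambda>\<theta>. \<epsilon> i * \<theta>) ` \<Delta> \<and>
      \<Delta> \<subseteq> {(q ^ s i) powi m | m::int. True} \<and> \<Delta> = inverse ` \<Delta>" for i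
    using act(2) unfolding T_K borel_type_def Let_def by auto
  have eigenvalue: "\<exists>m::int. \<theta> = \<epsilon> i * (q ^ s i) powi m" if \<theta>: "\<theta> \<in> M.eigenvalues (T (GenK i))" for i \<theta>
  proof -
    obtain \<Delta> where \<Delta>: "M.eigenvalues (T (GenK i)) = (\<lambda>\<theta>. \<epsilon> i * \<theta>) ` \<Delta>"
      "\<Delta> \<subseteq> {(q ^ s i) powi m | m::int. True}"
      using type(2)[of i] by blast
    obtain \<delta> where "\<delta> \<in> \<Delta>" "\<theta> = \<epsilon> i * \<delta>" using \<theta> unfolding \<Delta>(1) by blast
    then show ?thesis using \<Delta>(2) by blast
  qed
  define E K L where "E i = T (GenE i)" and "K i = T (GenK i)" and "L i = T (GenKinv i)" for i
  note EKL = E_def[abs_def] K_def[abs_def] L_def[abs_def]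
  have fam: "borel_family smul A s q \<epsilon> E K L"
    unfolding EKL
    by (rule T.borel_family[OF A s q \<epsilon> fd type(1) eigenvalue])
  interpret fam: borel_family smul A s q \<epsilon> E K L by (rule fam)
  interpret irr: irreducible_borel_family smul A s q \<epsilon> E K L
  proof
    show "serre_op smul (q ^ s i) (E i) (E j) (nat (1 - A $ i $ j)) v = 0" if "i \<noteq> j" for i j v
      unfolding EKL by (rule T.serre_E[OF that])
    show "\<exists>u::'v. u \<noteq> 0"
      using irr by (simp add: M.irreducible_module_def)
    show "W = {0} \<or> W = UNIV" if W: "M.subspace W" "\<And>i w. w \<in> W \<Longrightarrow> E i w \<in> W"
      "\<And>i w. w \<in> W \<Longrightarrow> K i w \<in> W" "\<And>i w. w \<in> W \<Longrightarrow> L i w \<in> W" for W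
    proof -
      have "T g w \<in> W" if "g \<in> borel_gens" "w \<in> W" for g w
        using that W(2-4) by (auto simp: borel_gens_def EKL)
      then have "act x ` W \<subseteq> W" if "x \<in> carrier (uq_borel A s q)" for x
        using T.generated_subalgebra_evaluates[OF that[unfolded carrier_uq_borel] W(1)]
        by (fastforce simp: T.evaluates_def)
      then show ?thesis
        using irr W(1) unfolding M.irreducible_module_def by blast
    qed
    \<comment> \<open>Dividing an eigenvalue by the sign lands in the set \<open>\<Delta>\<close> of
      the type, which is closed under inversion.\<close>
    show "fam.V i (- k) \<noteq> {0}" if "fam.V i k \<noteq> {0}" for i k
    proof -
      obtain \<Delta> where \<Delta>: "M.eigenvalues (K i) = (\<lambda>\<theta>. \<epsilon> i * \<theta>) ` \<Delta>" "\<Delta> = inverse ` \<Delta>"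
        using type(2)[of i] unfolding EKL by blast
      have "\<epsilon> i * (q ^ s i) powi k \<in> M.eigenvalues (K i)"
        using that M.eigenvalue_iff_weight_space[OF fam.lin_K] by blast
      then have "(q ^ s i) powi k \<in> \<Delta>"
        unfolding \<Delta>(1) using fam.sign_nonzero[of i] by auto
      then have "(q ^ s i) powi (- k) \<in> \<Delta>"
        unfolding power_int_minus using \<Delta>(2) by blast
      then have "\<epsilon> i * (q ^ s i) powi (- k) \<in> M.eigenvalues (K i)"
        unfolding \<Delta>(1) by blast
      then show ?thesis
        using M.eigenvalue_iff_weight_space[OF fam.lin_K] by blast
    qed
  qed
  \<comment> \<open>The reconstructed lowering operators replace the placeholder.\<close>
  define T' where "T' g = (case g of GenF i \<Rightarrow> irr.F i | _ \<Rightarrow> T g)" for g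
  have T'_simps: "T' (GenE i) = E i" "T' (GenF i) = irr.F i" "T' (GenK i) = K i" "T' (GenKinv i) = L i" for i
    by (simp_all add: T'_def EKL)
  have T'_borel: "T' g = T g" if "g \<in> borel_gens" for g
    using that by (auto simp: T'_def borel_gens_def)
  have lin_T': "lin smul (T' g)" for g
    by (cases g) (simp_all add: T'_simps fam.lin_E fam.lin_K fam.lin_L irr.sl2.lin_F)
  note ev = M.evaluate_mult[OF lin_T'] M.evaluate_add M.evaluate_diff M.evaluate_fvar
    M.evaluate_fconst M.evaluate_1 M.evaluate_0 M.evaluate_serre_poly[OF lin_T'] T'_simps
  interpret P: presented_action smul rels T'
  proof (intro presented_action.intro presented_action_axioms.intro)
    show "vector_space smul" by (rule M.vector_space_axioms)
    show "lin smul (T' g)" for g by (rule lin_T')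
    fix x v assume "x \<in> rels"
    then show "evaluate smul T' x v = 0"
      unfolding rels_def uq_relations_def
    proof (elim UnE CollectE exE conjE)
      fix i j assume "x = fE i * fF j - fF j * fE i - (if i = j
        then fconst (inverse (q ^ s i - inverse (q ^ s i))) * (fK i - fKinv i) else 0)"
      then show "evaluate smul T' x v = 0"
        using irr.usl2.E_F[of i v] irr.F_E_commute[of i j v] by (cases "i = j") (simp_all add: ev)
    qed (simp_all add: ev fam.K_L fam.L_K fam.K_K fam.K_E irr.K_F irr.serre irr.serre_F)
  qed
  define act' where "act' = P.action"
  have act'_quot: "act' (quot rels x) = evaluate smul T' x" for x
    by (simp add: act'_def P.action_quot)
  have module': "alg_module smul (uq A s q) act'"
    using P.alg_module_action by (simp add: act'_def uq_def rels_def)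
  interpret M': alg_module smul "uq A s q" act' by (rule module')
  interpret T': uq_action smul A s q "carrier (uq_borel A s q)" borel_gens T' act
    by (rule uq_action_borel[OF module lin_T']) (simp add: T'_borel T_def rels_def)
  have agree: "act' x = act x" if x: "x \<in> carrier (uq_borel A s q)" for x
  proof -
    obtain y where y: "x = quot rels y" "T'.evaluates y"
      using T'.generated_subalgebra_evaluates[OF x[unfolded carrier_uq_borel] M.subspace_UNIV]
      unfolding rels_def by blast
    have "act x v = evaluate smul T' y v" for v
      using y unfolding rels_def T'.evaluates_def by simp
    then show ?thesis
      unfolding y(1) act'_quot by (simp add: fun_eq_iff)
  qed
  have "extends_to_uq smul A s q act act'"
    unfolding extends_to_uq_def using module' agree by blast
  \<comment> \<open>Another extension agrees on the Borel generators, and its \<open>GenF\<close>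
    operators complete them to quantum sl(2)-modules, where the lowering operator is unique. Both
    actions then evaluate the same operators.\<close>
  moreover have "act'' x = act' x"
    if extends: "extends_to_uq smul A s q act act''" and x: "x \<in> carrier (uq A s q)" for act'' x
  proof -
    have module'': "alg_module smul (uq A s q) act''"
      and agree'': "\<And>x. x \<in> carrier (uq_borel A s q) \<Longrightarrow> act'' x = act x"
      using extends by (auto simp: extends_to_uq_def)
    define T'' where "T'' g = act'' (quot rels (fvar g))" for g
    interpret T'': uq_action smul A s q "carrier (uq A s q)" UNIV T'' act''
      by (rule uq_action_uq[OF module'']) (simp add: T''_def rels_def)
    have borel: "T'' g = T' g" if "g \<in> borel_gens" for g
      using agree''[OF gen_carrier[OF that]] that by (simp add: T''_def T'_borel T_def)
    have EKL'': "T'' (GenE i) = E i" "T'' (GenK i) = K i" "T'' (GenKinv i) = L i" for i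
      by (simp_all add: borel borel_gens_intros T'_simps)
    have "uq_sl2_module smul (q ^ s i) (\<epsilon> i) (E i) (T'' (GenF i)) (K i) (L i)" for i
    proof (intro uq_sl2_module.intro uq_sl2_module_axioms.intro)
      show "K i (T'' (GenF i) v) = smul ((q ^ s i) powi (- 2)) (T'' (GenF i) (K i v))" for v
        using T''.K_F[of i i v] by (simp add: EKL'' fam.cartan_diag)
      show "E i (T'' (GenF i) v) - T'' (GenF i) (E i v)
        = smul (inverse (q ^ s i - inverse (q ^ s i))) (K i v - L i v)" for v
        using T''.E_F[of i v] by (simp add: EKL'')
    qed (rule M.vector_space_axioms fam.generic_q \<epsilon> fam.lin_E T''.lin_T fam.lin_K fam.lin_L fam.K_L
        fam.L_K fam.sl2.K_E fam.sl2.span_weight_spaces fam.sl2.weights_bounded)+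
    then have "T'' (GenF i) = irr.F i" for i
      by (rule irr.sl2.F_unique)
    then have "T'' g = T' g" for g
      by (cases g) (simp_all add: EKL'' T'_simps)
    then have "T'' = T'" by (rule ext)
    obtain y where y: "x = quot rels y" using x by (auto simp: carrier_uq rels_def)
    have "T''.evaluates y" by (rule T''.evaluates_all) simp
    then have "act'' x v = evaluate smul T'' y v" for v
      unfolding y rels_def T''.evaluates_def by simp
    then show ?thesis
      unfolding y act'_quot \<open>T'' = T'\<close> by (simp add: fun_eq_iff)
  qed
  moreover have "fd_irreducible smul (uq A s q) act'"
  proof -
    \<comment> \<open>A subspace stable under the larger algebra is stable under the Borel
      subalgebra, over which irreducibility is given.\<close>
    have "W = {0} \<or> W = UNIV" if W: "M.subspace W" "\<forall>x\<in>carrier (uq A s q). act' x ` W \<subseteq> W" for W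
    proof -
      have "act x ` W \<subseteq> W" if x: "x \<in> carrier (uq_borel A s q)" for x
      proof -
        have "x \<in> carrier (uq A s q)" using carrier_uq_borel_subset x by (rule subsetD)
        then show ?thesis using W(2) agree[OF x] by metis
      qed
      then show ?thesis using irr W(1) unfolding M.irreducible_module_def by blast
    qed
    then have "M'.irreducible_module"
      using irr by (simp add: M'.irreducible_module_def M.irreducible_module_def)
    then show ?thesis using module' fd by (simp add: fd_irreducible_def)
  qed
  moreover have "uq_type smul A s q act' \<epsilon>"
  proof -
    have "act' (uq_gen A s q (GenK i)) = T (GenK i)" for i
      by (simp add: uq_gen_eq_quot act'_quot[unfolded rels_def] fun_eq_iff M.evaluate_fvar T'_simps EKL)
    then show ?thesis
      unfolding uq_type_def Let_def using type(1) eigenvalue \<epsilon> by simp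
  qed
  ultimately show ?thesis by blast
qed

lemma uq_restricts:
  fixes A :: "int ^ 'n::finite ^ 'n" and s :: "'n \<Rightarrow> nat" and q :: "'a::field"
    and smul :: "'a \<Rightarrow> 'v::ab_group_add \<Rightarrow> 'v"
  assumes A: "affine_cartan_matrix A" and s: "symmetrizer A s"
    and q: "q \<noteq> 0" "\<And>k::nat. k > 0 \<Longrightarrow> q ^ k \<noteq> 1"
    and \<epsilon>: "\<And>i. \<epsilon> i \<in> {1, -1}"
    and act: "fd_irreducible smul (uq A s q) act" "uq_type smul A s q act \<epsilon>"
  shows "fd_irreducible smul (uq_borel A s q) act \<and> borel_type smul A s q act \<epsilon>"
proof -
  define rels where "rels = uq_relations A s q"
  have A': "gen_cartan_matrix A" using A by (simp add: affine_cartan_matrix_def)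
  obtain u where u: "\<And>i. u $ i > 0" "real_matrix A *v u = 0"
    using A by (auto simp: affine_cartan_matrix_def)
  have module: "alg_module smul (uq A s q) act"
    and fd: "vector_space.finite_dim smul"
    and irr: "alg_module.irreducible_module smul (uq A s q) act"
    using act(1) by (auto simp: fd_irreducible_def)
  interpret M: alg_module smul "uq A s q" act by (rule module)
  define T where "T g = act (quot rels (fvar g))" for g
  interpret T: uq_action smul A s q "carrier (uq A s q)" UNIV T act
    by (rule uq_action_uq[OF module]) (simp add: T_def rels_def)
  have T_K: "T (GenK i) = act (uq_gen A s q (GenK i))" for i
    by (simp add: T_def uq_gen_eq_quot rels_def)
  have type: "M.acts_semisimply (T (GenK i))"
    "\<And>\<theta>. \<theta> \<in> M.eigenvalues (T (GenK i)) \<Longrightarrow> \<exists>m::int. \<theta> = \<epsilon> i * (q ^ s i) powi m" for i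
    using act(2) unfolding T_K uq_type_def Let_def by auto
  define E F K L where "E i = T (GenE i)" and "F i = T (GenF i)" and "K i = T (GenK i)"
    and "L i = T (GenKinv i)" for i
  note EFKL = E_def[abs_def] F_def[abs_def] K_def[abs_def] L_def[abs_def]
  have fam: "borel_family smul A s q \<epsilon> E K L"
    unfolding EFKL by (rule T.borel_family[OF A' s q \<epsilon> fd type])
  interpret fam: borel_family smul A s q \<epsilon> E K L by (rule fam)
  interpret uq: uq_family smul A s q \<epsilon> E K L F "\<lambda>i. u $ i"
  proof
    show "(\<Sum>j\<in>UNIV. real_of_int (A $ i $ j) * u $ j) = 0" for i
      using arg_cong[OF u(2), of "\<lambda>x. x $ i"]
      by (simp add: matrix_vector_mult_def real_matrix_def)
    show "W = {0} \<or> W = UNIV" if W: "M.subspace W" "\<And>i w. w \<in> W \<Longrightarrow> E i w \<in> W"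
      "\<And>i w. w \<in> W \<Longrightarrow> F i w \<in> W" "\<And>i w. w \<in> W \<Longrightarrow> K i w \<in> W" "\<And>i w. w \<in> W \<Longrightarrow> L i w \<in> W" for W
    proof -
      have T_W: "T g w \<in> W" if "w \<in> W" for g w
        using that W(2-5) by (cases g) (simp_all add: EFKL)
      have "act x ` W \<subseteq> W" if x: "x \<in> carrier (uq A s q)" for x
      proof -
        obtain y where y: "x = quot rels y" using x by (auto simp: carrier_uq rels_def)
        have "T.evaluates y" by (rule T.evaluates_all) simp
        then have "act x w = evaluate smul T y w" for w
          unfolding y rels_def T.evaluates_def by simp
        then show ?thesis using M.evaluate_in_subspace[OF W(1) T_W] by auto
      qed
      then show ?thesis
        using irr W(1) unfolding M.irreducible_module_def by blast
    qed
  qed (use u(1) in \<open>simp_all add: EFKL T.K_F T.E_F M.lin_add[OF T.lin_T] M.lin_scale[OF T.lin_T]\<close>)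
  have module': "alg_module smul (uq_borel A s q) act"
    by (rule alg_module_borel[OF module])
  interpret M': alg_module smul "uq_borel A s q" act by (rule module')
  have gen_carrier: "quot rels (fvar g) \<in> carrier (uq_borel A s q)" if "g \<in> borel_gens" for g
    unfolding carrier_uq_borel rels_def using that by (rule quot_generated_subalgebra)
  have "W = {0} \<or> W = UNIV"
    if W: "M.subspace W" "\<forall>x\<in>carrier (uq_borel A s q). act x ` W \<subseteq> W" for W
  proof -
    have "T g w \<in> W" if "g \<in> borel_gens" "w \<in> W" for g w
      using W(2) gen_carrier[OF that(1)] that(2) by (auto simp: T_def)
    then show ?thesis
      using uq.borel_irreducible[OF W(1)] borel_gens_intros by (metis EFKL)
  qed
  then have "M'.irreducible_module"
    using irr by (simp add: M'.irreducible_module_def M.irreducible_module_def)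
  then have "fd_irreducible smul (uq_borel A s q) act"
    using module' fd by (simp add: fd_irreducible_def)
  moreover have "borel_type smul A s q act \<epsilon>"
    unfolding borel_type_def Let_def T_K[symmetric]
  proof (intro allI conjI)
    fix i
    show "M.acts_semisimply (T (GenK i))" by (rule type(1))
    show "\<epsilon> i \<noteq> 0" by (rule fam.sign_nonzero)
    \<comment> \<open>The eigenvalues with the sign divided out, as \<open>\<epsilon> i\<close> is
      its own inverse.\<close>
    let ?\<Delta> = "{\<theta>. \<epsilon> i * \<theta> \<in> M.eigenvalues (T (GenK i))}"
    have sq: "\<epsilon> i * (\<epsilon> i * x) = x" for x using \<epsilon>[of i] by auto
    have powers: "\<exists>m::int. \<theta> = (q ^ s i) powi m" if "\<theta> \<in> ?\<Delta>" for \<theta>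
      using type(2)[of "\<epsilon> i * \<theta>" i] that fam.sign_nonzero[of i] by auto
    have inverse: "inverse \<theta> \<in> ?\<Delta>" if \<theta>: "\<theta> \<in> ?\<Delta>" for \<theta>
    proof -
      obtain m :: int where m: "\<theta> = (q ^ s i) powi m" using powers[OF \<theta>] by blast
      have "fam.V i m \<noteq> {0}"
        using \<theta> M.eigenvalue_iff_weight_space[OF fam.lin_K[of i]] by (simp add: m K_def)
      then have "fam.V i (- m) \<noteq> {0}" by (rule uq.V_symmetric)
      then show ?thesis
        using M.eigenvalue_iff_weight_space[OF fam.lin_K[of i]] by (simp add: m K_def power_int_minus[symmetric])
    qed
    have "M.eigenvalues (T (GenK i)) = (\<lambda>\<theta>. \<epsilon> i * \<theta>) ` ?\<Delta>"
      using sq by (auto simp: image_iff) (metis sq)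
    moreover have "?\<Delta> = inverse ` ?\<Delta>"
    proof (intro equalityI subsetI)
      fix \<theta> assume "\<theta> \<in> ?\<Delta>"
      then have "inverse (inverse \<theta>) \<in> inverse ` ?\<Delta>" by (intro imageI inverse)
      then show "\<theta> \<in> inverse ` ?\<Delta>" by simp
    next
      fix \<theta> assume "\<theta> \<in> inverse ` ?\<Delta>"
      then show "\<theta> \<in> ?\<Delta>" using inverse by (elim imageE) simp
    qed
    ultimately show "\<exists>\<Delta>. M.eigenvalues (T (GenK i)) = (\<lambda>\<theta>. \<epsilon> i * \<theta>) ` \<Delta> \<and>
        \<Delta> \<subseteq> {(q ^ s i) powi m | m::int. True} \<and> \<Delta> = inverse ` \<Delta>"
      using powers by (intro exI[of _ ?\<Delta>]) blast
  qed
  ultimately show ?thesis by blast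
qed

theorem theorem8p1:
  fixes A :: "int ^ 'n::finite ^ 'n"
    and s :: "'n \<Rightarrow> nat"
    and q :: "'a::{alg_closed_field, field_char_0}"
    and \<epsilon> :: "'n \<Rightarrow> 'a"
    and smul :: "'a \<Rightarrow> 'v::ab_group_add \<Rightarrow> 'v"
  assumes "affine_cartan_matrix A"
    and "symmetrizer A s"
    and "q \<noteq> 0"
    and "\<forall>k::nat. k > 0 \<longrightarrow> q ^ k \<noteq> 1"
    and "\<forall>i. \<epsilon> i \<in> {1, -1}"
    and "vector_space smul"
  shows
    "(\<forall>act. fd_irreducible smul (uq_borel A s q) act \<and> borel_type smul A s q act \<epsilon> \<longrightarrow>
        (\<exists>act'. extends_to_uq smul A s q act act' \<and>
           (\<forall>act''. extends_to_uq smul A s q act act'' \<longrightarrow>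
              (\<forall>x \<in> carrier (uq A s q). act'' x = act' x)) \<and>
           fd_irreducible smul (uq A s q) act' \<and>
           uq_type smul A s q act' \<epsilon>)) \<and>
     (\<forall>act. fd_irreducible smul (uq A s q) act \<and> uq_type smul A s q act \<epsilon> \<longrightarrow>
        fd_irreducible smul (uq_borel A s q) act \<and>
        borel_type smul A s q act \<epsilon>)"
proof -
  have "gen_cartan_matrix A" using assms(1) by (simp add: affine_cartan_matrix_def)
  then show ?thesis
    using borel_extends[of A s q \<epsilon> smul] uq_restricts[of A s q \<epsilon> smul] assms(1-5) by blast
qed

end
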